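(* Let $f \in \mathcal{R}$, $k \in [0,1)$ and $\alpha \in \mathbb{C}$. Let $h(r_0)\approx 1.055681$ be the constant defined in the context. Then: (1) if $|\alpha| \le 1/h(r_0) \approx 0.947255$, then $J_\alpha[f] \in \mathcal{S}$; (2) if $|\alpha| < k/h(r_0)$, then $J_\alpha[f]$ can be extended to a $k$-quasiconformal mapping of $\mathbb{C}$.
   Context: $\mathbb{D}=\{z\in\mathbb{C}:|z|<1\}$. $\mathcal{A}$ is the family of analytic functions $f$ on $\mathbb{D}$ with $f(0)=0$, $f'(0)=1$. $\mathcal{S}$ is the set of $f\in\mathcal{A}$ that are univalent (injective) on $\mathbb{D}$. $\mathcal{R}=\{f\in\mathcal{A}: \operatorname{Re} f'(z)>0 \text{ for all } z\in\mathbb{D}\}$; functions in $\mathcal{R}$ are univalent (Noshiro–Warschawski), so $f(z)/z\neq 0$ on $\mathbb{D}$ (with value $1$ at $z=0$). For $f\in\mathcal{A}$ with $f(z)/z\ne 0$ on $\mathbb{D}$ and $\alpha\in\mathbb{C}$, $J_\alpha[f](z)=\int_0^z (f(u)/u)^\alpha\,du$, where the branch is chosen so that $(f(z)/z)^\alpha=1$ at $z=0$. The constant: $h(r):=\dfrac{-(1+r)^2}{r+2\log(1-r)}-\dfrac{1-r^2}{r}$ for $r\in(0,1)$, and $r_0\approx 0.329423$ is the unique root in $(0,1)$ of $2(r^2+1)(r-1)[\log(1-r)]^2-2r(r-1)^2\log(1-r)+r^3(r+3)=0.$ A homeomorphism $F$ on a domain $G$ is $k$-quasiconformal ($0\le k<1$)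 if its distributional derivatives $\partial_{\bar z}F$ and $\partial_zF$ are locally integrable on $G$ and $|\partial_{\bar z}F|\le k|\partial_zF|$ a.e. in $G$. A $k$-quasiconformal mapping of $\mathbb{C}$ is a homeomorphism of $\mathbb{C}$ onto $\mathbb{C}$ that is $k$-quasiconformal on $\mathbb{C}$; extending a function on $\mathbb{D}$ means that the restriction of the mapping to $\mathbb{D}$ equals that function. *)

theory Defs
  imports "HOL-Complex_Analysis.Complex_Analysis"
begin

abbreviation unit_disk :: "complex set" where
  "unit_disk \<equiv> ball 0 1"

text \<open>
  Functions on the disk are total functions on the complex plane of which only the values on
  the disk matter.
\<close>

definition class_A :: "(complex \<Rightarrow> complex) set" where
  "class_A = {f. f holomorphic_on unit_disk \<and> f 0 = 0 \<and> deriv f 0 = 1}"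

definition class_S :: "(complex \<Rightarrow> complex) set" where
  "class_S = {f \<in> class_A. inj_on f unit_disk}"

definition class_R :: "(complex \<Rightarrow> complex) set" where
  "class_R = {f \<in> class_A. \<forall>z\<in>unit_disk. Re (deriv f z) > 0}"

definition quot :: "(complex \<Rightarrow> complex) \<Rightarrow> complex \<Rightarrow> complex" where
  "quot f z = (if z = 0 then 1 else f z / z)"

text \<open>
  The holomorphic branch of \<open>log (f z / z)\<close> on the disk that vanishes at the origin. It exists
  when \<open>f\<close> is in \<^const>\<open>class_A\<close> and \<open>quot f\<close> has no zero on the disk, and its values on the disk
  are then unique, so the choice made by \<open>SOME\<close> only concerns irrelevant values off the disk.
\<close>

definition log_quot :: "(complex \<Rightarrow> complex) \<Rightarrow> complex \<Rightarrow> complex" where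
  "log_quot f = (SOME L. L holomorphic_on unit_disk \<and> L 0 = 0 \<and>
                         (\<forall>z\<in>unit_disk. exp (L z) = quot f z))"

definition quot_power :: "complex \<Rightarrow> (complex \<Rightarrow> complex) \<Rightarrow> complex \<Rightarrow> complex" where
  "quot_power \<alpha> f z = exp (\<alpha> * log_quot f z)"

definition J :: "complex \<Rightarrow> (complex \<Rightarrow> complex) \<Rightarrow> complex \<Rightarrow> complex" where
  "J \<alpha> f z = contour_integral (linepath 0 z) (quot_power \<alpha> f)"

definition h :: "real \<Rightarrow> real" where
  "h r = - ((1 + r)\<^sup>2) / (r + 2 * ln (1 - r)) - (1 - r\<^sup>2) / r"

definition r0 :: real where
  "r0 = (THE r. 0 < r \<and> r < 1 \<and>
           2 * (r\<^sup>2 + 1) * (r - 1) * (ln (1 - r))\<^sup>2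
             - 2 * r * (r - 1)\<^sup>2 * ln (1 - r) + r ^ 3 * (r + 3) = 0)"

definition partial_x :: "(complex \<Rightarrow> complex) \<Rightarrow> complex \<Rightarrow> complex" where
  "partial_x \<phi> z = frechet_derivative \<phi> (at z) 1"

definition partial_y :: "(complex \<Rightarrow> complex) \<Rightarrow> complex \<Rightarrow> complex" where
  "partial_y \<phi> z = frechet_derivative \<phi> (at z) \<i>"

definition wirtinger_dz :: "(complex \<Rightarrow> complex) \<Rightarrow> complex \<Rightarrow> complex" where
  "wirtinger_dz \<phi> z = (partial_x \<phi> z - \<i> * partial_y \<phi> z) / 2"

definition wirtinger_dzbar :: "(complex \<Rightarrow> complex) \<Rightarrow> complex \<Rightarrow> complex" where
  "wirtinger_dzbar \<phi> z = (partial_x \<phi> z + \<i> * partial_y \<phi> z) / 2"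

text \<open>
  Differentiability is real (Frechet) differentiability: \<open>complex\<close> is regarded as a real vector
  space, not as a field.
\<close>

primrec C_k :: "nat \<Rightarrow> (complex \<Rightarrow> complex) \<Rightarrow> bool" where
  "C_k 0 \<phi> \<longleftrightarrow> continuous_on UNIV \<phi>"
| "C_k (Suc n) \<phi> \<longleftrightarrow> (\<forall>z. \<phi> differentiable (at z)) \<and> C_k n (partial_x \<phi>) \<and> C_k n (partial_y \<phi>)"

definition test_function_on :: "complex set \<Rightarrow> (complex \<Rightarrow> complex) \<Rightarrow> bool" where
  "test_function_on G \<phi> \<longleftrightarrow>
     (\<forall>n. C_k n \<phi>) \<and> compact (closure {z. \<phi> z \<noteq> 0}) \<and> closure {z. \<phi> z \<noteq> 0} \<subseteq> G"

definition locally_integrable_on :: "(complex \<Rightarrow> complex) \<Rightarrow> complex set \<Rightarrow> bool" where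
  "locally_integrable_on g G \<longleftrightarrow> (\<forall>K. compact K \<and> K \<subseteq> G \<longrightarrow> g absolutely_integrable_on K)"

definition distributional_dz ::
    "complex set \<Rightarrow> (complex \<Rightarrow> complex) \<Rightarrow> (complex \<Rightarrow> complex) \<Rightarrow> bool" where
  "distributional_dz G F g \<longleftrightarrow>
     (\<forall>\<phi>. test_function_on G \<phi> \<longrightarrow>
        (LINT z:G|lebesgue. F z * wirtinger_dz \<phi> z) = - (LINT z:G|lebesgue. g z * \<phi> z))"

definition distributional_dzbar ::
    "complex set \<Rightarrow> (complex \<Rightarrow> complex) \<Rightarrow> (complex \<Rightarrow> complex) \<Rightarrow> bool" where
  "distributional_dzbar G F g \<longleftrightarrow>
     (\<forall>\<phi>. test_function_on G \<phi> \<longrightarrow>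
        (LINT z:G|lebesgue. F z * wirtinger_dzbar \<phi> z) = - (LINT z:G|lebesgue. g z * \<phi> z))"

definition quasiconformal_on :: "real \<Rightarrow> complex set \<Rightarrow> (complex \<Rightarrow> complex) \<Rightarrow> bool" where
  "quasiconformal_on k G F \<longleftrightarrow>
     0 \<le> k \<and> k < 1 \<and> open G \<and> connected G \<and> G \<noteq> {} \<and>
     (\<exists>F'. homeomorphism G (F ` G) F F') \<and>
     (\<exists>Fz Fzbar.
        locally_integrable_on Fz G \<and> locally_integrable_on Fzbar G \<and>
        distributional_dz G F Fz \<and> distributional_dzbar G F Fzbar \<and>
        (AE z in lebesgue. z \<in> G \<longrightarrow> cmod (Fzbar z) \<le> k * cmod (Fz z)))"

definition quasiconformal_plane :: "real \<Rightarrow> (complex \<Rightarrow> complex) \<Rightarrow> bool" where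
  "quasiconformal_plane k F \<longleftrightarrow> quasiconformal_on k UNIV F \<and> F ` UNIV = UNIV"

definition has_quasiconformal_extension :: "real \<Rightarrow> (complex \<Rightarrow> complex) \<Rightarrow> bool" where
  "has_quasiconformal_extension k g \<longleftrightarrow>
     (\<exists>F. quasiconformal_plane k F \<and> (\<forall>z\<in>unit_disk. F z = g z))"

end

theory Submission
  imports Defs
begin

text \<open>
  Write \<open>q z = f z / z\<close>. Since the derivative of \<open>J \<alpha> f\<close> is \<open>q z\<close> to the power \<open>\<alpha>\<close>, its pre-Schwarzian
  derivative is \<open>\<alpha> * q' / q\<close>, and the result is an instance of Becker's theorem: if \<open>g' \<noteq> 0\<close> and
  \<open>cmod z * (1 - (cmod z)\<^sup>2) * cmod (g'' z / g' z) \<le> k < 1\<close> on the disk, then \<open>g\<close> extends to a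
  \<open>k\<close>-quasiconformal map of the plane. Two estimates connect this with the theorem: the bound
  \<open>cmod z * (1 - (cmod z)\<^sup>2) * cmod (q' z / q z) \<le> 1\<close> for \<open>f\<close> in \<^const>\<open>class_R\<close>
  (\<open>class_R_quotient_bound\<close>), and \<open>1 \<le> h r0\<close> (\<open>h_ge_1\<close>), which turns the hypotheses into
  \<open>cmod \<alpha> \<le> 1\<close> and \<open>cmod \<alpha> \<le> k\<close>. In the limiting case \<open>cmod \<alpha> = 1\<close> univalence follows by
  approximating \<open>\<alpha>\<close> and applying Hurwitz's theorem.

  The value \<open>h r\<close> is what \<open>(1 - (cmod z)\<^sup>2) * cmod (q' z / q z)\<close> becomes at \<open>z = r\<close> for the function
  with \<open>f' z = (1 + z) / (1 - z)\<close>. Becker's condition has the additional factor \<open>cmod z\<close>, and this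
  leaves enough room for the bound by \<open>1\<close>. The bound is proved by comparing an arbitrary \<open>f\<close> with that
  extremal function along each radius, using the Schwarz--Pick and Harnack inequalities for functions
  of positive real part.

  Becker's theorem is proved with his explicit extension, the exterior value at \<open>z\<close> being
  \<open>g w + (z - w) * g' w\<close> with \<open>w = 1 / cnj z\<close>. For the dilated functions \<open>g (\<rho> * z) / \<rho>\<close> this is a
  \<open>C\<^sup>1\<close> map of the plane whose Beltrami coefficient is bounded by \<open>k\<close> and which grows linearly
  at infinity, so it is a proper local homeomorphism and hence a homeomorphism. As \<open>\<rho>\<close> tends
  to \<open>1\<close> these maps converge uniformly on the plane. The limit has connected fibres. A fibre with two
  points would have to lie on the unit circle, where \<open>g\<close> would then have a constant boundary value, and
  this is impossible. The distributional derivatives of the limit are the limits of the classical ones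
  by dominated convergence: the derivative of \<open>g\<close> grows at most like the inverse square root
  of the distance to the circle, which is locally integrable in the plane.
\<close>

section \<open>The root \<open>r0\<close> and the constant \<open>h r0\<close>\<close>

text \<open>
  A function that starts at \<open>0\<close>, first decreases and then increases can cross zero only on its way
  up. This turns a single sign change of the derivative into a single sign change of the function,
  and it can be iterated.
\<close>
lemma sign_change_of_valley:
  fixes u u' :: "real \<Rightarrow> real"
  assumes c: "0 < c" "c < 1" and u0: "u 0 = 0"
    and der: "\<And>x. 0 \<le> x \<Longrightarrow> x < 1 \<Longrightarrow> (u has_real_derivative u' x) (at x)"
    and neg: "\<And>x. 0 < x \<Longrightarrow> x < c \<Longrightarrow> u' x < 0"
    and pos: "\<And>x. c < x \<Longrightarrow> x < 1 \<Longrightarrow> u' x > 0"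
    and b: "0 < b" "b < 1" "u b > 0"
  obtains r where "0 < r" "r < b" "u r = 0"
    "\<And>x. 0 < x \<Longrightarrow> x < r \<Longrightarrow> u x < 0" "\<And>x. r < x \<Longrightarrow> x < 1 \<Longrightarrow> u x > 0"
proof -
  have cont: "continuous_on {x..y} u" if "0 \<le> x" "y < 1" for x y
    by (meson DERIV_isCont atLeastAtMost_iff continuous_at_imp_continuous_on der le_less_trans order.trans that)
  have down: "u x < 0" if "0 < x" "x \<le> c" for x
  proof -
    have "u x < u 0"
    proof (rule DERIV_neg_imp_decreasing_open[of 0 x u])
      fix y assume "0 < y" "y < x"
      then show "\<exists>d. (u has_real_derivative d) (at y) \<and> 0 > d"
        using der[of y] neg[of y] that c by auto
    qed (use that c cont in auto)
    with u0 show ?thesis by simp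
  qed
  have up: "u x < u y" if "c \<le> x" "x < y" "y < 1" for x y
  proof (rule DERIV_pos_imp_increasing_open[of x y u])
    fix z assume "x < z" "z < y"
    then show "\<exists>d. (u has_real_derivative d) (at z) \<and> d > 0"
      using der[of z] pos[of z] that c by auto
  qed (use that c cont in auto)
  have "c < b" using down[of b] b by force
  obtain r where r: "c \<le> r" "r \<le> b" "u r = 0"
    using IVT'[of u c 0 b] down[of c] b c \<open>c < b\<close> cont[of c b] by force
  show ?thesis
  proof
    show "0 < r" "u r = 0" using r c by auto
    show "r < b" using r b by (cases "r = b") auto
    show "u x < 0" if "0 < x" "x < r" for x
      using down[of x] up[of x r] r that b by (cases "x \<le> c") auto
    show "u x > 0" if "r < x" "x < 1" for x
      using up[of r x] r that by auto
  qed
qed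

text \<open>
  The definite description that defines \<open>r0\<close> is legitimate because the equation has exactly one root.
  Divided by \<open>(1 + r\<^sup>2) * (1 - r)\<close>, its left-hand side is a quadratic polynomial \<open>D\<close> in
  \<open>ln (1 - r)\<close> with constant leading coefficient, so \<open>D'\<close> is linear in the logarithm and equals a
  positive factor times a function \<open>E\<close> in which the logarithm has coefficient \<open>1\<close>. Hence \<open>E'\<close> is
  rational, with the sign of a polynomial \<open>T\<close> that is increasing. Single sign changes
  propagate from \<open>T\<close> to \<open>E\<close> and from \<open>E\<close> to \<open>D\<close>, and the sign of \<open>D\<close> at \<open>1/2\<close> places the root
  to the left of \<open>1/2\<close>.
\<close>
lemma r0_properties: "0 < r0" "r0 < 1 / 2"
proof -
  define N :: "real \<Rightarrow> real" where "N = (\<lambda>r. 2*r + 5*r^2 + 2*r^3 - 4*r^4 + 4*r^5 - r^6)"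
  define P :: "real \<Rightarrow> real" where "P = (\<lambda>r. 2 + 6*r + 6*r^2 - 2*r^3 + 4*r^4)"
  define E :: "real \<Rightarrow> real" where "E = (\<lambda>r. N r / ((1 - r) * P r) + ln (1 - r))"
  define T :: "real \<Rightarrow> real"
    where "T = (\<lambda>r. 8*r^2 + 3*r + 7*r^3 + 8*r^4 + 5*r^5 + r^7 + r^8 - 1)"
  define D :: "real \<Rightarrow> real"
    where "D = (\<lambda>r. - 2 * (ln (1 - r))\<^sup>2 - 2*r*(1 - r) / (1 + r\<^sup>2) * ln (1 - r)
                    + r^3 * (r + 3) / ((1 + r\<^sup>2) * (1 - r)))"
  have P_pos: "P r > 0" if "0 \<le> r" "r < 1" for r
  proof -
    have "r^3 \<le> 1" using that by (simp add: power_le_one)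
    moreover have "P r = 2 * (1 - r^3) + (6*r + 6*r^2 + 4*r^4)" by (simp add: P_def)
    moreover have "6*r + 6*r^2 + 4*r^4 > 0 \<or> r = 0" 
      using that by (cases "r = 0") (auto intro!: add_pos_nonneg)
    ultimately show ?thesis by (cases "r = 0") (auto intro!: add_nonneg_pos simp: P_def)
  qed
  have derE: "(E has_real_derivative 4 * r^2 * T r / ((1 - r) * P r)\<^sup>2) (at r)"
    if "0 \<le> r" "r < 1" for r
  proof -
    have nz: "(1 - r) * P r \<noteq> 0" "1 - r \<noteq> 0" "1 - r > 0" using P_pos[OF that] that by auto
    have N': "(N has_real_derivative 2 + 10*r + 6*r^2 - 16*r^3 + 20*r^4 - 6*r^5) (at r)"
      unfolding N_def by (auto intro!: derivative_eq_intros)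
    have P': "(P has_real_derivative 6 + 12*r - 6*r^2 + 16*r^3) (at r)"
      unfolding P_def by (auto intro!: derivative_eq_intros)
    have "(E has_real_derivative
       ((2 + 10*r + 6*r^2 - 16*r^3 + 20*r^4 - 6*r^5) * ((1 - r) * P r)
         - N r * (-1 * P r + (6 + 12*r - 6*r^2 + 16*r^3) * (1 - r))) / (((1 - r) * P r) * ((1 - r) * P r))
       + (- 1) / (1 - r)) (at r)"
      unfolding E_def using nz by (auto intro!: derivative_eq_intros N' P' simp: mult_ac)
    moreover have "((2 + 10*r + 6*r^2 - 16*r^3 + 20*r^4 - 6*r^5) * ((1 - r) * P r)
         - N r * (-1 * P r + (6 + 12*r - 6*r^2 + 16*r^3) * (1 - r))) / (((1 - r) * P r) * ((1 - r) * P r))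
       + (- 1) / (1 - r) = ((2 + 10*r + 6*r^2 - 16*r^3 + 20*r^4 - 6*r^5) * ((1 - r) * P r)
         - N r * (-1 * P r + (6 + 12*r - 6*r^2 + 16*r^3) * (1 - r)) - (1 - r) * P r * P r) / ((1 - r) * P r)\<^sup>2"
      using nz by (simp add: divide_simps power2_eq_square)
    moreover have "(2 + 10*r + 6*r^2 - 16*r^3 + 20*r^4 - 6*r^5) * ((1 - r) * P r)
         - N r * (-1 * P r + (6 + 12*r - 6*r^2 + 16*r^3) * (1 - r)) - (1 - r) * P r * P r = 4 * r^2 * T r"
      unfolding N_def P_def T_def by algebra
    ultimately show ?thesis by simp
  qed
  have derD: "(D has_real_derivative P r / ((1 - r) * (1 + r\<^sup>2)\<^sup>2) * E r) (at r)"
    if "0 \<le> r" "r < 1" for r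
  proof -
    have nz: "1 - r \<noteq> 0" "1 - r > 0" "1 + r\<^sup>2 \<noteq> 0" "P r \<noteq> 0"
      using P_pos[OF that] that by (auto simp: add_nonneg_eq_0_iff)
    define l where "l = ln (1 - r)"
    have "(D has_real_derivative
        - 2 * (2 * l * (-1 / (1 - r))) - (((2 * (1 - r) - 2*r) * (1 + r\<^sup>2) - 2*r*(1 - r) * (2*r)) / ((1 + r\<^sup>2)*(1 + r\<^sup>2)) * l
           + (-1/(1-r)) * (2*r*(1 - r) / (1 + r\<^sup>2)))
        + ((3*r^2*(r+3) + r^3) * ((1 + r\<^sup>2) * (1 - r)) - r^3*(r+3)*(2*r*(1-r) - (1 + r\<^sup>2)))
           / (((1 + r\<^sup>2) * (1 - r)) * ((1 + r\<^sup>2) * (1 - r)))) (at r)"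
      unfolding D_def l_def using nz
      by (auto intro!: derivative_eq_intros simp: power2_eq_square) (simp add: divide_simps, algebra)
    moreover have "- 2 * (2 * l * (-1 / (1 - r))) - (((2 * (1 - r) - 2*r) * (1 + r\<^sup>2) - 2*r*(1 - r) * (2*r)) / ((1 + r\<^sup>2)*(1 + r\<^sup>2)) * l
           + (-1/(1-r)) * (2*r*(1 - r) / (1 + r\<^sup>2)))
        + ((3*r^2*(r+3) + r^3) * ((1 + r\<^sup>2) * (1 - r)) - r^3*(r+3)*(2*r*(1-r) - (1 + r\<^sup>2)))
           / (((1 + r\<^sup>2) * (1 - r)) * ((1 + r\<^sup>2) * (1 - r)))
       = (4 * l * (1 + r\<^sup>2)\<^sup>2 * (1 - r) - ((2 * (1 - r) - 2*r) * (1 + r\<^sup>2) - 2*r*(1 - r) * (2*r)) * l * (1-r)\<^sup>2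
          + 2*r*(1-r)\<^sup>2 * (1+r\<^sup>2)
          + ((3*r^2*(r+3) + r^3) * ((1 + r\<^sup>2) * (1 - r)) - r^3*(r+3)*(2*r*(1-r) - (1 + r\<^sup>2)))) / ((1 - r) * (1 + r\<^sup>2))\<^sup>2"
      using nz by (simp add: divide_simps power2_eq_square) algebra
    moreover have "4 * l * (1 + r\<^sup>2)\<^sup>2 * (1 - r) - ((2 * (1 - r) - 2*r) * (1 + r\<^sup>2) - 2*r*(1 - r) * (2*r)) * l * (1-r)\<^sup>2
          + 2*r*(1-r)\<^sup>2 * (1+r\<^sup>2)
          + ((3*r^2*(r+3) + r^3) * ((1 + r\<^sup>2) * (1 - r)) - r^3*(r+3)*(2*r*(1-r) - (1 + r\<^sup>2)))
        = (N r + l * ((1 - r) * P r))"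
      unfolding N_def P_def by algebra
    moreover have "(N r + l * ((1 - r) * P r)) / ((1 - r) * (1 + r\<^sup>2))\<^sup>2 = P r / ((1 - r) * (1 + r\<^sup>2)\<^sup>2) * E r"
      unfolding E_def l_def[symmetric] using nz by (simp add: divide_simps power2_eq_square) 
    ultimately show ?thesis by simp
  qed
  have "isCont T x" for x unfolding T_def by (intro continuous_intros)
  then obtain c where c: "0 \<le> c" "c \<le> 1/2" "T c = 0"
    using IVT'[of T 0 0 "1/2"] by (auto simp: T_def continuous_at_imp_continuous_on)
  have T_mono: "T x < T y" if "0 \<le> x" "x < y" for x y
  proof -
    have "x ^ n \<le> y ^ n" for n using that by (intro power_mono) auto
    then show ?thesis unfolding T_def
      using that by (intro diff_strict_right_mono add_less_le_mono add_le_less_mono mult_left_mono mult_strict_left_mono) auto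
  qed
  have c0: "0 < c" "c < 1" using c by (cases "c = 0"; auto simp: T_def)+
  obtain e where e: "0 < e" "e < 1/2" "E e = 0"
    "\<And>x. 0 < x \<Longrightarrow> x < e \<Longrightarrow> E x < 0" "\<And>x. e < x \<Longrightarrow> x < 1 \<Longrightarrow> E x > 0"
  proof (rule sign_change_of_valley[OF c0 _ derE, of "1/2"])
    show "E 0 = 0" by (simp add: E_def N_def)
    show "4 * x\<^sup>2 * T x / ((1 - x) * P x)\<^sup>2 < 0" if "0 < x" "x < c" for x
      using P_pos[of x] T_mono[of x c] c c0 that by (intro divide_neg_pos mult_pos_neg) auto
    show "4 * x\<^sup>2 * T x / ((1 - x) * P x)\<^sup>2 > 0" if "c < x" "x < 1" for x
      using P_pos[of x] T_mono[of c x] c c0 that by (intro divide_pos_pos mult_pos_pos) auto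
    show "E (1/2) > 0" using ln2_le_25_over_36
      by (simp add: E_def N_def P_def ln_div power_divide power_one_over)
  qed auto
  obtain r where r: "0 < r" "r < 1/2" "D r = 0"
    "\<And>x. 0 < x \<Longrightarrow> x < r \<Longrightarrow> D x < 0" "\<And>x. r < x \<Longrightarrow> x < 1 \<Longrightarrow> D x > 0"
  proof (rule sign_change_of_valley[OF e(1) _ _ derD, of "1/2"])
    show "D 0 = 0" by (simp add: D_def)
    show "e < 1" using e by simp
    show "P x / ((1 - x) * (1 + x\<^sup>2)\<^sup>2) * E x < 0" if "0 < x" "x < e" for x
      using P_pos[of x] e that by (intro mult_pos_neg divide_pos_pos mult_pos_pos zero_less_power add_pos_nonneg) auto
    show "P x / ((1 - x) * (1 + x\<^sup>2)\<^sup>2) * E x > 0" if "e < x" "x < 1" for x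
      using P_pos[of x] e that by (intro mult_pos_pos divide_pos_pos zero_less_power add_pos_nonneg) auto
    have "(ln 2)\<^sup>2 \<le> (25/36) * (ln 2 :: real)"
      using mult_right_mono[OF ln2_le_25_over_36, of "ln 2"] by (simp add: power2_eq_square)
    then show "D (1/2) > 0"
      using ln2_le_25_over_36 by (simp add: D_def ln_div power_divide)
  qed auto
  have root: "2 * (x\<^sup>2 + 1) * (x - 1) * (ln (1 - x))\<^sup>2
             - 2 * x * (x - 1)\<^sup>2 * ln (1 - x) + x ^ 3 * (x + 3) = (1 + x\<^sup>2) * (1 - x) * D x"
    if "0 < x" "x < 1" for x :: real
  proof -
    have "1 + x\<^sup>2 \<noteq> 0" "1 - x \<noteq> 0" using that by (auto simp: add_nonneg_eq_0_iff)
    then show ?thesis unfolding D_def by (simp add: divide_simps) algebra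
  qed
  have "r0 = r" unfolding r0_def
  proof (rule the_equality)
    fix x :: real assume "0 < x \<and> x < 1 \<and> 2 * (x\<^sup>2 + 1) * (x - 1) * (ln (1 - x))\<^sup>2
             - 2 * x * (x - 1)\<^sup>2 * ln (1 - x) + x ^ 3 * (x + 3) = 0"
    then have "0 < x" "x < 1" "D x = 0" using root[of x] by (auto simp: add_nonneg_eq_0_iff)
    then show "x = r" using r(4)[of x] r(5)[of x] by force
  qed (use r root[of r] in auto)
  with r show "0 < r0" "r0 < 1/2" by auto
qed

text \<open>
  After multiplication by the denominators the claim becomes an upper bound for \<open>- ln (1 - r)\<close> by a
  rational function. The derivative of the difference \<open>S\<close> factors, with \<open>1 - 2 * x\<close> as the only
  factor that changes sign, which is why the bound holds up to \<open>1/2\<close>.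
\<close>
lemma h_ge_1:
  fixes r :: real
  assumes "0 < r" "r \<le> 1 / 2"
  shows "h r \<ge> 1"
proof -
  define S :: "real \<Rightarrow> real" where "S = (\<lambda>x. (1 + x)\<^sup>2 * x / (1 + x - x\<^sup>2) + x + 2 * ln (1 - x))"
  have q: "1 + x - x\<^sup>2 > 0" if "0 \<le> x" "x < 1" for x :: real
  proof -
    have "x\<^sup>2 \<le> x" using that mult_left_le[of x x] by (simp add: power2_eq_square)
    then show ?thesis by simp
  qed
  have derS: "(S has_real_derivative x\<^sup>2 * (1 - 2*x) * (1 + x) / ((1 + x - x\<^sup>2)\<^sup>2 * (1 - x))) (at x)"
    if "0 \<le> x" "x < 1" for x
  proof -
    have nz: "1 + x - x\<^sup>2 \<noteq> 0" "1 - x > 0" "1 - x \<noteq> 0" using q[OF that] that by auto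
    have "(S has_real_derivative ((2*(1+x)*x + (1+x)\<^sup>2) * (1 + x - x\<^sup>2) - (1+x)\<^sup>2*x*(1 - 2*x)) / ((1 + x - x\<^sup>2)*(1 + x - x\<^sup>2))
        + 1 + 2 * (-1 / (1 - x))) (at x)"
      unfolding S_def using nz by (auto intro!: derivative_eq_intros simp: mult_ac)
    moreover have "((2*(1+x)*x + (1+x)\<^sup>2) * (1 + x - x\<^sup>2) - (1+x)\<^sup>2*x*(1 - 2*x)) / ((1 + x - x\<^sup>2)*(1 + x - x\<^sup>2))
        + 1 + 2 * (-1 / (1 - x)) = x\<^sup>2 * (1 - 2*x) * (1 + x) / ((1 + x - x\<^sup>2)\<^sup>2 * (1 - x))"
      using nz by (simp add: divide_simps) algebra
    ultimately show ?thesis by simp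
  qed
  have "S 0 \<le> S r"
  proof (rule DERIV_nonneg_imp_nondecreasing[of 0 r S])
    fix x assume "0 \<le> x" "x \<le> r"
    then have x: "0 \<le> x" "x \<le> 1/2" using assms by auto
    show "\<exists>y. (S has_real_derivative y) (at x) \<and> 0 \<le> y"
      using x derS[of x] by force
  qed (use assms in auto)
  then have "S r \<ge> 0" by (simp add: S_def)
  moreover define K where "K = - r - 2 * ln (1 - r)"
  ultimately have "K \<le> (1 + r)\<^sup>2 * r / (1 + r - r\<^sup>2)" by (simp add: S_def)
  then have K: "K * (1 + r - r\<^sup>2) \<le> (1 + r)\<^sup>2 * r" 
    using q[of r] assms by (simp add: pos_le_divide_eq)
  have "ln (1 - r) \<le> - r" using ln_add_one_self_le_self2[of "-r"] assms by simp
  then have "K > 0" using assms by (simp add: K_def)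
  have "r + 2 * ln (1 - r) = - K" by (simp add: K_def)
  then have "h r = (1 + r)\<^sup>2 / K - (1 - r\<^sup>2) / r"
    by (simp add: h_def)
  also have "\<dots> \<ge> 1"
    using K \<open>K > 0\<close> assms by (simp add: field_simps power2_eq_square)
  finally show ?thesis .
qed

text \<open>
  This is the case of the extremal function \<open>- z - 2 * ln (1 - z)\<close>, whose derivative is
  \<open>(1 + z) / (1 - z)\<close>, of the quotient bound below: it says that the product of \<open>1 - r\<^sup>2\<close> and
  \<open>z * f' z / f z - 1\<close> is at most \<open>1\<close> at \<open>z = r\<close>. The difference of the two sides, divided by
  \<open>2 - r\<^sup>2\<close>, vanishes at \<open>0\<close> and has a rational derivative with a positive numerator.
\<close>
lemma extremal_quotient_bound:
  fixes r :: real
  assumes "0 \<le> r" "r < 1"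
  shows "r * (1 + r)\<^sup>2 \<le> (2 - r\<^sup>2) * (- r - 2 * ln (1 - r))"
proof -
  define T :: "real \<Rightarrow> real" where "T = (\<lambda>x. - x - 2 * ln (1 - x) - x * (1 + x)\<^sup>2 / (2 - x\<^sup>2))"
  have q: "2 - x\<^sup>2 > 0" if "0 \<le> x" "x < 1" for x :: real
    using power_le_one[of x 2] that by simp
  have derT: "(T has_real_derivative (2 - 2*x - 3*x^2 + 3*x^3 + 2*x^4) / ((1 - x) * (2 - x\<^sup>2)\<^sup>2)) (at x)"
    if "0 \<le> x" "x < 1" for x
  proof -
    have nz: "2 - x\<^sup>2 \<noteq> 0" "1 - x > 0" "1 - x \<noteq> 0" using q[OF that] that by auto
    have "(T has_real_derivative - 1 - 2 * (-1/(1-x)) - (((1+x)\<^sup>2 + 2*(1+x)*x) * (2 - x\<^sup>2) + x*(1+x)\<^sup>2*(2*x)) / ((2 - x\<^sup>2)*(2 - x\<^sup>2))) (at x)"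
      unfolding T_def using nz by (auto intro!: derivative_eq_intros simp: mult_ac)
    moreover have "- 1 - 2 * (-1/(1-x)) - (((1+x)\<^sup>2 + 2*(1+x)*x) * (2 - x\<^sup>2) + x*(1+x)\<^sup>2*(2*x)) / ((2 - x\<^sup>2)*(2 - x\<^sup>2))
       = (2 - 2*x - 3*x^2 + 3*x^3 + 2*x^4) / ((1 - x) * (2 - x\<^sup>2)\<^sup>2)"
      using nz by (simp add: divide_simps power2_eq_square) (simp add: algebra_simps power3_eq_cube power4_eq_xxxx)
    ultimately show ?thesis by simp
  qed
  have num: "2 - 2*x - 3*x^2 + 3*x^3 + 2*x^4 \<ge> 0" if "0 \<le> x" "x < 1" for x :: real
  proof (cases "x\<^sup>2 \<le> 2/3")
    case True
    have "2 - 2*x - 3*x^2 + 3*x^3 + 2*x^4 = (1 - x) * (2 - 3*x^2) + 2*x^4" by algebra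
    with True that show ?thesis by simp
  next
    case False
    have "(1 - x) * (3*x^2 - 2) \<le> (1 - x) * 1"
      using power_le_one[of x 2] that by (intro mult_left_mono) auto
    moreover have "(2/3)\<^sup>2 \<le> (x\<^sup>2)\<^sup>2" using False by (intro power_mono) auto
    moreover have "x \<ge> 2/3" using False that mult_left_le[of x x] by (simp add: power2_eq_square)
    moreover have "2 - 2*x - 3*x^2 + 3*x^3 + 2*x^4 = 2*(x\<^sup>2)\<^sup>2 - (1 - x) * (3*x^2 - 2)" by algebra
    ultimately show ?thesis by (simp add: power2_eq_square)
  qed
  have "T 0 \<le> T r"
  proof (rule DERIV_nonneg_imp_nondecreasing[of 0 r T])
    fix x assume "0 \<le> x" "x \<le> r"
    then have x: "0 \<le> x" "x < 1" using assms by auto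
    show "\<exists>y. (T has_real_derivative y) (at x) \<and> 0 \<le> y"
      using x num[OF x] derT[of x] by force
  qed (use assms in auto)
  then show ?thesis using q[OF assms] by (simp add: T_def field_simps)
qed

section \<open>Functions whose derivative has positive real part\<close>

text \<open>
  The Schwarz--Pick inequality for maps of the disk into the right half-plane: move \<open>a\<close> to the origin
  by a disk automorphism \<open>\<phi>\<close>, map the half-plane to the disk by a Cayley transform that sends \<open>p a\<close>
  to \<open>0\<close>, and apply the Schwarz lemma to the composition \<open>\<psi>\<close>.
\<close>
lemma deriv_bound_of_Re_pos:
  assumes hol: "p holomorphic_on ball 0 1" and pos: "\<And>z. z \<in> ball 0 1 \<Longrightarrow> Re (p z) > 0"
    and a: "a \<in> ball 0 1"
  shows "cmod (deriv p a) * (1 - (cmod a)\<^sup>2) \<le> 2 * Re (p a)"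
proof -
  define \<phi> where "\<phi> = (\<lambda>z. (z + a) / (1 + cnj a * z))"
  define P where "P = (\<lambda>z. p (\<phi> z))"
  define \<psi> where "\<psi> = (\<lambda>z. (P z - p a) / (P z + cnj (p a)))"
  have a1: "cmod a < 1" using a by simp
  have nz: "1 + cnj a * z \<noteq> 0" if "z \<in> ball 0 1" for z
  proof
    assume "1 + cnj a * z = 0"
    then have "cnj a * z = -1" by (simp add: add_eq_0_iff)
    then have "cmod a * cmod z = 1" by (metis complex_mod_cnj norm_minus_cancel norm_mult norm_one)
    moreover have "cmod a * cmod z \<le> 1 * cmod z" using a1 by (intro mult_right_mono) auto
    then have "cmod a * cmod z < 1" using that by simp
    ultimately show False by simp
  qed
  have phi_in: "\<phi> z \<in> ball 0 1" if "z \<in> ball 0 1" for z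
  proof -
    have "(cmod (1 + cnj a * z))\<^sup>2 - (cmod (z + a))\<^sup>2 = (1 - (cmod a)\<^sup>2) * (1 - (cmod z)\<^sup>2)"
      unfolding cmod_power2 by (simp add: power2_eq_square algebra_simps)
    moreover have "(1 - (cmod a)\<^sup>2) * (1 - (cmod z)\<^sup>2) > 0"
      using a1 that by (intro mult_pos_pos) (auto simp: power_less_one_iff)
    ultimately have "(cmod (z + a))\<^sup>2 < (cmod (1 + cnj a * z))\<^sup>2" by linarith
    then have "cmod (z + a) < cmod (1 + cnj a * z)"
      using norm_ge_zero power_less_imp_less_base by blast
    then show ?thesis using nz[OF that] by (simp add: \<phi>_def norm_divide)
  qed
  have phi_hol: "\<phi> holomorphic_on ball 0 1"
    unfolding \<phi>_def using nz by (intro holomorphic_intros) auto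
  have P_hol: "P holomorphic_on ball 0 1"
    unfolding P_def using holomorphic_on_compose_gen[OF phi_hol hol, unfolded o_def] phi_in by blast
  have P_pos: "Re (P z) > 0" if "z \<in> ball 0 1" for z
    unfolding P_def using pos phi_in that by blast
  have nz2: "P z + cnj (p a) \<noteq> 0" if "z \<in> ball 0 1" for z
    using P_pos[OF that] pos[OF a] by (auto simp: complex_eq_iff)
  have psi_hol: "\<psi> holomorphic_on ball 0 1"
    unfolding \<psi>_def using nz2 P_hol by (intro holomorphic_intros) auto
  have P0: "P 0 = p a" by (simp add: P_def \<phi>_def)
  have "cmod (\<psi> z) < 1" if "cmod z < 1" for z
  proof -
    have z: "z \<in> ball 0 1" using that by simp
    have "(cmod (P z + cnj (p a)))\<^sup>2 - (cmod (P z - p a))\<^sup>2 = 4 * Re (P z) * Re (p a)"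
      unfolding cmod_power2 by (simp add: power2_eq_square algebra_simps)
    moreover have "4 * Re (P z) * Re (p a) > 0" using P_pos[OF z] pos[OF a] by simp
    ultimately have "(cmod (P z - p a))\<^sup>2 < (cmod (P z + cnj (p a)))\<^sup>2" by linarith
    then have "cmod (P z - p a) < cmod (P z + cnj (p a))"
      using norm_ge_zero power_less_imp_less_base by blast
    then show ?thesis using nz2[OF z] by (simp add: \<psi>_def norm_divide)
  qed
  then have le: "cmod (deriv \<psi> 0) \<le> 1"
    by (intro Schwarz_Lemma(2)[OF psi_hol, of 0]) (auto simp: \<psi>_def P0)
  have dphi: "(\<phi> has_field_derivative (1 - cnj a * a)) (at 0)"
    unfolding \<phi>_def by (auto intro!: derivative_eq_intros simp: algebra_simps)
  have "(p has_field_derivative deriv p a) (at (\<phi> 0))"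
    using holomorphic_derivI[OF hol _ a] by (simp add: \<phi>_def)
  from DERIV_chain2[OF this dphi]
  have dP: "(P has_field_derivative deriv p a * (1 - cnj a * a)) (at 0)"
    by (simp add: P_def)
  have "p a + cnj (p a) = of_real (2 * Re (p a))" by (simp add: complex_add_cnj)
  moreover have "Re (p a) > 0" using pos a by blast
  ultimately have nz3: "p a + cnj (p a) \<noteq> 0" by (simp del: of_real_mult)
  have "(\<psi> has_field_derivative (deriv p a * (1 - cnj a * a)) / (p a + cnj (p a))) (at 0)"
    unfolding \<psi>_def using nz3 by (auto intro!: derivative_eq_intros dP simp: P0)
  then have "deriv \<psi> 0 = deriv p a * (1 - cnj a * a) / (p a + cnj (p a))"
    by (rule DERIV_imp_deriv)
  moreover have "1 - cnj a * a = of_real (1 - (cmod a)\<^sup>2)"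
    by (simp add: complex_norm_square mult.commute del: of_real_power)
  ultimately have "cmod (deriv \<psi> 0) = cmod (deriv p a) * (1 - (cmod a)\<^sup>2) / (2 * Re (p a))"
    using \<open>Re (p a) > 0\<close> a1 \<open>p a + cnj (p a) = _\<close>
    by (simp add: norm_divide norm_mult abs_square_le_1 del: of_real_mult of_real_diff)
  with le \<open>Re (p a) > 0\<close> show ?thesis by (simp add: field_simps)
qed

text \<open>
  Harnack's inequality in monotone form. By the Schwarz--Pick inequality the logarithmic derivative
  of \<open>Re p\<close> along a radius is at most that of \<open>(1 + x) / (1 - x)\<close>, so the ratio of the two decreases.
\<close>
lemma Re_pos_Harnack:
  assumes hol: "p holomorphic_on ball 0 1" and pos: "\<And>z. z \<in> ball 0 1 \<Longrightarrow> Re (p z) > 0"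
    and z: "z \<in> ball 0 1" and st: "0 \<le> s" "s \<le> t" "t \<le> 1"
  defines "r \<equiv> cmod z"
  shows "Re (p (of_real t * z)) * (1 - t * r) / (1 + t * r)
       \<le> Re (p (of_real s * z)) * (1 - s * r) / (1 + s * r)"
proof -
  have r: "0 \<le> r" "r < 1" using z by (auto simp: r_def)
  have tr: "x * r < 1" "0 \<le> x * r" if "0 \<le> x" "x \<le> 1" for x
    using r that mult_right_mono[of x 1 r] by auto
  define m where "m = (\<lambda>t. Re (p (of_real t * z)))"
  define \<mu> where "\<mu> = (\<lambda>t. m t * (1 - t * r) / (1 + t * r))"
  have "\<mu> s \<ge> \<mu> t"
  proof (rule DERIV_nonpos_imp_nonincreasing[OF st(2)])
    fix x assume "s \<le> x" "x \<le> t"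
    then have x: "0 \<le> x" "x \<le> 1" using st by auto
    have xz: "of_real x * z \<in> ball 0 1" using tr[OF x] x by (simp add: norm_mult r_def)
    define d where "d = Re (deriv p (of_real x * z) * z)"
    have "((\<lambda>w. p (w * z)) has_field_derivative deriv p (of_real x * z) * z) (at (of_real x))"
      by (intro DERIV_chain2[of p _ "\<lambda>w. w * z"] holomorphic_derivI[OF hol open_ball xz])
         (auto intro!: derivative_eq_intros)
    then have "((\<lambda>t. p (of_real t * z)) has_vector_derivative deriv p (of_real x * z) * z) (at x)"
      by (rule has_vector_derivative_real_field)
    then have dm: "(m has_real_derivative d) (at x)"
      unfolding m_def d_def has_real_derivative_iff_has_vector_derivative
      by (rule bounded_linear.has_vector_derivative[OF bounded_linear_Re])
    have "\<bar>d\<bar> \<le> cmod (deriv p (of_real x * z)) * r"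
      unfolding d_def r_def by (metis abs_Re_le_cmod norm_mult)
    moreover have "cmod (deriv p (of_real x * z)) * (1 - (x*r)\<^sup>2) \<le> 2 * m x"
      using deriv_bound_of_Re_pos[OF hol pos xz] x by (simp add: m_def norm_mult r_def)
    then have le: "cmod (deriv p (of_real x * z)) * (1 - (x*r)\<^sup>2) * r \<le> 2 * m x * r"
      using r by (intro mult_right_mono) auto
    moreover have "1 - (x*r)\<^sup>2 \<ge> 0" using tr[OF x] by (simp add: power_le_one)
    ultimately have "d * (1 - (x*r)\<^sup>2) \<le> cmod (deriv p (of_real x * z)) * r * (1 - (x*r)\<^sup>2)"
      by (intro mult_right_mono) auto
    with le have d: "d * (1 - (x*r)\<^sup>2) \<le> 2 * m x * r" by (simp add: mult_ac)
    have "(\<mu> has_real_derivative ((d * (1 - x * r) + m x * (- r)) * (1 + x * r) - m x * (1 - x * r) * r) / ((1 + x * r) * (1 + x * r))) (at x)"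
      unfolding \<mu>_def using tr[OF x] by (auto intro!: derivative_eq_intros dm)
    moreover have "(d * (1 - x * r) + m x * (- r)) * (1 + x * r) - m x * (1 - x * r) * r = d * (1 - (x*r)\<^sup>2) - 2 * m x * r"
      by algebra
    ultimately show "\<exists>y. (\<mu> has_real_derivative y) (at x) \<and> y \<le> 0"
      using d tr[OF x] by (auto intro!: exI divide_nonpos_pos)
  qed
  then show ?thesis by (simp add: \<mu>_def m_def)
qed

text \<open>
  Put \<open>p = f'\<close>, \<open>r = cmod z\<close> and \<open>m t = Re (p (t * z))\<close>. Then \<open>f z / z\<close> is the mean of \<open>p\<close> over the
  segment from \<open>0\<close> to \<open>z\<close>, the difference \<open>f' z - f z / z\<close> is the integral of \<open>t * z * p' (t * z)\<close>,
  and the Schwarz--Pick inequality bounds the latter by the integral of \<open>\<omega> * m\<close>. So it suffices that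
  the integral of \<open>W * m\<close> is nonnegative, where the weight \<open>W = 1 - (1 - r\<^sup>2) * \<omega>\<close> decreases and
  hence changes sign at most once, at some \<open>c\<close>. By Harnack's inequality \<open>m\<close> is a decreasing multiple
  \<open>\<mu>\<close> of the extremal density \<open>M\<close>. Replacing \<open>\<mu>\<close> by the constant \<open>\<mu> c\<close> lowers the integrand on both
  sides of \<open>c\<close>, which reduces the claim to the extremal function.
\<close>
lemma class_R_quotient_bound:
  assumes f: "f \<in> class_R" and z: "z \<in> unit_disk" "z \<noteq> 0"
  shows "cmod (deriv f z - f z / z) * (1 - (cmod z)\<^sup>2) \<le> Re (f z / z)"
proof -
  define p where "p = deriv f"
  define r where "r = cmod z"
  define m where "m = (\<lambda>t. Re (p (of_real t * z)))"
  define \<omega> where "\<omega> = (\<lambda>t. 2*t*r / (1 - (t*r)\<^sup>2))"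
  define M where "M = (\<lambda>t. (1 + t*r) / (1 - t*r))"
  define W where "W = (\<lambda>t. 1 - (1 - r\<^sup>2) * \<omega> t)"
  have f_hol: "f holomorphic_on unit_disk" and f0: "f 0 = 0"
    and pos: "\<And>z. z \<in> unit_disk \<Longrightarrow> Re (p z) > 0"
    using f by (auto simp: class_R_def class_A_def p_def)
  have p_hol: "p holomorphic_on unit_disk"
    unfolding p_def using f_hol by (intro holomorphic_deriv) auto
  have p'_hol: "deriv p holomorphic_on unit_disk"
    using p_hol by (intro holomorphic_deriv) auto
  have r: "0 < r" "r < 1" using z by (auto simp: r_def)
  have tr: "t * r < 1" "0 \<le> t * r" "1 - (t*r)\<^sup>2 > 0" if "t \<in> {0..1}" for t
  proof -
    have "t * r \<le> 1 * r" using r that by (intro mult_right_mono) auto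
    also have "\<dots> < 1" using r by simp
    finally show *: "t * r < 1" .
    show **: "0 \<le> t * r" using r that by simp
    show "1 - (t*r)\<^sup>2 > 0" using * ** by (simp add: power_less_one_iff abs_square_less_1)
  qed
  have r2: "1 - r\<^sup>2 > 0" using tr(3)[of 1] by simp
  have tz: "of_real t * z \<in> unit_disk" if "t \<in> {0..1}" for t
    using tr[OF that] that by (simp add: norm_mult r_def)
  have ray: "continuous_on {0..1} (\<lambda>t::real. of_real t * z)" by (intro continuous_intros)
  have cont_ray: "continuous_on {0..1} (\<lambda>t::real. g (of_real t * z))" if "g holomorphic_on unit_disk" for g
    by (rule continuous_on_compose2[OF holomorphic_on_imp_continuous_on[OF that] ray]) (use tz in auto)
  have der_ray: "((\<lambda>t. g (of_real t * z)) has_vector_derivative z * deriv g (of_real t * z)) (at t within {0..1})"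
    if g: "g holomorphic_on unit_disk" and t: "t \<in> {0..1}" for g t
  proof -
    have "((\<lambda>w. g (w * z)) has_field_derivative deriv g (of_real t * z) * z) (at (of_real t))"
      by (intro DERIV_chain2[of g _ "\<lambda>w. w * z"] holomorphic_derivI[OF g open_ball tz[OF t]])
         (auto intro!: derivative_eq_intros)
    then have "((\<lambda>t. g (of_real t * z)) has_vector_derivative deriv g (of_real t * z) * z) (at t within {0..1})"
      by (rule has_vector_derivative_real_field)
    then show ?thesis by (simp add: mult.commute)
  qed
  have int_p: "((\<lambda>t. p (of_real t * z)) has_integral f z / z) {0..1}"
  proof -
    have "((\<lambda>t. p (of_real t * z)) has_integral f (of_real 1 * z) / z - f (of_real 0 * z) / z) {0..1}"
    proof (rule fundamental_theorem_of_calculus)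
      fix t :: real assume t: "t \<in> {0..1}"
      show "((\<lambda>t. f (of_real t * z) / z) has_vector_derivative p (of_real t * z)) (at t within {0..1})"
        using has_vector_derivative_mult_right[OF der_ray[OF f_hol t], of "inverse z"] z
        by (simp add: p_def field_simps)
    qed simp
    then show ?thesis by (simp add: f0)
  qed
  have int_p': "((\<lambda>t. of_real t * z * deriv p (of_real t * z)) has_integral p z - f z / z) {0..1}"
  proof -
    have "((\<lambda>t. of_real t * z * deriv p (of_real t * z)) has_integral
       (of_real 1 * p (of_real 1 * z) - f (of_real 1 * z) / z) - (of_real 0 * p (of_real 0 * z) - f (of_real 0 * z) / z)) {0..1}"
    proof (rule fundamental_theorem_of_calculus)
      fix t :: real assume t: "t \<in> {0..1}"
      have 1: "((\<lambda>t. f (of_real t * z) / z) has_vector_derivative p (of_real t * z)) (at t within {0..1})"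
        using has_vector_derivative_mult_right[OF der_ray[OF f_hol t], of "inverse z"] z
        by (simp add: p_def field_simps)
      have 2: "((\<lambda>t. of_real t :: complex) has_vector_derivative 1) (at t within {0..1})"
        by (auto intro!: derivative_eq_intros has_vector_derivative_of_real)
      show "((\<lambda>t. of_real t * p (of_real t * z) - f (of_real t * z) / z) has_vector_derivative
              of_real t * z * deriv p (of_real t * z)) (at t within {0..1})"
        using has_vector_derivative_diff[OF has_vector_derivative_mult[OF 2 der_ray[OF p_hol t]] 1]
        by (simp add: mult_ac)
    qed simp
    then show ?thesis by (simp add: f0)
  qed
  have cont_m: "continuous_on {0..1} m"
    unfolding m_def by (intro continuous_intros cont_ray p_hol)
  have cont_\<omega>: "continuous_on {0..1} \<omega>"
    unfolding \<omega>_def by (intro continuous_intros ballI) (use tr(3) in force)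
  have int_m: "(m has_integral Re (f z / z)) {0..1}"
    using has_integral_Re[OF int_p] by (simp add: m_def)
  have int_\<omega>m: "(\<lambda>t. \<omega> t * m t) integrable_on {0..1}"
    by (intro integrable_continuous_interval continuous_intros cont_m cont_\<omega>)
  have "cmod (p z - f z / z) \<le> integral {0..1} (\<lambda>t. \<omega> t * m t)"
  proof (rule integral_norm_bound_integral[of "\<lambda>t. of_real t * z * deriv p (of_real t * z)" "{0..1}" "\<lambda>t. \<omega> t * m t", unfolded integral_unique[OF int_p']])
    show "(\<lambda>t. of_real t * z * deriv p (of_real t * z)) integrable_on {0..1}"
      using int_p' by blast
    show "(\<lambda>t. \<omega> t * m t) integrable_on {0..1}" by (rule int_\<omega>m)
    fix t :: real assume t: "t \<in> {0..1}"
    have "cmod (deriv p (of_real t * z)) * (1 - (t*r)\<^sup>2) \<le> 2 * m t"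
      using deriv_bound_of_Re_pos[OF p_hol pos tz[OF t]] t by (simp add: m_def norm_mult r_def)
    then have "cmod (deriv p (of_real t * z)) \<le> 2 * m t / (1 - (t*r)\<^sup>2)"
      using tr[OF t] by (simp add: pos_le_divide_eq)
    then have "t * r * cmod (deriv p (of_real t * z)) \<le> t * r * (2 * m t / (1 - (t*r)\<^sup>2))"
      using tr[OF t] by (intro mult_left_mono) auto
    then show "cmod (of_real t * z * deriv p (of_real t * z)) \<le> \<omega> t * m t"
      using t by (simp add: norm_mult r_def \<omega>_def mult_ac)
  qed
  then have "cmod (p z - f z / z) * (1 - r\<^sup>2) \<le> integral {0..1} (\<lambda>t. \<omega> t * m t) * (1 - r\<^sup>2)"
    using r2 by (intro mult_right_mono) auto
  moreover have int_Wm: "((\<lambda>t. W t * m t) has_integral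
      Re (f z / z) - integral {0..1} (\<lambda>t. \<omega> t * m t) * (1 - r\<^sup>2)) {0..1}"
    using has_integral_diff[OF int_m has_integral_mult_left[OF integrable_integral[OF int_\<omega>m], of "1 - r\<^sup>2"]]
    by (simp add: W_def algebra_simps)
  moreover have int_WM: "((\<lambda>t. W t * M t) has_integral
      ((2 - r\<^sup>2) * (- r - 2 * ln (1 - r)) - r * (1 + r)\<^sup>2) / r) {0..1}"
  proof -
    \<comment> \<open>\<open>A\<close> is a primitive of \<open>M\<close>, and \<open>\<omega> * M\<close> is \<open>t * M'\<close>, so that \<open>t * M - A\<close> is a primitive of \<open>\<omega> * M\<close>.\<close>
    define A where "A = (\<lambda>t. - t - 2 / r * ln (1 - t*r))"
    have dA: "(A has_real_derivative M t) (at t within {0..1})" if "t \<in> {0..1}" for t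
      unfolding A_def M_def using tr[OF that] r by (auto intro!: derivative_eq_intros simp: field_simps)
    have dM: "(M has_real_derivative (2 * r / (1 - t*r)\<^sup>2)) (at t within {0..1})" if "t \<in> {0..1}" for t
      unfolding M_def using tr[OF that] r
      by (auto intro!: derivative_eq_intros simp: power2_eq_square field_simps)
    have "((\<lambda>t. W t * M t) has_integral
       (A 1 - (1 - r\<^sup>2) * (1 * M 1 - A 1)) - (A 0 - (1 - r\<^sup>2) * (0 * M 0 - A 0))) {0..1}"
    proof (rule fundamental_theorem_of_calculus)
      fix t :: real assume t: "t \<in> {0..1}"
      have der: "((\<lambda>t. A t - (1 - r\<^sup>2) * (t * M t - A t)) has_real_derivative
          M t - (1 - r\<^sup>2) * (1 * M t + (2 * r / (1 - t*r)\<^sup>2) * t - M t)) (at t within {0..1})"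
        by (rule derivative_eq_intros dA[OF t] dM[OF t] refl)+ simp
      have "1 - (t*r)\<^sup>2 = (1 - t*r) * (1 + t*r)" by algebra
      moreover have "1 - t*r \<noteq> 0" "1 + t*r \<noteq> 0" using tr[OF t] by auto
      ultimately have "2 * r / (1 - t*r)\<^sup>2 * t = \<omega> t * M t"
        by (simp add: M_def \<omega>_def power2_eq_square)
      then have eq: "M t - (1 - r\<^sup>2) * (1 * M t + 2 * r / (1 - t*r)\<^sup>2 * t - M t) = W t * M t"
        by (simp add: W_def algebra_simps)
      show "((\<lambda>t. A t - (1 - r\<^sup>2) * (t * M t - A t)) has_vector_derivative W t * M t) (at t within {0..1})"
        using der unfolding eq has_real_derivative_iff_has_vector_derivative .
    qed simp
    moreover have "(A 1 - (1 - r\<^sup>2) * (1 * M 1 - A 1)) - (A 0 - (1 - r\<^sup>2) * (0 * M 0 - A 0))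
       = ((2 - r\<^sup>2) * (- r - 2 * ln (1 - r)) - r * (1 + r)\<^sup>2) / r"
      using r by (simp add: A_def M_def divide_simps) algebra
    ultimately show ?thesis by simp
  qed
  moreover have "0 \<le> Re (f z / z) - integral {0..1} (\<lambda>t. \<omega> t * m t) * (1 - r\<^sup>2)"
  proof -
    define \<mu> where "\<mu> = (\<lambda>t. m t * (1 - t*r) / (1 + t*r))"
    have \<mu>_mono: "\<mu> t \<le> \<mu> s" if "0 \<le> s" "s \<le> t" "t \<le> 1" for s t
      using Re_pos_Harnack[OF p_hol pos z(1) that] by (simp add: \<mu>_def m_def r_def)
    have \<mu>_pos: "\<mu> t \<ge> 0" if "t \<in> {0..1}" for t
      using tr[OF that] pos[OF tz[OF that]] by (simp add: \<mu>_def m_def)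
    have m_eq: "m t = \<mu> t * M t" if "t \<in> {0..1}" for t
      using tr[OF that] by (simp add: \<mu>_def M_def)
    have \<omega>_mono: "\<omega> s \<le> \<omega> t" if "0 \<le> s" "s \<le> t" "t \<le> 1" for s t
      unfolding \<omega>_def using tr[of s] tr[of t] r that
      by (intro frac_le diff_left_mono power_mono mult_right_mono) auto
    have W_mono: "W t \<le> W s" if "0 \<le> s" "s \<le> t" "t \<le> 1" for s t
      unfolding W_def using \<omega>_mono[OF that] r2 by simp
    obtain c where c: "c \<in> {0..1}" "\<And>t. 0 \<le> t \<Longrightarrow> t \<le> c \<Longrightarrow> W t \<ge> 0" "\<And>t. c < t \<Longrightarrow> t \<le> 1 \<Longrightarrow> W t \<le> 0"
    proof (cases "W 1 \<ge> 0")
      case True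
      then show ?thesis using W_mono[of _ 1] by (intro that[of 1]) force+
    next
      case False
      have "continuous_on {0..1} W" unfolding W_def by (intro continuous_intros cont_\<omega>)
      then obtain c where "0 \<le> c" "c \<le> 1" "W c = 0"
        using IVT2'[of W 1 0 0] False by (auto simp: W_def \<omega>_def)
      then show ?thesis using W_mono[of _ c] W_mono[of c] by (intro that[of c]) auto
    qed
    have "\<mu> c * (((2 - r\<^sup>2) * (- r - 2 * ln (1 - r)) - r * (1 + r)\<^sup>2) / r)
        \<le> Re (f z / z) - integral {0..1} (\<lambda>t. \<omega> t * m t) * (1 - r\<^sup>2)"
    proof (rule has_integral_le[OF has_integral_mult_right[OF int_WM] int_Wm])
      fix t :: real assume t: "t \<in> {0..1}"
      have "W t * \<mu> t \<ge> W t * \<mu> c"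
      proof (cases "t \<le> c")
        case True
        then show ?thesis using c t \<mu>_mono[of t c] by (intro mult_left_mono) auto
      next
        case False
        then show ?thesis using c t \<mu>_mono[of c t] by (intro mult_left_mono_neg) auto
      qed
      moreover have "M t \<ge> 0" using tr[OF t] by (simp add: M_def)
      ultimately have "W t * \<mu> c * M t \<le> W t * \<mu> t * M t" by (rule mult_right_mono)
      then show "\<mu> c * (W t * M t) \<le> W t * m t" by (simp add: m_eq[OF t] mult_ac)
    qed
    moreover have "\<mu> c * (((2 - r\<^sup>2) * (- r - 2 * ln (1 - r)) - r * (1 + r)\<^sup>2) / r) \<ge> 0"
      using extremal_quotient_bound[of r] r \<mu>_pos[OF c(1)] by simp
    ultimately show ?thesis by linarith
  qed
  ultimately show ?thesis by (simp add: p_def r_def)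
qed

section \<open>Proper local homeomorphisms and limits of homeomorphisms\<close>

lemma proper_imp_closed_image:
  fixes F :: "'a::euclidean_space \<Rightarrow> 'b::euclidean_space"
  assumes cont: "continuous_on UNIV F" and proper: "\<And>B. bounded B \<Longrightarrow> bounded (F -` B)"
    and C: "closed C"
  shows "closed (F ` C)"
  unfolding closed_sequential_limits
proof (intro allI impI, elim conjE)
  fix x l assume x: "\<forall>n. x n \<in> F ` C" and l: "x \<longlonglongrightarrow> l"
  have "\<forall>n. \<exists>c\<in>C. x n = F c" using x by (simp add: image_iff)
  then obtain c where c: "\<And>n. c n \<in> C" "\<And>n. F (c n) = x n" by metis
  have "bounded (range x)" using l convergent_imp_bounded by blast
  then have "bounded (F -` range x)" by (rule proper)
  then have "bounded (range c)" by (rule bounded_subset) (use c in auto)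
  then obtain a s where s: "strict_mono s" "(c \<circ> s) \<longlonglongrightarrow> a"
    using bounded_imp_convergent_subsequence by blast
  have "\<And>n. (c \<circ> s) n \<in> C" using c by simp
  then have "a \<in> C" by (rule closed_sequentially[OF C _ s(2)])
  moreover have "(\<lambda>n. F ((c \<circ> s) n)) \<longlonglongrightarrow> F a"
    by (rule continuous_on_tendsto_compose[OF cont s(2)]) auto
  then have "(x \<circ> s) \<longlonglongrightarrow> F a" by (simp add: c o_def)
  with LIMSEQ_subseq_LIMSEQ[OF l s(1)] have "F a = l" by (rule LIMSEQ_unique[rotated])
  ultimately show "l \<in> F ` C" by blast
qed

text \<open>
  A fibre is compact and discrete, hence finite. Small disjoint balls around its points are mapped
  onto open sets by invariance of domain, and since the image of the complement of these balls is
  closed, a neighbourhood of the base point is covered by nothing but these balls.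
\<close>
lemma proper_local_injection_imp_covering:
  fixes F :: "'a::euclidean_space \<Rightarrow> 'a"
  assumes cont: "continuous_on UNIV F" and proper: "\<And>B. bounded B \<Longrightarrow> bounded (F -` B)"
    and inj: "\<And>x. \<exists>e>0. inj_on F (ball x e)"
  shows "covering_space UNIV F UNIV"
proof
  have open_img: "open (F ` (ball x e))" if "inj_on F (ball x e)" for x e
    using that cont by (intro invariance_of_domain) (auto intro: continuous_on_subset)
  have "open (range F)"
  proof (subst open_subopen, safe)
    fix x
    obtain e where "e > 0" "inj_on F (ball x e)" using inj by blast
    then show "\<exists>T. open T \<and> F x \<in> T \<and> T \<subseteq> range F"
      using open_img by (intro exI[of _ "F ` ball x e"]) auto
  qed
  moreover have "closed (range F)" by (rule proper_imp_closed_image[OF cont proper]) auto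
  ultimately show surj: "range F = UNIV" by (metis clopen UNIV_not_empty image_is_empty)
  show "continuous_on UNIV F" by (rule cont)
  fix y :: 'a
  define A where "A = F -` {y}"
  have "closed A" unfolding A_def using cont by (simp add: continuous_closed_vimage continuous_on_eq_continuous_at)
  then have "compact A" using proper[of "{y}"] by (simp add: A_def compact_eq_bounded_closed)
  moreover have "\<not> x islimpt A" for x
  proof
    assume "x islimpt A"
    obtain e where e: "e > 0" "inj_on F (ball x e)" using inj by blast
    have "infinite (A \<inter> ball x e)" using \<open>x islimpt A\<close> e by (simp add: islimpt_eq_infinite_ball)
    moreover have "A \<inter> ball x e \<subseteq> {z}" if "z \<in> A \<inter> ball x e" for z
      using that e by (auto simp: A_def inj_on_def)
    ultimately show False by (metis finite.emptyI finite_insert finite_subset ex_in_conv)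
  qed
  ultimately have "finite A"
    by (meson Heine_Borel_imp_Bolzano_Weierstrass subset_refl)
  have "\<exists>d>0. \<forall>x\<in>A. inj_on F (ball x d)"
    using \<open>finite A\<close>
  proof induction
    case (insert a A)
    then obtain d where "d > 0" "\<forall>x\<in>A. inj_on F (ball x d)" by blast
    moreover obtain e where "e > 0" "inj_on F (ball a e)" using inj by blast
    ultimately show ?case
      by (intro exI[of _ "min d e"]) (auto intro: inj_on_subset)
  qed (auto intro: exI[of _ 1])
  then obtain d2 where d2: "d2 > 0" "\<And>x. x \<in> A \<Longrightarrow> inj_on F (ball x d2)" by blast
  define d where "d = d2 / 2"
  have "d > 0" using d2 by (simp add: d_def)
  have inj_d: "inj_on F (ball x d)" if "x \<in> A" for x
    using d2(2)[OF that] by (rule inj_on_subset) (use d2 in \<open>auto simp: d_def\<close>)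
  define U where "U = (\<Union>x\<in>A. ball x d)"
  define T where "T = (\<Inter>x\<in>A. F ` ball x d) \<inter> - (F ` (- U))"
  have "open T"
    unfolding T_def U_def using \<open>finite A\<close> open_img[OF inj_d]
    by (intro open_Int open_INT open_Compl proper_imp_closed_image[OF cont proper] closed_Compl) auto
  have "y \<in> T" unfolding T_def U_def A_def using \<open>d > 0\<close> by force
  define v where "v = (\<lambda>x. ball x d \<inter> F -` T) ` A"
  have openT: "open (F -` T)"
    using cont \<open>open T\<close> by (simp add: continuous_on_open_vimage)
  show "\<exists>T. y \<in> T \<and> openin (top_of_set UNIV) T \<and>
           (\<exists>v. \<Union>v = UNIV \<inter> F -` T \<and> (\<forall>u\<in>v. openin (top_of_set UNIV) u) \<and>
                pairwise disjnt v \<and> (\<forall>u\<in>v. \<exists>q. homeomorphism u T F q))"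
  proof (rule exI[of _ T], intro conjI exI[of _ v])
    show "y \<in> T" "openin (top_of_set UNIV) T" using \<open>y \<in> T\<close> \<open>open T\<close> by auto
    show "\<Union> v = UNIV \<inter> F -` T"
      by (auto simp: v_def T_def U_def)
    show "\<forall>u\<in>v. openin (top_of_set UNIV) u"
      using openT by (auto simp: v_def)
    have "ball x d \<inter> ball x' d = {}" if "x \<in> A" "x' \<in> A" "x \<noteq> x'" for x x'
    proof (rule disjoint_ballI)
      have "F x = F x'" using that by (simp add: A_def)
      then have "x' \<notin> ball x d2" using d2(2)[OF that(1)] d2(1) that(3) by (auto simp: inj_on_def)
      then show "dist x x' \<ge> d + d" by (simp add: d_def)
    qed
    then show "pairwise disjnt v"
      unfolding v_def pairwise_def disjnt_def by blast
    show "\<forall>u\<in>v. \<exists>q. homeomorphism u T F q"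
    proof
      fix u assume "u \<in> v"
      then obtain x where x: "x \<in> A" "u = ball x d \<inter> F -` T" by (auto simp: v_def)
      have "inj_on F u" using inj_d[OF x(1)] x(2) by (auto intro: inj_on_subset)
      moreover have "open u" using x openT by auto
      moreover have "T \<subseteq> F ` ball x d" using x(1) by (auto simp: T_def)
      then have "F ` u = T" unfolding x(2) by blast
      ultimately show "\<exists>q. homeomorphism u T F q"
        using invariance_of_domain_homeomorphism[of u F] cont
        by (metis continuous_on_subset order_refl subset_UNIV)
    qed
  qed
qed

text \<open>
  Hadamard's global inversion theorem. The target is simply connected, so the identity lifts through
  the covering to a section \<open>G\<close>. Its range is open, by invariance of domain, and closed, so it is
  everything.
\<close>
lemma proper_local_injection_imp_homeomorphism:
  fixes F :: "'a::euclidean_space \<Rightarrow> 'a"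
  assumes cont: "continuous_on UNIV F" and proper: "\<And>B. bounded B \<Longrightarrow> bounded (F -` B)"
    and inj: "\<And>x. \<exists>e>0. inj_on F (ball x e)"
  obtains G where "homeomorphism UNIV UNIV F G"
proof -
  have cov: "covering_space UNIV F UNIV"
    by (rule proper_local_injection_imp_covering[OF assms])
  obtain G where G: "continuous_on UNIV G" "\<And>y. F (G y) = y"
    by (rule covering_space_lift[OF cov, of "UNIV :: 'a set" id])
       (auto simp: convex_imp_simply_connected locally_path_connected_UNIV)
  have "inj G" using G(2) by (metis injI)
  then have "open (range G)" using G by (intro invariance_of_domain) auto
  moreover have "range G = {x. G (F x) = x}" using G(2) by (auto intro: range_eqI[symmetric]) (metis rangeI)
  moreover have "closed {x. G (F x) = x}"
    using continuous_on_compose2[OF G(1) cont] by (intro closed_Collect_eq) auto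
  ultimately have "range G = UNIV" by (metis clopen UNIV_not_empty image_is_empty)
  then have "G (F x) = x" for x using \<open>range G = {x. G (F x) = x}\<close> by auto
  with G cont have "homeomorphism UNIV UNIV F G"
    by (intro homeomorphismI) auto
  then show ?thesis by (rule that)
qed

text \<open>
  A uniform limit of homeomorphisms may collapse sets, but only connected ones. If a fibre of the
  limit \<open>F\<close> over \<open>w\<close> fell into two compact pieces, then \<open>F\<close> would stay away from \<open>w\<close> on the boundary of a
  neighbourhood \<open>U'\<close> of one of them; but for large \<open>n\<close> the preimage under \<open>F' n\<close> of a small ball
  about \<open>w\<close> is connected and meets both pieces, so it crosses that boundary.
\<close>
lemma fibre_of_limit_of_homeomorphisms:
  fixes F :: "'a::euclidean_space \<Rightarrow> 'b::euclidean_space"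
  assumes homeo: "\<And>n. homeomorphism UNIV UNIV (F' n) (G n)"
    and lim: "uniform_limit UNIV F' F sequentially"
    and cont: "continuous_on UNIV F" and proper: "\<And>B. bounded B \<Longrightarrow> bounded (F -` B)"
  shows "connected (F -` {w})" "F -` {w} \<noteq> {}"
proof -
  have near: "\<exists>n. \<forall>x. dist (F' n x) (F x) < e" if "e > 0" for e
    using uniform_limitD[OF lim that] by (auto simp: eventually_sequentially)
  have F'G: "F' n (G n y) = y" "G n (F' n x) = x" for n x y
    using homeo[of n] by (auto simp: homeomorphism_def)
  have "w \<in> closure (range F)"
  proof (subst closure_approachable, intro allI impI)
    fix e :: real assume "e > 0"
    then obtain n where n: "\<And>x. dist (F' n x) (F x) < e" using near by blast
    show "\<exists>y\<in>range F. dist y w < e"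
      using n[of "G n w"] F'G by (auto simp: dist_commute)
  qed
  moreover have "closed (range F)" by (rule proper_imp_closed_image[OF cont proper]) auto
  ultimately show "F -` {w} \<noteq> {}" by auto
  have closed: "closed (F -` {w})"
    using cont by (simp add: continuous_closed_vimage continuous_on_eq_continuous_at)
  show "connected (F -` {w})"
  proof (rule ccontr)
    assume "\<not> connected (F -` {w})"
    then obtain A B where AB: "closed A" "closed B" "A \<noteq> {}" "B \<noteq> {}" "A \<union> B = F -` {w}" "A \<inter> B = {}"
      using connected_closed_set[OF closed] by blast
    obtain U V where UV: "open U" "open V" "A \<subseteq> U" "B \<subseteq> V" "U \<inter> V = {}"
      using separation_normal AB by metis
    obtain R where R: "F -` {w} \<subseteq> ball 0 R"
      using proper[of "{w}"] by (metis bounded_insert bounded_empty bounded_subset_ballD)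
    define U' where "U' = U \<inter> ball 0 R"
    have "A \<subseteq> ball 0 R" using R AB by blast
    then have U': "open U'" "A \<subseteq> U'" "bounded U'" using UV by (auto simp: U'_def intro: bounded_Int)
    have "frontier U' \<inter> V = {}"
    proof -
      have "V \<inter> closure U = {}" using UV by (subst open_Int_closure_eq_empty) auto
      moreover have "closure U' \<subseteq> closure U" by (intro closure_mono) (auto simp: U'_def)
      ultimately show ?thesis by (auto simp: frontier_def)
    qed
    moreover have "frontier U' \<inter> U' = {}" using U' by (auto simp: frontier_def interior_open)
    ultimately have "w \<notin> F ` frontier U'" using AB UV U' by fastforce
    moreover have "compact (frontier U')" using U' by (simp add: compact_frontier_bounded)
    then have "closed (F ` frontier U')"
      using cont by (meson compact_continuous_image compact_imp_closed continuous_on_subset subset_UNIV)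
    ultimately obtain d where d: "d > 0" "ball w d \<inter> F ` frontier U' = {}"
      by (metis Compl_iff open_Compl open_contains_ball disjoint_eq_subset_Compl)
    obtain n where n: "\<And>x. dist (F' n x) (F x) < d / 2" using near[of "d/2"] d by auto
    define S where "S = G n ` ball w (d/2)"
    have "connected S" unfolding S_def
      using homeo[of n] by (intro connected_continuous_image) (auto simp: homeomorphism_def intro: continuous_on_subset)
    have mem: "x \<in> S \<longleftrightarrow> dist w (F' n x) < d / 2" for x
    proof
      assume "x \<in> S" then show "dist w (F' n x) < d / 2" using F'G by (auto simp: S_def)
    next
      assume "dist w (F' n x) < d / 2"
      then have "G n (F' n x) \<in> S" unfolding S_def by (intro imageI) simp
      then show "x \<in> S" using F'G by simp
    qed
    have fib: "F -` {w} \<subseteq> S" using n by (auto simp: mem dist_commute)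
    have "S \<inter> U' \<noteq> {}" using AB U' fib by blast
    moreover have "S - U' \<noteq> {}" using AB UV U'_def fib by blast
    ultimately obtain z where z: "z \<in> S" "z \<in> frontier U'"
      using connected_Int_frontier[OF \<open>connected S\<close>] by blast
    then have "dist w (F z) < d"
      using n[of z] dist_triangle[of w "F z" "F' n z"] by (simp add: mem)
    with z d show False by auto
  qed
qed

section \<open>Boundary values on a continuum in the circle\<close>

text \<open>
  A holomorphic function cannot have a constant boundary value on an arc unless it is constant; the
  form used here only evaluates it at the centre. Instead of showing that \<open>K\<close> contains an arc, rotate
  \<open>a\<close> to \<open>1\<close> and symmetrise: the real parts of the points of the rotated \<open>K\<close> fill an interval
  \<open>[c, 1]\<close>, so each \<open>u\<close> on the circle with \<open>Re u\<close> in it is such a point or the conjugate of one, and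
  the product \<open>H\<close> of \<open>g - w\<close> and its reflection vanishes at \<open>u\<close>. Finitely many rotations of this arc
  cover the circle. The product \<open>P\<close> of the corresponding rotations of \<open>H\<close> vanishes on the whole
  circle, so it vanishes at \<open>0\<close> by the maximum principle.
\<close>
lemma constant_on_circular_continuum_imp_centre:
  assumes cont: "continuous_on (cball 0 1) g" and hol: "g holomorphic_on ball 0 1"
    and K: "connected K" "K \<subseteq> sphere 0 1" "a \<in> K" "b \<in> K" "a \<noteq> b" and const: "\<And>z. z \<in> K \<Longrightarrow> g z = w"
  shows "g 0 = w"
proof -
  have a: "cmod a = 1" and b: "cmod b = 1" using K by auto
  define G where "G = (\<lambda>z. g (a * z) - w)"
  define H where "H = (\<lambda>z. G z * cnj (G (cnj z)))"
  have ball: "a * z \<in> ball 0 1" if "z \<in> ball 0 1" for z using that a by (simp add: norm_mult)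
  have G_hol: "G holomorphic_on ball 0 1"
    unfolding G_def
    by (intro holomorphic_intros holomorphic_on_compose_gen[OF _ hol, unfolded o_def]) (use ball in auto)
  moreover have cnj_ball: "cnj ` ball 0 1 = ball 0 1"
    by (auto simp: image_iff) (metis complex_cnj_cnj complex_mod_cnj mem_ball_0)
  ultimately have "(cnj \<circ> G \<circ> cnj) holomorphic_on ball 0 1"
    using cnj_ball by (intro holomorphic_on_compose_cnj_cnj) auto
  then have H_hol: "H holomorphic_on ball 0 1"
    unfolding H_def using G_hol by (auto intro!: holomorphic_intros simp: o_def)
  have G_cont: "continuous_on (cball 0 1) G"
    unfolding G_def by (intro continuous_intros continuous_on_compose2[OF cont]) (auto simp: norm_mult a)
  have H_cont: "continuous_on (cball 0 1) H"
    unfolding H_def by (intro continuous_intros G_cont continuous_on_compose2[OF G_cont]) auto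
  define c where "c = Re (cnj a * b)"
  have "c < 1"
  proof -
    have "(cmod (a - b))\<^sup>2 = (cmod a)\<^sup>2 + (cmod b)\<^sup>2 - 2 * c"
      unfolding cmod_power2 c_def by (simp add: power2_eq_square algebra_simps)
    moreover have "(cmod (a - b))\<^sup>2 > 0" using K by simp
    ultimately show ?thesis using a b by simp
  qed
  have H0: "H u = 0" if u: "cmod u = 1" "Re u \<ge> c" for u
  proof -
    have "connected ((\<lambda>z. Re (cnj a * z)) ` K)"
      by (intro connected_continuous_image continuous_intros K)
    moreover have "c \<in> (\<lambda>z. Re (cnj a * z)) ` K" using K by (auto simp: c_def)
    moreover have "cnj a * a = 1" using a by (metis complex_norm_square mult.commute of_real_1 one_power2)
    then have "1 \<in> (\<lambda>z. Re (cnj a * z)) ` K" using K by (metis imageI one_complex.sel(1))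
    moreover have "Re u \<le> 1" using u complex_Re_le_cmod[of u] by simp
    ultimately have "Re u \<in> (\<lambda>z. Re (cnj a * z)) ` K"
      using u unfolding connected_iff_interval by blast
    then obtain z where z: "z \<in> K" "Re u = Re (cnj a * z)" by auto
    define v where "v = cnj a * z"
    have "cmod v = 1" using z K a by (auto simp: v_def norm_mult)
    then have "(Re v)\<^sup>2 + (Im v)\<^sup>2 = (Re u)\<^sup>2 + (Im u)\<^sup>2" using u by (simp add: cmod_def)
    then have "Im v = Im u \<or> Im v = - Im u" using z by (simp add: v_def[symmetric] power2_eq_iff)
    then have "v = u \<or> v = cnj u" using z by (auto simp: complex_eq_iff v_def)
    moreover have "a * v = z" using \<open>cnj a * a = 1\<close> by (simp add: v_def mult.assoc[symmetric] mult.commute)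
    ultimately show ?thesis using const[OF z(1)] by (auto simp: H_def G_def)
  qed
  define O' where "O' = (\<lambda>v::complex. {u. Re (cnj v * u) > c})"
  have "compact (sphere (0::complex) 1)" by simp
  moreover have "open (O' v)" for v unfolding O'_def
    by (intro open_Collect_less continuous_intros)
  moreover have "sphere (0::complex) 1 \<subseteq> (\<Union>v\<in>sphere 0 1. O' v)"
  proof
    fix v :: complex assume v: "v \<in> sphere 0 1"
    then have "Re (cnj v * v) = 1" by (simp add: cmod_def power2_eq_square)
    with \<open>c < 1\<close> have "v \<in> O' v" by (simp add: O'_def)
    with v show "v \<in> (\<Union>v\<in>sphere 0 1. O' v)" by blast
  qed
  ultimately obtain V where V: "V \<subseteq> sphere 0 1" "finite V" "sphere 0 1 \<subseteq> (\<Union>v\<in>V. O' v)"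
    by (meson compactE_image)
  define P where "P = (\<lambda>z. \<Prod>v\<in>V. H (cnj v * z))"
  have "cmod (P 0) \<le> 0"
  proof (rule maximum_modulus_frontier[of P "ball 0 1"])
    show "P holomorphic_on interior (ball 0 1)"
      unfolding P_def using V
      by (intro holomorphic_intros holomorphic_on_compose_gen[OF _ H_hol, unfolded o_def]) (auto simp: norm_mult)
    show "continuous_on (closure (ball 0 1)) P"
      unfolding P_def using V by (intro continuous_intros continuous_on_compose2[OF H_cont]) (auto simp: norm_mult)
    fix u :: complex assume "u \<in> frontier (ball 0 1)"
    then have u: "u \<in> sphere 0 1" by simp
    then obtain v where v: "v \<in> V" "u \<in> O' v" using V by blast
    then have "H (cnj v * u) = 0" using V u by (intro H0) (auto simp: O'_def norm_mult)
    then show "cmod (P u) \<le> 0" using V v by (auto simp: P_def)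
  qed auto
  then have "H 0 = 0" using V by (auto simp: P_def)
  then show ?thesis by (auto simp: H_def G_def)
qed

section \<open>Distributional derivatives of limits of smooth maps\<close>

lemma compactly_supported_integrable:
  fixes g :: "'a::euclidean_space \<Rightarrow> 'b::euclidean_space"
  assumes "continuous_on UNIV g" "\<And>z. z \<notin> cball 0 R \<Longrightarrow> g z = 0"
  shows "integrable lborel g"
proof -
  have "integrable lborel (\<lambda>x. indicator (cball 0 R) x *\<^sub>R g x)"
    using assms by (intro borel_integrable_compact) (auto intro: continuous_on_subset)
  moreover have "(\<lambda>x. indicator (cball 0 R) x *\<^sub>R g x) = g"
    using assms by (auto simp: indicator_def)
  ultimately show ?thesis by simp
qed

text \<open>
  The integral of a difference quotient vanishes because Lebesgue measure is translation invariant.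
  The difference quotients converge boundedly, inside a fixed ball, to the directional derivative.
\<close>
lemma integral_directional_derivative_eq_0:
  fixes G :: "'a::euclidean_space \<Rightarrow> 'b::euclidean_space"
  assumes der: "\<And>z. (G has_derivative D z) (at z)"
    and cont: "continuous_on UNIV (\<lambda>z. D z v)"
    and supp: "\<And>z. z \<notin> cball 0 R \<Longrightarrow> G z = 0"
  shows "(LINT z|lborel. D z v) = 0"
proof -
  define t where "t = (\<lambda>n::nat. inverse (real (Suc n)))"
  have t: "0 < t n" "t n \<le> 1" for n by (auto simp: t_def divide_simps)
  have t0: "t \<longlonglongrightarrow> 0" unfolding t_def by (rule LIMSEQ_inverse_real_of_nat)
  define q where "q = (\<lambda>n z. (1 / t n) *\<^sub>R (G (z + t n *\<^sub>R v) - G z))"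
  have G_cont: "continuous_on UNIV G"
    by (intro continuous_at_imp_continuous_on ballI has_derivative_continuous[OF der])
  have [measurable]: "G \<in> borel_measurable borel" "(\<lambda>z. D z v) \<in> borel_measurable borel"
    using G_cont cont by (auto intro: borel_measurable_continuous_onI)
  have int_G: "integrable lborel G"
    by (rule compactly_supported_integrable[OF G_cont supp])
  have shift: "integrable lborel (\<lambda>z. G (z + c))" "(LINT z|lborel. G (z + c)) = (LINT z|lborel. G z)" for c
  proof -
    have eq: "distr lborel borel (\<lambda>z. z + c) = lborel" 
    proof -
      have "(\<lambda>z. z + c) = (+) c" by (simp add: fun_eq_iff add.commute)
      then show ?thesis using lborel_distr_plus[of c] by simp
    qed
    show "integrable lborel (\<lambda>z. G (z + c))"
      using integrable_distr_eq[of "\<lambda>z. z + c" lborel borel G] int_G by (simp add: eq)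
    show "(LINT z|lborel. G (z + c)) = (LINT z|lborel. G z)"
      using integral_distr[of "\<lambda>z. z + c" lborel borel G] by (simp add: eq)
  qed
  have int_q: "(LINT z|lborel. q n z) = 0" for n
    unfolding q_def using shift int_G by simp
  have line: "((\<lambda>s. G (z + s *\<^sub>R v)) has_vector_derivative D (z + s *\<^sub>R v) v) (at s within S)" for z s S
  proof -
    have "((\<lambda>s. z + s *\<^sub>R v) has_derivative (\<lambda>h. h *\<^sub>R v)) (at s within S)"
      by (auto intro!: derivative_eq_intros)
    from has_derivative_compose[OF this der]
    show ?thesis
      unfolding has_vector_derivative_def
      by (simp add: linear_cmul[OF bounded_linear.linear[OF has_derivative_bounded_linear[OF der]]])
  qed
  have lim: "(\<lambda>n. q n z) \<longlonglongrightarrow> D z v" for z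
  proof -
    have "((\<lambda>s. norm (G (z + s *\<^sub>R v) - G z - s *\<^sub>R D z v) / norm s) \<longlongrightarrow> 0) (at 0)"
      using line[of z 0 UNIV] unfolding has_vector_derivative_def has_derivative_at by simp
    moreover have "filterlim t (at 0) sequentially"
      using t0 t by (simp add: filterlim_at less_imp_neq[OF t(1), symmetric])
    ultimately have "(\<lambda>n. norm (G (z + t n *\<^sub>R v) - G z - t n *\<^sub>R D z v) / norm (t n)) \<longlonglongrightarrow> 0"
      by (rule filterlim_compose)
    moreover have "norm (G (z + t n *\<^sub>R v) - G z - t n *\<^sub>R D z v) / norm (t n) = norm (q n z - D z v)" for n
    proof -
      have "q n z - D z v = (1 / t n) *\<^sub>R (G (z + t n *\<^sub>R v) - G z - t n *\<^sub>R D z v)"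
        using t(1)[of n] by (simp add: q_def algebra_simps)
      then show ?thesis using t(1)[of n] by simp
    qed
    ultimately show ?thesis by (simp add: tendsto_norm_zero_iff LIM_zero_iff)
  qed
  define R' where "R' = R + norm v"
  obtain B where B: "\<And>z. z \<in> cball 0 (R' + norm v) \<Longrightarrow> norm (D z v) \<le> B" "B \<ge> 0"
  proof -
    have "compact ((\<lambda>z. D z v) ` cball 0 (R' + norm v))"
      using cont by (intro compact_continuous_image) (auto intro: continuous_on_subset)
    then show ?thesis using that
      by (metis bounded_pos compact_imp_bounded imageI less_eq_real_def)
  qed
  have bound: "norm (q n z) \<le> indicator (cball 0 R') z *\<^sub>R B" for n z
  proof (cases "z \<in> cball 0 R'")
    case True
    have "norm (G (z + t n *\<^sub>R v) - G (z + 0 *\<^sub>R v)) \<le> t n * B - 0 * B"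
    proof (rule differentiable_bound_general[OF t(1)])
      show "continuous_on {0..t n} (\<lambda>s. G (z + s *\<^sub>R v))"
        by (intro continuous_on_compose2[OF G_cont] continuous_intros) auto
      show "((\<lambda>s. G (z + s *\<^sub>R v)) has_vector_derivative D (z + s *\<^sub>R v) v) (at s)" for s
        by (rule line)
      show "norm (D (z + s *\<^sub>R v) v) \<le> B" if "0 < s" "s < t n" for s
      proof (rule B(1))
        have "norm (z + s *\<^sub>R v) \<le> norm z + s * norm v"
          using that norm_triangle_ineq[of z "s *\<^sub>R v"] by simp
        also have "s * norm v \<le> 1 * norm v" using that t(2)[of n] by (intro mult_right_mono) auto
        finally show "z + s *\<^sub>R v \<in> cball 0 (R' + norm v)" using True by simp
      qed
    qed (auto intro!: continuous_intros derivative_eq_intros)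
    moreover have "norm (q n z) = norm (G (z + t n *\<^sub>R v) - G z) / t n"
      using t(1)[of n] by (simp add: q_def)
    ultimately show ?thesis using True t(1)[of n] by (simp add: pos_divide_le_eq mult.commute)
  next
    case False
    have "norm (t n *\<^sub>R v) \<le> norm v" using t[of n] by (simp add: mult_left_le_one_le)
    then have "z + t n *\<^sub>R v \<notin> cball 0 R" "z \<notin> cball 0 R"
      using False norm_diff_ineq[of z "t n *\<^sub>R v"] norm_ge_zero[of v] by (auto simp: R'_def simp del: norm_scaleR norm_ge_zero)
    then show ?thesis using supp by (simp add: q_def B)
  qed
  have "(\<lambda>n. LINT z|lborel. q n z) \<longlonglongrightarrow> (LINT z|lborel. D z v)"
  proof (rule integral_dominated_convergence)
    show "integrable lborel (\<lambda>z. indicator (cball 0 R') z *\<^sub>R B)"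
      by (intro borel_integrable_compact) auto
    show "q n \<in> borel_measurable lborel" for n unfolding q_def by measurable
  qed (use lim bound in auto)
  then show ?thesis by (simp add: int_q LIMSEQ_const_iff)
qed

lemma test_function_C1:
  assumes "test_function_on G \<phi>"
  shows "(\<phi> has_derivative (\<lambda>h. wirtinger_dz \<phi> z * h + wirtinger_dzbar \<phi> z * cnj h)) (at z)"
    and "continuous_on UNIV \<phi>" "continuous_on UNIV (wirtinger_dz \<phi>)" "continuous_on UNIV (wirtinger_dzbar \<phi>)"
proof -
  have Ck: "C_k (Suc 0) \<phi>" "C_k 0 \<phi>"
    using assms unfolding test_function_on_def by blast+
  then have diff: "\<phi> differentiable (at z)" for z by simp
  show "(\<phi> has_derivative (\<lambda>h. wirtinger_dz \<phi> z * h + wirtinger_dzbar \<phi> z * cnj h)) (at z)"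
  proof -
    define L where "L = frechet_derivative \<phi> (at z)"
    have L: "(\<phi> has_derivative L) (at z)" unfolding L_def using diff frechet_derivative_works by blast
    then have lin: "linear L" by (simp add: has_derivative_linear)
    have "L h = wirtinger_dz \<phi> z * h + wirtinger_dzbar \<phi> z * cnj h" for h
    proof -
      have "h = Re h *\<^sub>R 1 + Im h *\<^sub>R \<i>" by (simp add: complex_eq_iff)
      then have "L h = L (Re h *\<^sub>R 1 + Im h *\<^sub>R \<i>)" by (rule arg_cong)
      also have "\<dots> = Re h *\<^sub>R L 1 + Im h *\<^sub>R L \<i>"
        by (simp only: linear_add[OF lin] linear_cmul[OF lin])
      also have "\<dots> = L 1 * ((h + cnj h) / 2) - \<i> * L \<i> * ((h - cnj h) / 2)"
      proof -
        have "\<i> * L \<i> * (of_real (Im h) * \<i>) = - (of_real (Im h) * L \<i>)"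
          using i_squared by algebra
        then show ?thesis by (simp add: complex_add_cnj complex_diff_cnj scaleR_conv_of_real)
      qed
      also have "\<dots> = wirtinger_dz \<phi> z * h + wirtinger_dzbar \<phi> z * cnj h"
        unfolding wirtinger_dz_def wirtinger_dzbar_def partial_x_def partial_y_def L_def[symmetric]
        by (simp add: algebra_simps add_divide_distrib diff_divide_distrib)
      finally show ?thesis .
    qed
    then have "L = (\<lambda>h. wirtinger_dz \<phi> z * h + wirtinger_dzbar \<phi> z * cnj h)" by (rule ext)
    then show ?thesis by (rule has_derivative_eq_rhs[OF L])
  qed
  show "continuous_on UNIV \<phi>" using Ck by simp
  show "continuous_on UNIV (wirtinger_dz \<phi>)" "continuous_on UNIV (wirtinger_dzbar \<phi>)"
    unfolding wirtinger_dz_def wirtinger_dzbar_def using Ck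
    by (simp_all add: continuous_on_divide continuous_on_diff continuous_on_add continuous_on_mult)
qed

lemma test_function_support:
  assumes "test_function_on G \<phi>"
  obtains R where "\<And>z. z \<notin> cball 0 R \<Longrightarrow> \<phi> z = 0 \<and> wirtinger_dz \<phi> z = 0 \<and> wirtinger_dzbar \<phi> z = 0"
proof -
  have cpt: "compact (closure {z. \<phi> z \<noteq> 0})"
    using assms unfolding test_function_on_def by blast
  obtain R where R: "closure {z. \<phi> z \<noteq> 0} \<subseteq> cball 0 R"
    using bounded_subset_ballD[OF compact_imp_bounded[OF cpt], of 0] ball_subset_cball[of 0] by blast
  have supp: "\<phi> z = 0" if "z \<notin> cball 0 R" for z
    using R that closure_subset[of "{z. \<phi> z \<noteq> 0}"] by blast
  have part: "partial_x \<phi> z = 0 \<and> partial_y \<phi> z = 0" if "z \<notin> cball 0 R" for z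
  proof -
    have "(\<phi> has_derivative (\<lambda>h. 0)) (at z)"
    proof (rule has_derivative_transform_within_open[of "\<lambda>_. 0" _ _ _ "- cball 0 R"])
      show "((\<lambda>_. 0) has_derivative (\<lambda>h. 0)) (at z)" by simp
    qed (use that supp in auto)
    then have "frechet_derivative \<phi> (at z) = (\<lambda>h. 0)"
      by (rule frechet_derivative_at[symmetric])
    then show ?thesis by (simp add: partial_x_def partial_y_def)
  qed
  show ?thesis
    by (rule that[of R]) (use supp part in \<open>auto simp: wirtinger_dz_def wirtinger_dzbar_def\<close>)
qed

text \<open>
  The Wirtinger derivatives of the product \<open>F * \<phi>\<close> are combinations of its directional derivatives
  along \<open>1\<close> and \<open>\<i>\<close>, whose integrals vanish.
\<close>
lemma C1_integration_by_parts:
  assumes der: "\<And>z. (F has_derivative (\<lambda>h. A z * h + B z * cnj h)) (at z)"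
    and cont: "continuous_on UNIV A" "continuous_on UNIV B"
    and \<phi>: "test_function_on G \<phi>"
  shows "(LINT z|lborel. F z * wirtinger_dz \<phi> z) = - (LINT z|lborel. A z * \<phi> z)"
    and "(LINT z|lborel. F z * wirtinger_dzbar \<phi> z) = - (LINT z|lborel. B z * \<phi> z)"
proof -
  obtain R where R: "\<And>z. z \<notin> cball 0 R \<Longrightarrow> \<phi> z = 0 \<and> wirtinger_dz \<phi> z = 0 \<and> wirtinger_dzbar \<phi> z = 0"
    by (rule test_function_support[OF \<phi>]) blast
  then have s\<phi>: "\<And>z. z \<notin> cball 0 R \<Longrightarrow> \<phi> z = 0" "\<And>z. z \<notin> cball 0 R \<Longrightarrow> wirtinger_dz \<phi> z = 0"
    "\<And>z. z \<notin> cball 0 R \<Longrightarrow> wirtinger_dzbar \<phi> z = 0" by blast+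
  note d\<phi> = test_function_C1(1)[OF \<phi>] and c\<phi> = test_function_C1(2-4)[OF \<phi>]
  define D where "D = (\<lambda>z h. F z * (wirtinger_dz \<phi> z * h + wirtinger_dzbar \<phi> z * cnj h) + (A z * h + B z * cnj h) * \<phi> z)"
  have F_cont: "continuous_on UNIV F"
    by (intro continuous_at_imp_continuous_on ballI has_derivative_continuous[OF der])
  have D: "((\<lambda>z. F z * \<phi> z) has_derivative D z) (at z)" for z
    unfolding D_def by (rule has_derivative_mult[OF der d\<phi>])
  have D0: "(LINT z|lborel. D z h) = 0" for h
  proof (rule integral_directional_derivative_eq_0[OF D])
    show "continuous_on UNIV (\<lambda>z. D z h)"
      unfolding D_def by (intro continuous_on_mult continuous_on_add continuous_on_const cont c\<phi> F_cont)
    show "F z * \<phi> z = 0" if "z \<notin> cball 0 R" for z using s\<phi>(1)[OF that] by simp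
  qed
  have int: "integrable lborel (\<lambda>z. F z * wirtinger_dz \<phi> z)" "integrable lborel (\<lambda>z. A z * \<phi> z)"
    "integrable lborel (\<lambda>z. F z * wirtinger_dzbar \<phi> z)" "integrable lborel (\<lambda>z. B z * \<phi> z)"
    by (rule compactly_supported_integrable[of _ R], (intro continuous_on_mult cont c\<phi> F_cont), simp add: s\<phi>)+
  have intD: "integrable lborel (\<lambda>z. D z h)" for h
    unfolding D_def
    by (rule compactly_supported_integrable[of _ R])
       (intro continuous_on_mult continuous_on_add continuous_on_const cont c\<phi> F_cont, simp add: s\<phi>)
  have eqs: "F z * wirtinger_dz \<phi> z + A z * \<phi> z = (D z 1 - \<i> * D z \<i>) / 2"
    and eqs': "F z * wirtinger_dzbar \<phi> z + B z * \<phi> z = (D z 1 + \<i> * D z \<i>) / 2" for z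
    by (simp_all add: D_def algebra_simps)
  have "(LINT z|lborel. F z * wirtinger_dz \<phi> z + A z * \<phi> z) = 0"
    unfolding eqs using D0 intD by simp
  then have "(LINT z|lborel. F z * wirtinger_dz \<phi> z) + (LINT z|lborel. A z * \<phi> z) = 0"
    using Bochner_Integration.integral_add[OF int(1,2)] by simp
  then show "(LINT z|lborel. F z * wirtinger_dz \<phi> z) = - (LINT z|lborel. A z * \<phi> z)"
    by (rule eq_neg_iff_add_eq_0[THEN iffD2])
  have "(LINT z|lborel. F z * wirtinger_dzbar \<phi> z + B z * \<phi> z) = 0"
    unfolding eqs' using D0 intD by simp
  then have "(LINT z|lborel. F z * wirtinger_dzbar \<phi> z) + (LINT z|lborel. B z * \<phi> z) = 0"
    using Bochner_Integration.integral_add[OF int(3,4)] by simp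
  then show "(LINT z|lborel. F z * wirtinger_dzbar \<phi> z) = - (LINT z|lborel. B z * \<phi> z)"
    by (rule eq_neg_iff_add_eq_0[THEN iffD2])
qed

lemma integral_against_test_limit:
  fixes U :: "complex \<Rightarrow> complex"
  assumes meas: "\<And>n. U' n \<in> borel_measurable borel" "U \<in> borel_measurable borel"
    and \<omega>: "set_integrable lborel (cball 0 R) \<omega>"
    and lim: "AE z in lborel. (\<lambda>n. U' n z) \<longlonglongrightarrow> U z"
    and bound: "\<And>n. AE z in lborel. z \<in> cball 0 R \<longrightarrow> cmod (U' n z) \<le> \<omega> z"
    and \<psi>: "continuous_on UNIV \<psi>" "\<And>z. z \<notin> cball 0 R \<Longrightarrow> \<psi> z = 0"
  shows "(\<lambda>n. LINT z|lborel. U' n z * \<psi> z) \<longlonglongrightarrow> (LINT z|lborel. U z * \<psi> z)"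
proof -
  have "compact (\<psi> ` cball 0 R)"
    using \<psi> by (intro compact_continuous_image) (auto intro: continuous_on_subset)
  then obtain C where C: "\<And>z. z \<in> cball 0 R \<Longrightarrow> cmod (\<psi> z) \<le> C"
    by (metis bounded_pos compact_imp_bounded imageI)
  have [measurable]: "\<psi> \<in> borel_measurable borel" using \<psi> by (intro borel_measurable_continuous_onI)
  note [measurable] = meas
  show ?thesis
  proof (rule integral_dominated_convergence[where w = "\<lambda>z. indicator (cball 0 R) z *\<^sub>R \<omega> z * C"])
    show "integrable lborel (\<lambda>z. indicator (cball 0 R) z *\<^sub>R \<omega> z * C)"
      using \<omega> unfolding set_integrable_def by (rule integrable_mult_left)
    show "AE z in lborel. (\<lambda>n. U' n z * \<psi> z) \<longlonglongrightarrow> U z * \<psi> z"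
      using lim by eventually_elim (rule tendsto_mult_right)
    show "AE z in lborel. norm (U' n z * \<psi> z) \<le> indicator (cball 0 R) z *\<^sub>R \<omega> z * C" for n
      using bound[of n]
    proof eventually_elim
      case (elim z)
      show ?case
      proof (cases "z \<in> cball 0 R")
        case True
        then show ?thesis using elim C[OF True] by (auto simp: norm_mult intro!: mult_mono intro: order.trans[OF norm_ge_zero])
      qed (use \<psi> in auto)
    qed
  qed measurable
qed

lemma set_lebesgue_integral_lebesgue_UNIV:
  fixes g :: "complex \<Rightarrow> complex"
  assumes "g \<in> borel_measurable borel"
  shows "(LINT z:UNIV|lebesgue. g z) = (LINT z|lborel. g z)"
  using assms by (simp add: set_lebesgue_integral_def integral_completion)

text \<open>
  Integration by parts for the maps \<open>F' n\<close> passes to the limit by dominated convergence. Convergence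
  almost everywhere is what the application provides: the derivatives converge off the unit circle.
\<close>
lemma distributional_derivatives_of_limit:
  assumes der: "\<And>n z. (F' n has_derivative (\<lambda>h. A' n z * h + B' n z * cnj h)) (at z)"
    and cont: "\<And>n. continuous_on UNIV (A' n)" "\<And>n. continuous_on UNIV (B' n)"
    and meas: "F \<in> borel_measurable borel" "A \<in> borel_measurable borel" "B \<in> borel_measurable borel"
    and lim: "AE z in lborel. (\<lambda>n. F' n z) \<longlonglongrightarrow> F z" "AE z in lborel. (\<lambda>n. A' n z) \<longlonglongrightarrow> A z"
      "AE z in lborel. (\<lambda>n. B' n z) \<longlonglongrightarrow> B z"
    and \<omega>: "\<And>R. set_integrable lborel (cball 0 R) (\<omega> R)"
    and bound: "\<And>R n. AE z in lborel. z \<in> cball 0 R \<longrightarrow> cmod (F' n z) \<le> \<omega> R z"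
      "\<And>R n. AE z in lborel. z \<in> cball 0 R \<longrightarrow> cmod (A' n z) \<le> \<omega> R z"
      "\<And>R n. AE z in lborel. z \<in> cball 0 R \<longrightarrow> cmod (B' n z) \<le> \<omega> R z"
  shows "distributional_dz UNIV F A" "distributional_dzbar UNIV F B"
    "locally_integrable_on A UNIV" "locally_integrable_on B UNIV"
proof -
  have F'_cont: "continuous_on UNIV (F' n)" for n
    by (intro continuous_at_imp_continuous_on ballI has_derivative_continuous[OF der])
  note m' = borel_measurable_continuous_onI
  have meas': "F' n \<in> borel_measurable borel" "A' n \<in> borel_measurable borel" "B' n \<in> borel_measurable borel" for n
    using F'_cont cont by (auto intro: m')
  note [measurable] = meas
  show "distributional_dz UNIV F A"
    unfolding distributional_dz_def
  proof (intro allI impI)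
    fix \<phi> assume \<phi>: "test_function_on UNIV \<phi>"
    obtain R where R: "\<And>z. z \<notin> cball 0 R \<Longrightarrow> \<phi> z = 0 \<and> wirtinger_dz \<phi> z = 0 \<and> wirtinger_dzbar \<phi> z = 0"
      by (rule test_function_support[OF \<phi>]) blast
    note p = test_function_C1[OF \<phi>]
    note [measurable] = p(2,3,4)[THEN m']
    have 1: "(\<lambda>n. LINT z|lborel. F' n z * wirtinger_dz \<phi> z) \<longlonglongrightarrow> (LINT z|lborel. F z * wirtinger_dz \<phi> z)"
      using R by (intro integral_against_test_limit[OF meas'(1) meas(1) \<omega> lim(1) bound(1) p(3)]) auto
    have "(\<lambda>n. LINT z|lborel. A' n z * \<phi> z) \<longlonglongrightarrow> (LINT z|lborel. A z * \<phi> z)"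
      using R by (intro integral_against_test_limit[OF meas'(2) meas(2) \<omega> lim(2) bound(2) p(2)]) auto
    then have 2: "(\<lambda>n. LINT z|lborel. F' n z * wirtinger_dz \<phi> z) \<longlonglongrightarrow> - (LINT z|lborel. A z * \<phi> z)"
      by (simp add: C1_integration_by_parts(1)[OF der cont \<phi>] tendsto_minus)
    show "(LINT z:UNIV|lebesgue. F z * wirtinger_dz \<phi> z) = - (LINT z:UNIV|lebesgue. A z * \<phi> z)"
      using LIMSEQ_unique[OF 1 2] by (simp add: set_lebesgue_integral_lebesgue_UNIV)
  qed
  show "distributional_dzbar UNIV F B"
    unfolding distributional_dzbar_def
  proof (intro allI impI)
    fix \<phi> assume \<phi>: "test_function_on UNIV \<phi>"
    obtain R where R: "\<And>z. z \<notin> cball 0 R \<Longrightarrow> \<phi> z = 0 \<and> wirtinger_dz \<phi> z = 0 \<and> wirtinger_dzbar \<phi> z = 0"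
      by (rule test_function_support[OF \<phi>]) blast
    note p = test_function_C1[OF \<phi>]
    note [measurable] = p(2,3,4)[THEN m']
    have 1: "(\<lambda>n. LINT z|lborel. F' n z * wirtinger_dzbar \<phi> z) \<longlonglongrightarrow> (LINT z|lborel. F z * wirtinger_dzbar \<phi> z)"
      using R by (intro integral_against_test_limit[OF meas'(1) meas(1) \<omega> lim(1) bound(1) p(4)]) auto
    have "(\<lambda>n. LINT z|lborel. B' n z * \<phi> z) \<longlonglongrightarrow> (LINT z|lborel. B z * \<phi> z)"
      using R by (intro integral_against_test_limit[OF meas'(3) meas(3) \<omega> lim(3) bound(3) p(2)]) auto
    then have 2: "(\<lambda>n. LINT z|lborel. F' n z * wirtinger_dzbar \<phi> z) \<longlonglongrightarrow> - (LINT z|lborel. B z * \<phi> z)"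
      by (simp add: C1_integration_by_parts(2)[OF der cont \<phi>] tendsto_minus)
    show "(LINT z:UNIV|lebesgue. F z * wirtinger_dzbar \<phi> z) = - (LINT z:UNIV|lebesgue. B z * \<phi> z)"
      using LIMSEQ_unique[OF 1 2] by (simp add: set_lebesgue_integral_lebesgue_UNIV)
  qed
  have loc: "locally_integrable_on U UNIV"
    if U: "U \<in> borel_measurable borel" "AE z in lborel. (\<lambda>n. U' n z) \<longlonglongrightarrow> U z"
      "\<And>R n. AE z in lborel. z \<in> cball 0 R \<longrightarrow> cmod (U' n z) \<le> \<omega> R z" for U U' :: "_ \<Rightarrow> _"
    unfolding locally_integrable_on_def
  proof (intro allI impI)
    fix K :: "complex set" assume K: "compact K \<and> K \<subseteq> UNIV"
    then obtain R where R: "K \<subseteq> cball 0 R"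
      using bounded_subset_ballD[OF compact_imp_bounded, of K 0] ball_subset_cball[of 0] by blast
    have [measurable]: "K \<in> sets borel" "U \<in> borel_measurable borel" using K U by (auto intro: borel_compact)
    have "AE z in lborel. \<forall>n. z \<in> cball 0 R \<longrightarrow> cmod (U' n z) \<le> \<omega> R z"
      unfolding AE_all_countable using U(3) by blast
    with U(2) have le: "AE z in lborel. z \<in> cball 0 R \<longrightarrow> cmod (U z) \<le> \<omega> R z"
    proof eventually_elim
      case (elim z)
      then show ?case using LIMSEQ_le_const2[OF tendsto_norm[OF elim(1)]] by blast
    qed
    have "integrable lborel (\<lambda>z. indicator K z *\<^sub>R U z)"
    proof (rule Bochner_Integration.integrable_bound)
      show "integrable lborel (\<lambda>z. indicator (cball 0 R) z *\<^sub>R \<omega> R z)"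
        using \<omega> by (simp add: set_integrable_def)
      show "AE z in lborel. norm (indicator K z *\<^sub>R U z) \<le> norm (indicator (cball 0 R) z *\<^sub>R \<omega> R z)"
        using le by eventually_elim (use R in \<open>auto simp: indicator_def\<close>)
    qed measurable
    then show "U absolutely_integrable_on K"
      unfolding set_integrable_def by (subst integrable_completion) auto
  qed
  show "locally_integrable_on A UNIV" by (rule loc[OF meas(2) lim(2) bound(2)])
  show "locally_integrable_on B UNIV" by (rule loc[OF meas(3) lim(3) bound(3)])
qed

text \<open>
  The annulus \<open>S n\<close> of points at distance at most \<open>(1/4)^n\<close> from the unit circle has area
  \<open>4 * pi * (1/4)^n\<close>, and outside \<open>S (Suc n)\<close> the integrand is at most \<open>2 ^ Suc n\<close>. So the
  integrand is bounded by \<open>1\<close> plus a weighted sum of indicators of annuli, and the weighted areas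
  form a geometric series of ratio \<open>1/2\<close>. On the circle itself the integrand is \<open>0\<close> by the
  convention for division by zero.
\<close>
lemma inverse_sqrt_circle_distance_integrable:
  "set_integrable lborel (cball 0 R) (\<lambda>z::complex. 1 / sqrt \<bar>cmod z - 1\<bar>)"
proof -
  define S where "S = (\<lambda>n::nat. cball 0 (1 + (1/4)^n) - ball (0::complex) (1 - (1/4)^n))"
  have le1: "(1/4::real)^n \<le> 1" for n by (simp add: power_le_one)
  have S_meas[measurable]: "S n \<in> sets borel" for n unfolding S_def by auto
  have emS: "emeasure lborel (S n) = ennreal (4 * pi * (1/4)^n)" for n
  proof -
    have "ball (0::complex) (1 - (1/4)^n) \<subseteq> cball 0 (1 + (1/4)^n)"
    proof
      fix x :: complex assume "x \<in> ball 0 (1 - (1/4)^n)"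
      moreover have "(1/4::real)^n \<ge> 0" by simp
      ultimately show "x \<in> cball 0 (1 + (1/4)^n)" unfolding mem_ball_0 mem_cball_0 by linarith
    qed
    then have "emeasure lborel (S n) = emeasure lborel (cball (0::complex) (1 + (1/4)^n)) - emeasure lborel (ball (0::complex) (1 - (1/4)^n))"
      unfolding S_def using le1[of n] by (intro emeasure_Diff) (auto simp: emeasure_ball)
    also have "\<dots> = ennreal (pi * (1 + (1/4)^n)\<^sup>2) - ennreal (pi * (1 - (1/4)^n)\<^sup>2)"
      using le1[of n] by (simp add: emeasure_ball emeasure_cball unit_ball_vol_numeral)
    also have "\<dots> = ennreal (pi * (1 + (1/4)^n)\<^sup>2 - pi * (1 - (1/4)^n)\<^sup>2)"
      by (intro ennreal_minus) auto
    also have "pi * (1 + (1/4)^n)\<^sup>2 - pi * (1 - (1/4)^n)\<^sup>2 = 4 * pi * (1/4)^n"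
      by (simp add: power2_eq_square algebra_simps)
    finally show ?thesis .
  qed
  define w where "w = (\<lambda>z::complex. 1 / sqrt \<bar>cmod z - 1\<bar>)"
  have pointwise: "ennreal (w z) \<le> 1 + (\<Sum>n. ennreal (2 ^ Suc n) * indicator (S n) z)" for z
  proof -
    define d where "d = \<bar>cmod z - 1\<bar>"
    consider "d = 0" | "d \<ge> 1" | "0 < d" "d < 1" unfolding d_def by fastforce
    then show ?thesis
    proof cases
      case 1 then show ?thesis by (simp add: w_def d_def)
    next
      case 2
      then have "w z \<le> 1" by (simp add: w_def d_def)
      then have "ennreal (w z) \<le> 1" by (simp add: ennreal_le_1)
      then show ?thesis by (simp add: add_increasing2)
    next
      case 3
      obtain m where "(1/4)^m < d" using real_arch_pow_inv[of d "1/4"] 3 by auto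
      define n where "n = (LEAST m. (1/4)^m < d)"
      have n: "(1/4)^n < d" unfolding n_def by (rule LeastI) fact
      then have "n \<noteq> 0" using 3 by (cases "n = 0") auto
      then obtain k where k: "n = Suc k" using not0_implies_Suc by blast
      have dk: "d \<le> (1/4)^k" using not_less_Least[of k "\<lambda>m. (1/4)^m < d"] k by (simp add: n_def)
      have "z \<in> S k" using dk by (auto simp: S_def d_def)
      have "((1/2)^n)\<^sup>2 < d" using n by (simp add: power2_eq_square flip: power_mult_distrib)
      then have "(1/2)^n < sqrt d" by (simp add: real_less_rsqrt)
      then have "w z \<le> 2 ^ Suc k"
        unfolding w_def d_def[symmetric] k using 3 by (simp add: field_simps power_one_over)
      then have "ennreal (w z) \<le> ennreal (2 ^ Suc k) * indicator (S k) z"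
        using \<open>z \<in> S k\<close> by (simp add: ennreal_leI)
      also have "\<dots> \<le> (\<Sum>n. ennreal (2 ^ Suc n) * indicator (S n) z)"
        using sum_le_suminf[of "\<lambda>n. ennreal (2 ^ Suc n) * indicator (S n) z" "{k}"]
        by (simp only: sum.insert sum.empty finite.intros empty_iff not_False_eq_True add_0_right summableI zero_le simp_thms)
      finally show ?thesis by (simp add: add_increasing)
    qed
  qed
  have "(\<integral>\<^sup>+z. ennreal (w z) * indicator (cball 0 R) z \<partial>lborel)
     \<le> (\<integral>\<^sup>+z. indicator (cball (0::complex) R) z + (\<Sum>n. ennreal (2 ^ Suc n) * indicator (S n) z) \<partial>lborel)"
    using pointwise by (intro nn_integral_mono) (auto simp: indicator_def)
  also have "\<dots> = emeasure lborel (cball (0::complex) R) + (\<Sum>n. ennreal (2 ^ Suc n) * emeasure lborel (S n))"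
    by (subst nn_integral_add) (auto simp: nn_integral_suminf nn_integral_cmult_indicator intro!: borel_measurable_indicator)
  also have "(\<Sum>n. ennreal (2 ^ Suc n) * emeasure lborel (S n)) = (\<Sum>n. ennreal (8 * pi * (1/2)^n))"
  proof (rule suminf_cong)
    fix n
    have "2 ^ Suc n * (4 * pi * (1/4)^n) = 8 * pi * ((2 * (1/4))^n :: real)"
      by (subst power_mult_distrib) simp
    then show "ennreal (2 ^ Suc n) * emeasure lborel (S n) = ennreal (8 * pi * (1/2)^n)"
      unfolding emS by (subst ennreal_mult[symmetric]) auto
  qed
  also have "\<dots> = ennreal (\<Sum>n. 8 * pi * (1/2)^n)"
    by (intro suminf_ennreal2 summable_mult) auto
  also have "emeasure lborel (cball (0::complex) R) + ennreal (\<Sum>n. 8 * pi * (1/2)^n) < \<infinity>"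
    using emeasure_compact_finite[of "cball (0::complex) R"] by (simp add: less_top)
  finally have fin: "(\<integral>\<^sup>+z. ennreal (w z) * indicator (cball 0 R) z \<partial>lborel) < \<infinity>" .
  have "integrable lborel (\<lambda>z. indicator (cball 0 R) z *\<^sub>R w z)"
  proof (rule integrableI_nonneg)
    have "(\<lambda>z::complex. sqrt \<bar>cmod z - 1\<bar>) \<in> borel_measurable borel"
      by (intro borel_measurable_continuous_onI continuous_intros)
    then have "w \<in> borel_measurable borel" unfolding w_def by simp
    then show "(\<lambda>z. indicator (cball 0 R) z *\<^sub>R w z) \<in> borel_measurable lborel"
      by (intro borel_measurable_scaleR borel_measurable_indicator) auto
    have "(\<integral>\<^sup>+z. ennreal (indicator (cball 0 R) z *\<^sub>R w z) \<partial>lborel) = (\<integral>\<^sup>+z. ennreal (w z) * indicator (cball 0 R) z \<partial>lborel)"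
      by (intro nn_integral_cong) (auto simp: indicator_def)
    with fin show "(\<integral>\<^sup>+z. ennreal (indicator (cball 0 R) z *\<^sub>R w z) \<partial>lborel) < \<infinity>" by simp
  qed (auto simp: w_def)
  then show ?thesis by (simp add: set_integrable_def w_def)
qed

section \<open>Becker's extension of a dilated function\<close>

text \<open>
  Folding the exterior of the unit circle onto the disk by the reflection in the circle lets one
  formula describe the extension on both sides.
\<close>
definition circle_fold :: "complex \<Rightarrow> complex" where
  "circle_fold z = (if cmod z \<le> 1 then z else 1 / cnj z)"

lemma circle_fold_eq:
  "cmod z \<le> 1 \<Longrightarrow> circle_fold z = z" "1 \<le> cmod z \<Longrightarrow> circle_fold z = 1 / cnj z"
proof -
  show "cmod z \<le> 1 \<Longrightarrow> circle_fold z = z" by (simp add: circle_fold_def)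
  assume z: "1 \<le> cmod z"
  show "circle_fold z = 1 / cnj z"
  proof (cases "cmod z = 1")
    case True
    then have "z * cnj z = 1" by (metis complex_norm_square of_real_1 one_power2)
    moreover have "cnj z \<noteq> 0" using True by auto
    ultimately show ?thesis using True by (simp add: circle_fold_def divide_simps)
  qed (use z in \<open>simp add: circle_fold_def\<close>)
qed

lemma cmod_circle_fold_le: "cmod (circle_fold z) \<le> 1"
  by (simp add: circle_fold_def norm_divide divide_simps)

lemma cmod_circle_fold_less: "cmod z \<noteq> 1 \<Longrightarrow> cmod (circle_fold z) < 1"
  by (auto simp: circle_fold_def norm_divide divide_simps)

lemma continuous_on_circle_fold: "continuous_on UNIV circle_fold"
proof -
  have "continuous_on UNIV (\<lambda>z. if cmod z \<le> 1 then z else 1 / cnj z)"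
  proof (rule continuous_on_cases_le)
    show "continuous_on {x \<in> UNIV. 1 \<le> cmod x} (\<lambda>z. 1 / cnj z)"
      by (intro continuous_intros) auto
    show "z = 1 / cnj z" if "cmod z = 1" for z
      using circle_fold_eq[of z] that by simp
  qed (intro continuous_intros)+
  then show ?thesis by (simp add: circle_fold_def[abs_def])
qed

lemma circle_fold_displacement:
  "cmod (z - circle_fold z) * cmod (circle_fold z) \<le> 1 - (cmod (circle_fold z))\<^sup>2"
proof (cases "cmod z \<le> 1")
  case True
  then show ?thesis by (simp add: circle_fold_eq power_le_one)
next
  case False
  then have z: "cmod z > 1" "z \<noteq> 0" by auto
  have "z - 1 / cnj z = of_real ((cmod z)\<^sup>2 - 1) / cnj z"
    using z by (simp add: divide_simps complex_norm_square mult.commute del: of_real_power)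
  then have "cmod (z - 1 / cnj z) = ((cmod z)\<^sup>2 - 1) / cmod z"
    using z by (simp add: norm_divide one_le_power abs_of_nonneg del: of_real_power of_real_diff)
  then show ?thesis using z False
    by (simp add: circle_fold_def norm_divide field_simps power2_eq_square)
qed

text \<open>
  An \<open>\<real>\<close>-linear map of the plane has the form \<open>h \<mapsto> a * h + b * cnj h\<close>; its Beltrami coefficient is
  \<open>b / a\<close>, and it is invertible when this is smaller than \<open>1\<close> in modulus.
\<close>
lemma real_linear_bound_below:
  fixes a b h :: complex
  assumes "cmod b \<le> k * cmod a"
  shows "(1 - k) * cmod a * cmod h \<le> cmod (a * h + b * cnj h)"
proof -
  have "cmod (a * h) - cmod (b * cnj h) \<le> cmod (a * h + b * cnj h)"
    using norm_triangle_ineq2[of "a * h" "- (b * cnj h)"] by simp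
  moreover have "cmod (b * cnj h) \<le> k * cmod a * cmod h"
    using assms by (simp add: norm_mult mult_right_mono)
  ultimately show ?thesis by (simp add: norm_mult algebra_simps)
qed

lemma real_linear_left_inverse:
  fixes a b :: complex
  assumes "cmod b < cmod a"
  obtains L where "bounded_linear L" "L \<circ> (\<lambda>h. a * h + b * cnj h) = id"
proof
  define d where "d = complex_of_real ((cmod a)\<^sup>2 - (cmod b)\<^sup>2)"
  have "(cmod b)\<^sup>2 < (cmod a)\<^sup>2" using assms by (intro power_strict_mono) auto
  then have d: "d \<noteq> 0" unfolding d_def of_real_eq_0_iff by linarith
  have d': "d = a * cnj a - b * cnj b" by (simp add: d_def complex_norm_square del: of_real_power)
  define L where "L = (\<lambda>y. (cnj a * y - b * cnj y) / d)"
  have "bounded_linear (\<lambda>y. cnj a * y - b * cnj y)"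
    by (intro bounded_linear_sub bounded_linear_mult_right bounded_linear_const_mult bounded_linear_cnj)
  then show "bounded_linear L" unfolding L_def
    by (rule bounded_linear_compose[OF bounded_linear_divide, unfolded o_def])
  show "L \<circ> (\<lambda>h. a * h + b * cnj h) = id"
  proof
    fix h
    have "cnj a * (a * h + b * cnj h) - b * cnj (a * h + b * cnj h) = d * h"
      unfolding d' by (simp add: algebra_simps)
    then show "(L \<circ> (\<lambda>h. a * h + b * cnj h)) h = id h" using d by (simp add: L_def)
  qed
qed


locale becker =
  fixes g :: "complex \<Rightarrow> complex" and k :: real
  assumes hol: "g holomorphic_on unit_disk"
    and g0: "g 0 = 0" and deriv_0: "deriv g 0 = 1"
    and deriv_nz: "z \<in> unit_disk \<Longrightarrow> deriv g z \<noteq> 0"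
    and pre_schwarzian: "z \<in> unit_disk \<Longrightarrow>
      cmod z * (1 - (cmod z)\<^sup>2) * cmod (deriv (deriv g) z) \<le> k * cmod (deriv g z)"
    and k: "0 \<le> k" "k < 1"
begin

lemma deriv_hol: "deriv g holomorphic_on unit_disk" "deriv (deriv g) holomorphic_on unit_disk"
  using hol by (auto intro!: holomorphic_deriv)

text \<open>
  Becker's extension of the dilated function \<open>z \<mapsto> g (\<rho> * z) / \<rho>\<close>. The second term vanishes on the
  closed disk. Its exterior values are those of a Loewner chain: the point \<open>exp t * \<zeta>\<close> with
  \<open>cmod \<zeta> = 1\<close> is sent to the boundary value at \<open>\<zeta>\<close> of the \<open>t\<close>-th function of the chain. For \<open>\<rho> < 1\<close> it
  makes sense everywhere; for \<open>\<rho> = 1\<close> it makes sense off the circle.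
\<close>
definition ext :: "real \<Rightarrow> complex \<Rightarrow> complex" where
  "ext \<rho> z = g (of_real \<rho> * circle_fold z) / of_real \<rho>
           + (z - circle_fold z) * deriv g (of_real \<rho> * circle_fold z)"

definition ext_dz :: "real \<Rightarrow> complex \<Rightarrow> complex" where
  "ext_dz \<rho> z = deriv g (of_real \<rho> * circle_fold z)"

definition ext_dzbar :: "real \<Rightarrow> complex \<Rightarrow> complex" where
  "ext_dzbar \<rho> z = - (z - circle_fold z) * of_real \<rho> * deriv (deriv g) (of_real \<rho> * circle_fold z)
                   * (circle_fold z)\<^sup>2"

text \<open>
  For \<open>v = \<rho> * circle_fold z\<close> the factors of \<open>ext_dzbar\<close> other than \<open>g'' v\<close> have a product of modulus at
  most \<open>cmod v * (1 - (cmod v)\<^sup>2)\<close>, so Becker's condition at \<open>v\<close> bounds the Beltrami coefficient at \<open>z\<close>.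
\<close>
lemma ext_dilatation:
  assumes "0 < \<rho>" "\<rho> \<le> 1" "of_real \<rho> * circle_fold z \<in> unit_disk"
  shows "cmod (ext_dzbar \<rho> z) \<le> k * cmod (ext_dz \<rho> z)"
proof -
  define w where "w = circle_fold z"
  have "cmod (ext_dzbar \<rho> z) = cmod (z - w) * cmod w * (\<rho> * cmod w * cmod (deriv (deriv g) (of_real \<rho> * w)))"
    using assms by (simp add: ext_dzbar_def w_def norm_mult norm_power power2_eq_square norm_minus_commute)
  also have "\<dots> \<le> (1 - (\<rho> * cmod w)\<^sup>2) * (\<rho> * cmod w * cmod (deriv (deriv g) (of_real \<rho> * w)))"
  proof (rule mult_right_mono)
    have "\<rho> * cmod w \<le> cmod w" using assms by (simp add: mult_left_le_one_le)
    then have "(\<rho> * cmod w)\<^sup>2 \<le> (cmod w)\<^sup>2" using assms by (intro power_mono) auto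
    with circle_fold_displacement[of z]
    show "cmod (z - w) * cmod w \<le> 1 - (\<rho> * cmod w)\<^sup>2" by (simp add: w_def)
  qed (use assms in auto)
  also have "\<dots> \<le> k * cmod (deriv g (of_real \<rho> * w))"
    using pre_schwarzian[of "of_real \<rho> * w"] assms by (simp add: w_def norm_mult mult_ac)
  finally show ?thesis by (simp add: ext_dz_def w_def)
qed

text \<open>
  The pieces \<open>u\<close> and \<open>v\<close> on the two sides of the circle agree there to first order, because the factor
  \<open>z - circle_fold z\<close> of \<open>ext_dzbar\<close> vanishes on the circle. So the extension is \<open>C\<^sup>1\<close> across it.
\<close>
lemma ext_has_derivative:
  assumes \<rho>: "0 < \<rho>" "\<rho> \<le> 1" and z: "of_real \<rho> * circle_fold z \<in> unit_disk"
  shows "(ext \<rho> has_derivative (\<lambda>h. ext_dz \<rho> z * h + ext_dzbar \<rho> z * cnj h)) (at z)"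
proof -
  define u where "u = (\<lambda>z. g (of_real \<rho> * z) / of_real \<rho>)"
  define v where "v = (\<lambda>z. g (of_real \<rho> * (1 / cnj z)) / of_real \<rho> + (z - 1 / cnj z) * deriv g (of_real \<rho> * (1 / cnj z)))"
  have dg: "(g has_field_derivative deriv g w) (at w)" if "w \<in> unit_disk" for w
    using holomorphic_derivI[OF hol _ that] by simp
  have dg': "(deriv g has_field_derivative deriv (deriv g) w) (at w)" if "w \<in> unit_disk" for w
    using holomorphic_derivI[OF deriv_hol(1) _ that] by simp
  have du: "(u has_derivative (\<lambda>h. ext_dz \<rho> z * h + ext_dzbar \<rho> z * cnj h)) (at z within S)"
    if "cmod z \<le> 1" for S
  proof -
    have "((\<lambda>z. g (of_real \<rho> * z)) has_field_derivative deriv g (of_real \<rho> * z) * of_real \<rho>) (at z)"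
      by (rule DERIV_chain2[of g _ "\<lambda>z. of_real \<rho> * z"])
         (use dg z that in \<open>auto intro!: derivative_eq_intros simp: circle_fold_eq\<close>)
    then have "(u has_field_derivative deriv g (of_real \<rho> * z)) (at z)"
      unfolding u_def using \<rho> by (auto intro!: derivative_eq_intros)
    then have "(u has_derivative (\<lambda>h. deriv g (of_real \<rho> * z) * h)) (at z within S)"
      by (meson has_field_derivative_imp_has_derivative has_derivative_at_withinI)
    moreover have "ext_dz \<rho> z = deriv g (of_real \<rho> * z)" "ext_dzbar \<rho> z = 0"
      using that by (simp_all add: ext_dz_def ext_dzbar_def circle_fold_eq)
    ultimately show ?thesis by simp
  qed
  have dv: "(v has_derivative (\<lambda>h. ext_dz \<rho> z * h + ext_dzbar \<rho> z * cnj h)) (at z within S)"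
    if "cmod z \<ge> 1" for S
  proof -
    have nz: "cnj z \<noteq> 0" using that by auto
    define w where "w = 1 / cnj z"
    have w: "circle_fold z = w" using that by (simp add: circle_fold_eq w_def)
    have z': "of_real \<rho> * w \<in> unit_disk" using z w by simp
    have dw: "((\<lambda>z. 1 / cnj z) has_derivative (\<lambda>h. - (w\<^sup>2 * cnj h))) (at z within S)"
    proof -
      have "((\<lambda>y. 1 / y) has_field_derivative - (1 / (cnj z)\<^sup>2)) (at (cnj z))"
        using nz by (auto intro!: derivative_eq_intros simp: power2_eq_square)
      then have "((\<lambda>y. 1 / y) has_derivative (\<lambda>h. - (1 / (cnj z)\<^sup>2) * h)) (at (cnj z))"
        by (rule has_field_derivative_imp_has_derivative)
      from has_derivative_compose[OF has_derivative_cnj[OF has_derivative_ident] this]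
      show ?thesis by (simp add: w_def power_divide)
    qed
    have d\<rho>w: "((\<lambda>z. of_real \<rho> * (1 / cnj z)) has_derivative (\<lambda>h. of_real \<rho> * - (w\<^sup>2 * cnj h))) (at z within S)"
      by (rule has_derivative_mult_right[OF dw])
    have d1: "((\<lambda>z. g (of_real \<rho> * (1 / cnj z))) has_derivative
        (\<lambda>h. deriv g (of_real \<rho> * w) * (of_real \<rho> * - (w\<^sup>2 * cnj h)))) (at z within S)"
      using has_derivative_compose[OF d\<rho>w has_field_derivative_imp_has_derivative[OF dg]] z' by (simp add: w_def)
    have d2: "((\<lambda>z. deriv g (of_real \<rho> * (1 / cnj z))) has_derivative
        (\<lambda>h. deriv (deriv g) (of_real \<rho> * w) * (of_real \<rho> * - (w\<^sup>2 * cnj h)))) (at z within S)"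
      using has_derivative_compose[OF d\<rho>w has_field_derivative_imp_has_derivative[OF dg']] z' by (simp add: w_def)
    have "(v has_derivative (\<lambda>h. deriv g (of_real \<rho> * w) * (of_real \<rho> * - (w\<^sup>2 * cnj h)) / of_real \<rho>
        + ((z - 1 / cnj z) * (deriv (deriv g) (of_real \<rho> * w) * (of_real \<rho> * - (w\<^sup>2 * cnj h)))
           + (h - - (w\<^sup>2 * cnj h)) * deriv g (of_real \<rho> * (1 / cnj z))))) (at z within S)"
      unfolding v_def
      by (intro has_derivative_add has_derivative_mult has_derivative_diff dw d1 d2
            has_derivative_ident bounded_linear.has_derivative[OF bounded_linear_divide])
    moreover have "(\<lambda>h. deriv g (of_real \<rho> * w) * (of_real \<rho> * - (w\<^sup>2 * cnj h)) / of_real \<rho>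
        + ((z - 1 / cnj z) * (deriv (deriv g) (of_real \<rho> * w) * (of_real \<rho> * - (w\<^sup>2 * cnj h)))
           + (h - - (w\<^sup>2 * cnj h)) * deriv g (of_real \<rho> * (1 / cnj z))))
        = (\<lambda>h. ext_dz \<rho> z * h + ext_dzbar \<rho> z * cnj h)"
      using \<rho> unfolding ext_dz_def ext_dzbar_def w w_def[symmetric] by (simp add: fun_eq_iff algebra_simps)
    ultimately show ?thesis by simp
  qed
  have ext_u: "ext \<rho> z = u z" if "cmod z \<le> 1" for z
    using that by (simp add: ext_def u_def circle_fold_eq)
  have ext_v: "ext \<rho> z = v z" if "cmod z \<ge> 1" for z
    using that by (simp add: ext_def v_def circle_fold_eq)
  define D where "D = (\<lambda>h. ext_dz \<rho> z * h + ext_dzbar \<rho> z * cnj h)"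
  have S: "closure (cball (0::complex) 1) = cball 0 1" "closure (- ball (0::complex) 1) = - ball 0 1"
    by (auto intro!: closure_closed closed_Compl)
  have uv: "u z = v z" if "cmod z = 1" for z using ext_u[of z] ext_v[of z] that by simp
  have "((\<lambda>x. if x \<in> cball 0 1 then u x else v x) has_derivative (if z \<in> cball 0 1 then D else D))
     (at z within (cball 0 1 \<union> - ball 0 1))"
    by (rule has_derivative_If_within_closures[of z "cball 0 1" "- ball 0 1" u "\<lambda>_. D" v "\<lambda>_. D"])
       (use du dv uv in \<open>auto simp: S D_def\<close>)
  moreover have "cball 0 1 \<union> - ball 0 1 = (UNIV :: complex set)" by auto
  moreover have "(\<lambda>x. if x \<in> cball 0 1 then u x else v x) = ext \<rho>"
    using ext_u ext_v by (auto simp: fun_eq_iff)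
  ultimately show ?thesis by (simp add: D_def)
qed

text \<open>
  Integrating Becker's bound for the derivative of \<open>log g'\<close> along a radius from \<open>1/2\<close> on gives the growth
  \<open>(1 - r\<^sup>2) powr (- k / 2)\<close> of \<open>g'\<close>, which is at most the inverse square root since \<open>k < 1\<close>. The
  bound for \<open>g''\<close> follows by inserting this into Becker's condition again. The exponents matter: the
  inverse square root is integrable up to the circle.
\<close>
lemma growth:
  obtains C where "C > 0"
    "\<And>z. z \<in> unit_disk \<Longrightarrow> cmod (deriv g z) \<le> C / sqrt (1 - cmod z)"
    "\<And>z. z \<in> unit_disk \<Longrightarrow> cmod (deriv (deriv g) z) \<le> C / ((1 - cmod z) * sqrt (1 - cmod z))"
proof -
  obtain p where p: "p holomorphic_on unit_disk" "\<And>z. z \<in> unit_disk \<Longrightarrow> deriv g z = exp (p z)"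
    using contractible_imp_holomorphic_log[OF deriv_hol(1) _ deriv_nz] by (auto simp: convex_imp_contractible)
  have p': "deriv p z = deriv (deriv g) z / deriv g z" if z: "z \<in> unit_disk" for z
  proof -
    have "(p has_field_derivative deriv p z) (at z)" using holomorphic_derivI[OF p(1) _ z] by simp
    then have "((\<lambda>z. exp (p z)) has_field_derivative exp (p z) * deriv p z) (at z)"
      by (rule DERIV_chain2[OF DERIV_exp])
    then have "(deriv g has_field_derivative exp (p z) * deriv p z) (at z)"
      by (rule has_field_derivative_transform_within_open[of _ _ _ unit_disk]) (use p z in auto)
    then have "deriv (deriv g) z = deriv g z * deriv p z" using p(2)[OF z] by (simp add: DERIV_imp_deriv)
    then show ?thesis using deriv_nz[OF z] by simp
  qed
  have bnd: "\<exists>M>0. \<forall>z\<in>cball 0 (1/2). cmod (q z) \<le> M" if "q holomorphic_on unit_disk" for q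
  proof -
    have "cball (0::complex) (1/2) \<subseteq> unit_disk" by auto
    then have "compact (q ` cball 0 (1/2))"
      using that by (intro compact_continuous_image) (auto intro: holomorphic_on_imp_continuous_on continuous_on_subset)
    then show ?thesis by (meson bounded_pos compact_imp_bounded imageI)
  qed
  obtain M1 where M1: "M1 > 0" "\<And>z. z \<in> cball 0 (1/2) \<Longrightarrow> cmod (deriv g z) \<le> M1" using bnd[OF deriv_hol(1)] by blast
  obtain M2 where M2: "M2 > 0" "\<And>z. z \<in> cball 0 (1/2) \<Longrightarrow> cmod (deriv (deriv g) z) \<le> M2" using bnd[OF deriv_hol(2)] by blast
  define C1 where "C1 = M1 * exp 1"
  have C1: "C1 \<ge> M1" "C1 > 0" using M1 by (auto simp: C1_def)
  have inv: "1 / sqrt (1 - r) \<ge> 1" "1 / ((1 - r) * sqrt (1 - r)) \<ge> 1" if "0 \<le> r" "r < 1" for r :: real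
    using that by (auto simp: divide_simps mult_le_one)
  have g1: "cmod (deriv g z) \<le> C1 / sqrt (1 - cmod z)" if z: "z \<in> unit_disk" for z
  proof (cases "cmod z \<le> 1/2")
    case True
    have "M1 * 1 \<le> C1 * (1 / sqrt (1 - cmod z))"
      using C1 M1 inv(1)[of "cmod z"] z by (intro mult_mono) auto
    with M1(2)[of z] True show ?thesis by simp
  next
    case False
    define r where "r = cmod z"
    define \<zeta> where "\<zeta> = z / of_real r"
    have r: "1/2 < r" "r < 1" using False z by (auto simp: r_def)
    have \<zeta>: "cmod \<zeta> = 1" "of_real r * \<zeta> = z" using r by (auto simp: \<zeta>_def norm_divide r_def)
    have in_disk: "of_real t * \<zeta> \<in> unit_disk" if "1/2 \<le> t" "t \<le> r" for t
      using that r \<zeta> by (simp add: norm_mult)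
    \<comment> \<open>\<open>\<phi>\<close> is a primitive of \<open>k / (t * (1 - t\<^sup>2))\<close>, the bound for the derivative of \<open>p = log g'\<close>.\<close>
    define \<phi> where "\<phi> = (\<lambda>t. k * (ln t - ln (1 - t\<^sup>2) / 2))"
    have sq: "t\<^sup>2 < 1" if "1/2 \<le> t" "t \<le> r" for t using that r by (simp add: abs_square_less_1)
    have cross_mult: "x / y \<le> c / t" if "y > 0" "t > 0" "t * x \<le> c * y" for c x y t :: real
      using that by (simp add: field_simps)
    have "cmod (p (of_real r * \<zeta>) - p (of_real (1/2) * \<zeta>)) \<le> \<phi> r - \<phi> (1/2)"
    proof (rule differentiable_bound_general[OF r(1)])
      show "continuous_on {1/2..r} (\<lambda>t. p (of_real t * \<zeta>))"
        by (intro continuous_on_compose2[OF holomorphic_on_imp_continuous_on[OF p(1)]] continuous_intros)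
           (use in_disk in auto)
      show "continuous_on {1/2..r} \<phi>"
        unfolding \<phi>_def using sq by (intro continuous_intros ballI) force+
      fix t assume t: "1/2 < t" "t < r"
      then have t': "of_real t * \<zeta> \<in> unit_disk" "t\<^sup>2 < 1" using in_disk sq by auto
      have "((\<lambda>w. p (w * \<zeta>)) has_field_derivative deriv p (of_real t * \<zeta>) * \<zeta>) (at (of_real t))"
        by (rule DERIV_chain2[of p _ "\<lambda>w. w * \<zeta>"])
           (use holomorphic_derivI[OF p(1) _ t'(1)] in \<open>auto intro!: derivative_eq_intros\<close>)
      then show "((\<lambda>t. p (of_real t * \<zeta>)) has_vector_derivative deriv p (of_real t * \<zeta>) * \<zeta>) (at t)"
        by (rule has_vector_derivative_real_field)
      have "4 * t / (4 - t\<^sup>2 * 4) = 2 * t / (2 - t\<^sup>2 * 2)" using t' by (simp add: divide_simps)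
      then have "(\<phi> has_real_derivative k * (1 / t - (- (2 * t)) / (1 - t\<^sup>2) / 2)) (at t)"
        unfolding \<phi>_def using t t' by (auto intro!: derivative_eq_intros)
      moreover have "k * (1 / t - (- (2 * t)) / (1 - t\<^sup>2) / 2) = k / (t * (1 - t\<^sup>2))"
        using t t' by (simp add: field_simps power2_eq_square)
      ultimately show "(\<phi> has_vector_derivative k / (t * (1 - t\<^sup>2))) (at t)"
        by (simp add: has_real_derivative_iff_has_vector_derivative)
      have "cmod (deriv g (of_real t * \<zeta>)) > 0" using deriv_nz[OF t'(1)] by simp
      moreover have "t * (1 - t\<^sup>2) > 0" using t t' by simp
      moreover have "t * (1 - t\<^sup>2) * cmod (deriv (deriv g) (of_real t * \<zeta>)) \<le> k * cmod (deriv g (of_real t * \<zeta>))"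
        using pre_schwarzian[OF t'(1)] t \<zeta> by (simp add: norm_mult)
      ultimately show "cmod (deriv p (of_real t * \<zeta>) * \<zeta>) \<le> k / (t * (1 - t\<^sup>2))"
        unfolding p'[OF t'(1)] norm_mult norm_divide \<zeta>(1) mult_1_right by (rule cross_mult)
    qed
    moreover have "\<phi> r - \<phi> (1/2) \<le> 1 - ln (sqrt (1 - r))"
    proof -
      define Y where "Y = ln 2 - ln (1 - r) / 2"
      have "r\<^sup>2 \<le> r" using r by (simp add: power2_eq_square mult_left_le)
      then have "ln (1 - r) \<le> ln (1 - r\<^sup>2)" using r by simp
      moreover have "ln r \<le> 0" "ln (3/4) \<le> (0::real)" "ln (1/2) = - ln (2::real)" using r by (auto simp: ln_div)
      ultimately have "ln r - ln (1 - r\<^sup>2) / 2 - (ln (1/2) - ln (3/4) / 2) \<le> Y"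
        unfolding Y_def by linarith
      then have "\<phi> r - \<phi> (1/2) \<le> k * Y"
        using mult_left_mono[OF _ k(1)] by (simp add: \<phi>_def power2_eq_square flip: right_diff_distrib)
      also have "\<dots> \<le> Y"
      proof (rule mult_left_le_one_le)
        have "ln (1 - r) \<le> 0" using r by simp
        moreover have "ln 2 > (0::real)" by simp
        ultimately show "0 \<le> Y" unfolding Y_def by linarith
      qed (use k in auto)
      also have "\<dots> \<le> 1 - ln (sqrt (1 - r))" using r ln_2_less_1 by (simp add: Y_def ln_sqrt)
      finally show ?thesis .
    qed
    ultimately have "Re (p z) \<le> Re (p (of_real (1/2) * \<zeta>)) + (1 - ln (sqrt (1 - r)))"
      using abs_Re_le_cmod[of "p (of_real r * \<zeta>) - p (of_real (1/2) * \<zeta>)"] \<zeta> by simp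
    then have "exp (Re (p z)) \<le> exp (Re (p (of_real (1/2) * \<zeta>)) + (1 - ln (sqrt (1 - r))))" by simp
    also have "\<dots> = cmod (deriv g (of_real (1/2) * \<zeta>)) * exp 1 / sqrt (1 - r)"
      using p(2)[OF in_disk[of "1/2"]] r by (simp add: exp_add exp_diff)
    also have "\<dots> \<le> M1 * exp 1 / sqrt (1 - r)"
      using M1(2)[of "of_real (1/2) * \<zeta>"] \<zeta> r by (intro divide_right_mono mult_right_mono) (auto simp: norm_mult)
    finally show ?thesis using p(2)[OF z] by (simp add: C1_def r_def)
  qed
  have g2: "cmod (deriv (deriv g) z) \<le> max M2 (2 * C1) / ((1 - cmod z) * sqrt (1 - cmod z))" if z: "z \<in> unit_disk" for z
  proof (cases "cmod z \<le> 1/2")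
    case True
    have "M2 * 1 \<le> max M2 (2 * C1) * (1 / ((1 - cmod z) * sqrt (1 - cmod z)))"
      using C1 M2 inv(2)[of "cmod z"] z by (intro mult_mono) auto
    with M2(2)[of z] True show ?thesis by simp
  next
    case False
    define r where "r = cmod z"
    have r: "1/2 < r" "r < 1" using False z by (auto simp: r_def)
    have "(1/2) * (1 - r) \<le> r * (1 - r\<^sup>2)"
      using r by (intro mult_mono) (auto simp: power2_eq_square mult_left_le)
    then have "(1/2) * (1 - r) * cmod (deriv (deriv g) z) \<le> r * (1 - r\<^sup>2) * cmod (deriv (deriv g) z)"
      by (intro mult_right_mono) auto
    also have "\<dots> \<le> k * cmod (deriv g z)" using pre_schwarzian[OF z] by (simp add: r_def)
    also have "\<dots> \<le> cmod (deriv g z)" using k by (simp add: mult_left_le_one_le)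
    also have "\<dots> \<le> C1 / sqrt (1 - r)" using g1[OF z] by (simp add: r_def)
    finally have "cmod (deriv (deriv g) z) \<le> 2 * C1 / ((1 - r) * sqrt (1 - r))"
      using r by (simp add: field_simps)
    also have "\<dots> \<le> max M2 (2 * C1) / ((1 - r) * sqrt (1 - r))"
      using r by (intro divide_right_mono) auto
    finally show ?thesis by (simp add: r_def)
  qed
  show ?thesis
  proof (rule that[of "max M2 (2 * C1)"])
    show "max M2 (2 * C1) > 0" using M2 by simp
    show "cmod (deriv g z) \<le> max M2 (2 * C1) / sqrt (1 - cmod z)" if "z \<in> unit_disk" for z
      using g1[OF that] C1 that by (elim order.trans) (intro divide_right_mono, auto)
  qed (use g2 in auto)
qed

lemma continuous_on_ext_parts:
  assumes "0 < \<rho>" "\<rho> \<le> 1" and S: "\<And>z. z \<in> S \<Longrightarrow> of_real \<rho> * circle_fold z \<in> unit_disk"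
  shows "continuous_on S (ext \<rho>)" "continuous_on S (ext_dz \<rho>)" "continuous_on S (ext_dzbar \<rho>)"
proof -
  have W: "continuous_on S circle_fold"
    using continuous_on_circle_fold by (rule continuous_on_subset) auto
  have comp: "continuous_on S (\<lambda>z. q (of_real \<rho> * circle_fold z))" if "q holomorphic_on unit_disk" for q
    by (rule continuous_on_compose2[OF holomorphic_on_imp_continuous_on[OF that]])
       (use S in \<open>auto intro!: continuous_intros W\<close>)
  note c = comp[OF hol] comp[OF deriv_hol(1)] comp[OF deriv_hol(2)]
  show "continuous_on S (ext \<rho>)" "continuous_on S (ext_dz \<rho>)" "continuous_on S (ext_dzbar \<rho>)"
    unfolding ext_def ext_dz_def ext_dzbar_def using assms(1) by (intro continuous_intros c W; simp)+
qed

lemma dilated_in_disk: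
  assumes "0 < \<rho>" "\<rho> < 1"
  shows "of_real \<rho> * circle_fold z \<in> unit_disk" "\<rho> * cmod (circle_fold z) \<le> \<rho>"
proof -
  show 1: "\<rho> * cmod (circle_fold z) \<le> \<rho>"
    using cmod_circle_fold_le[of z] assms by (simp add: mult_left_le)
  show "of_real \<rho> * circle_fold z \<in> unit_disk"
    using le_less_trans[OF 1 assms(2)] assms by (simp add: norm_mult)
qed

lemma ext_dz_nz:
  assumes "of_real \<rho> * circle_fold z \<in> unit_disk"
  shows "ext_dz \<rho> z \<noteq> 0"
  using deriv_nz[OF assms] by (simp add: ext_dz_def)

lemma ext_locally_injective:
  assumes \<rho>: "0 < \<rho>" "\<rho> < 1"
  shows "\<exists>e>0. inj_on (ext \<rho>) (ball z e)"
proof -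
  note dil = dilated_in_disk[OF \<rho>]
  define f' where "f' = (\<lambda>x h. ext_dz \<rho> x * h + ext_dzbar \<rho> x * cnj h)"
  have der: "(ext \<rho> has_derivative f' x) (at x)" for x
    unfolding f'_def using \<rho> dil by (intro ext_has_derivative) auto
  have "cmod (ext_dzbar \<rho> z) \<le> k * cmod (ext_dz \<rho> z)"
    using \<rho> dil by (intro ext_dilatation) auto
  also have "\<dots> < 1 * cmod (ext_dz \<rho> z)"
    using ext_dz_nz[OF dil(1)] k by (intro mult_strict_right_mono) auto
  finally obtain L where L: "bounded_linear L" "L \<circ> f' z = id"
    unfolding f'_def using real_linear_left_inverse by (metis mult_1)
  have cont: "continuous_on UNIV (ext_dz \<rho>)" "continuous_on UNIV (ext_dzbar \<rho>)"
    using \<rho> dil by (auto intro!: continuous_on_ext_parts)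
  have small: "\<exists>d>0. \<forall>x. dist z x < d \<longrightarrow> onorm (\<lambda>v. f' x v - f' z v) < e" if "e > 0" for e
  proof -
    obtain d1 where d1: "d1 > 0" "\<And>x. dist x z < d1 \<Longrightarrow> dist (ext_dz \<rho> x) (ext_dz \<rho> z) < e / 3"
      using cont(1) \<open>e > 0\<close> unfolding continuous_on_iff by (metis UNIV_I divide_pos_pos zero_less_numeral)
    obtain d2 where d2: "d2 > 0" "\<And>x. dist x z < d2 \<Longrightarrow> dist (ext_dzbar \<rho> x) (ext_dzbar \<rho> z) < e / 3"
      using cont(2) \<open>e > 0\<close> unfolding continuous_on_iff by (metis UNIV_I divide_pos_pos zero_less_numeral)
    have "onorm (\<lambda>v. f' x v - f' z v) \<le> 2 * e / 3" if "dist z x < min d1 d2" for x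
    proof (rule onorm_bound)
      fix v
      have "f' x v - f' z v = (ext_dz \<rho> x - ext_dz \<rho> z) * v + (ext_dzbar \<rho> x - ext_dzbar \<rho> z) * cnj v"
        by (simp add: f'_def algebra_simps)
      also have "cmod \<dots> \<le> dist (ext_dz \<rho> x) (ext_dz \<rho> z) * cmod v + dist (ext_dzbar \<rho> x) (ext_dzbar \<rho> z) * cmod v"
        by (rule norm_triangle_le) (simp add: dist_norm norm_mult)
      also have "\<dots> \<le> e / 3 * cmod v + e / 3 * cmod v"
        using d1(2)[of x] d2(2)[of x] that by (intro add_mono mult_right_mono) (auto simp: dist_commute)
      finally show "cmod (f' x v - f' z v) \<le> 2 * e / 3 * cmod v" by (simp add: algebra_simps)
    qed (use \<open>e > 0\<close> in auto)
    then show ?thesis using d1 d2 \<open>e > 0\<close> by (intro exI[of _ "min d1 d2"]) force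
  qed
  obtain r where "r > 0" "inj_on (ext \<rho>) (ball z r)"
    by (rule has_derivative_locally_injective[of z UNIV L f' "ext \<rho>"]) (use L der small in auto)
  then show ?thesis by blast
qed

definition growth_const :: real where
  "growth_const = (SOME c. c > 0 \<and> (\<forall>z\<in>unit_disk. cmod (deriv g z) \<le> c / sqrt (1 - cmod z) \<and>
     cmod (deriv (deriv g) z) \<le> c / ((1 - cmod z) * sqrt (1 - cmod z)) \<and> cmod (g z) \<le> c))"

lemma growth_const_pos:
  "growth_const > 0" and deriv_le: "z \<in> unit_disk \<Longrightarrow> cmod (deriv g z) \<le> growth_const / sqrt (1 - cmod z)"
  and deriv2_le: "z \<in> unit_disk \<Longrightarrow> cmod (deriv (deriv g) z) \<le> growth_const / ((1 - cmod z) * sqrt (1 - cmod z))"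
  and g_le: "z \<in> unit_disk \<Longrightarrow> cmod (g z) \<le> growth_const"
proof -
  obtain c where c: "c > 0" "\<And>z. z \<in> unit_disk \<Longrightarrow> cmod (deriv g z) \<le> c / sqrt (1 - cmod z)"
    "\<And>z. z \<in> unit_disk \<Longrightarrow> cmod (deriv (deriv g) z) \<le> c / ((1 - cmod z) * sqrt (1 - cmod z))"
    using growth by metis
  have g: "cmod (g z) \<le> 2 * c" if z: "z \<in> unit_disk" for z
  proof -
    have in_disk: "of_real t * z \<in> unit_disk" "t * cmod z \<le> cmod z" if "0 \<le> t" "t \<le> 1" for t
    proof -
      show 1: "t * cmod z \<le> cmod z" using that by (simp add: mult_left_le_one_le)
      show "of_real t * z \<in> unit_disk" using le_less_trans[OF 1, of 1] z that by (simp add: norm_mult)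
    qed
    have "cmod (g (of_real 1 * z) - g (of_real 0 * z)) \<le> - 2 * c * sqrt (1 - 1 * cmod z) - - 2 * c * sqrt (1 - 0 * cmod z)"
    proof (rule differentiable_bound_general)
      show "continuous_on {0..1} (\<lambda>t. g (of_real t * z))"
        by (intro continuous_on_compose2[OF holomorphic_on_imp_continuous_on[OF hol]] continuous_intros)
           (use in_disk in auto)
      show "continuous_on {0..1} (\<lambda>t. - 2 * c * sqrt (1 - t * cmod z))" by (intro continuous_intros)
      fix t :: real assume t: "0 < t" "t < 1"
      have tz: "of_real t * z \<in> unit_disk" "t * cmod z < 1" using in_disk[of t] t z by auto
      have "((\<lambda>w. g (w * z)) has_field_derivative deriv g (of_real t * z) * z) (at (of_real t))"
        by (rule DERIV_chain2[of g _ "\<lambda>w. w * z"])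
           (use holomorphic_derivI[OF hol _ tz(1)] in \<open>auto intro!: derivative_eq_intros\<close>)
      then show "((\<lambda>t. g (of_real t * z)) has_vector_derivative deriv g (of_real t * z) * z) (at t)"
        by (rule has_vector_derivative_real_field)
      have "((\<lambda>t. - 2 * c * sqrt (1 - t * cmod z)) has_real_derivative c * cmod z / sqrt (1 - t * cmod z)) (at t)"
        using tz by (auto intro!: derivative_eq_intros simp: field_simps)
      then show "((\<lambda>t. - 2 * c * sqrt (1 - t * cmod z)) has_vector_derivative c * cmod z / sqrt (1 - t * cmod z)) (at t)"
        by (simp add: has_real_derivative_iff_has_vector_derivative)
      show "cmod (deriv g (of_real t * z) * z) \<le> c * cmod z / sqrt (1 - t * cmod z)"
        using mult_right_mono[OF c(2)[OF tz(1)], of "cmod z"] t by (simp add: norm_mult)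
    qed simp
    moreover have "c * sqrt (1 - cmod z) \<ge> 0" using c z by simp
    ultimately show ?thesis by (simp add: g0)
  qed
  have "\<exists>b. b > 0 \<and> (\<forall>z\<in>unit_disk. cmod (deriv g z) \<le> b / sqrt (1 - cmod z) \<and>
     cmod (deriv (deriv g) z) \<le> b / ((1 - cmod z) * sqrt (1 - cmod z)) \<and> cmod (g z) \<le> b)"
  proof (intro exI[of _ "2 * c"] conjI ballI)
    fix z assume z: "z \<in> unit_disk"
    show "cmod (deriv g z) \<le> 2 * c / sqrt (1 - cmod z)"
      by (rule order.trans[OF c(2)[OF z]]) (use c z in \<open>intro divide_right_mono; simp\<close>)
    show "cmod (deriv (deriv g) z) \<le> 2 * c / ((1 - cmod z) * sqrt (1 - cmod z))"
      by (rule order.trans[OF c(3)[OF z]]) (use c z in \<open>intro divide_right_mono; simp\<close>)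
  qed (use c g in auto)
  from someI_ex[OF this, folded growth_const_def] show "growth_const > 0"
    "z \<in> unit_disk \<Longrightarrow> cmod (deriv g z) \<le> growth_const / sqrt (1 - cmod z)"
    "z \<in> unit_disk \<Longrightarrow> cmod (deriv (deriv g) z) \<le> growth_const / ((1 - cmod z) * sqrt (1 - cmod z))"
    "z \<in> unit_disk \<Longrightarrow> cmod (g z) \<le> growth_const" by auto
qed

text \<open>
  Differentiate with respect to the dilation parameter \<open>t\<close>. By the growth bounds the derivative \<open>e' t\<close> is
  \<open>O(1 / sqrt (1 - t))\<close>, uniformly in \<open>z\<close>: near the circle the large second derivative of \<open>g\<close> comes
  with the small factor \<open>z - circle_fold z\<close>. This is integrable in \<open>t\<close> up to \<open>1\<close>.
\<close>
lemma ext_Cauchy_bound: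
  assumes "1/2 \<le> \<sigma>" "\<sigma> \<le> \<rho>" "\<rho> < 1"
  shows "cmod (ext \<rho> z - ext \<sigma> z) \<le> 16 * growth_const * sqrt (1 - \<sigma>)"
proof (cases "\<sigma> = \<rho>")
  case False
  then have less: "\<sigma> < \<rho>" using assms by simp
  define W where "W = circle_fold z"
  have W: "cmod W \<le> 1" by (simp add: W_def cmod_circle_fold_le)
  have in_disk: "of_real t * W \<in> unit_disk" "t * cmod W \<le> t" if "0 < t" "t < 1" for t
    using dilated_in_disk[OF that] by (auto simp: W_def)
  define e' where "e' = (\<lambda>t. (deriv g (of_real t * W) * W * of_real t - g (of_real t * W)) / (of_real t * of_real t)
         + (z - W) * (deriv (deriv g) (of_real t * W) * W))"
  have "cmod (ext \<rho> z - ext \<sigma> z) \<le> - 16 * growth_const * sqrt (1 - \<rho>) - - 16 * growth_const * sqrt (1 - \<sigma>)"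
  proof (rule differentiable_bound_general[OF less])
    have der: "((\<lambda>t. ext t z) has_vector_derivative e' t) (at t)" if t: "0 < t" "t < 1" for t
    proof -
      have lin: "((\<lambda>w. w * W) has_field_derivative W) (at (of_real t))" by (auto intro!: derivative_eq_intros)
      have "((\<lambda>w. g (w * W)) has_field_derivative deriv g (of_real t * W) * W) (at (of_real t))"
        and "((\<lambda>w. deriv g (w * W)) has_field_derivative deriv (deriv g) (of_real t * W) * W) (at (of_real t))"
        using holomorphic_derivI[OF hol _ in_disk(1)[OF t]] holomorphic_derivI[OF deriv_hol(1) _ in_disk(1)[OF t]]
        by (auto intro!: DERIV_chain2[OF _ lin])
      then have "((\<lambda>w. g (w * W) / w + (z - W) * deriv g (w * W)) has_field_derivative e' t) (at (of_real t))"
        unfolding e'_def using t by (auto intro!: derivative_eq_intros)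
      then show ?thesis unfolding ext_def W_def[symmetric] by (rule has_vector_derivative_real_field)
    qed
    show "continuous_on {\<sigma>..\<rho>} (\<lambda>t. ext t z)"
    proof (intro continuous_at_imp_continuous_on ballI)
      fix t assume "t \<in> {\<sigma>..\<rho>}"
      then show "isCont (\<lambda>t. ext t z) t"
        by (intro has_vector_derivative_continuous[OF der]) (use assms in auto)
    qed
    show "continuous_on {\<sigma>..\<rho>} (\<lambda>t. - 16 * growth_const * sqrt (1 - t))" by (intro continuous_intros)
    fix t assume "\<sigma> < t" "t < \<rho>"
    then have t: "1/2 \<le> t" "0 < t" "t < 1" using assms by auto
    show "((\<lambda>t. ext t z) has_vector_derivative e' t) (at t)" using t by (intro der)
    have "((\<lambda>t. - 16 * growth_const * sqrt (1 - t)) has_real_derivative 8 * growth_const / sqrt (1 - t)) (at t)"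
      using t by (auto intro!: derivative_eq_intros simp: field_simps)
    then show "((\<lambda>t. - 16 * growth_const * sqrt (1 - t)) has_vector_derivative 8 * growth_const / sqrt (1 - t)) (at t)"
      by (simp add: has_real_derivative_iff_has_vector_derivative)
    note tW = in_disk[OF t(2,3)]
    define s where "s = 1 - t * cmod W"
    have s: "1 - t \<le> s" "0 < s" "1 - cmod W \<le> s"
      using tW(2) t mult_left_le_one_le[of "cmod W" t] unfolding s_def by (linarith, linarith, simp)
    have sq: "1 / sqrt s \<le> 1 / sqrt (1 - t)" using s t by (intro divide_left_mono) auto
    have one: "1 \<le> 1 / sqrt (1 - t)" using t by (simp add: divide_simps)
    have nW: "cmod (of_real t * W) = t * cmod W" using t by (simp add: norm_mult)
    \<comment> \<open>The three terms of \<open>e' t\<close> contribute \<open>2\<close>, \<open>4\<close> and \<open>2\<close> to the constant \<open>8\<close>.\<close>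
    have "cmod (deriv g (of_real t * W) * W / of_real t) \<le> 2 * growth_const * (1 / sqrt (1 - t))"
    proof -
      have "cmod (deriv g (of_real t * W)) \<le> growth_const * (1 / sqrt s)"
        using deriv_le[OF tW(1)] by (simp add: nW s_def)
      also have "\<dots> \<le> growth_const * (1 / sqrt (1 - t))" using sq growth_const_pos by (intro mult_left_mono) auto
      finally have "cmod (deriv g (of_real t * W)) * (cmod W / t) \<le> growth_const * (1 / sqrt (1 - t)) * 2"
        using W t growth_const_pos by (intro mult_mono) (auto simp: divide_simps)
      then show ?thesis using t by (simp add: norm_mult norm_divide mult.commute)
    qed
    moreover have "cmod (g (of_real t * W) / (of_real t * of_real t)) \<le> 4 * growth_const * (1 / sqrt (1 - t))"
    proof -
      have "1 / (t * t) \<le> 4" using mult_mono[OF t(1) t(1)] t by (simp add: divide_simps)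
      then have "cmod (g (of_real t * W)) * (1 / (t * t)) \<le> growth_const * 4"
        using g_le[OF tW(1)] growth_const_pos by (intro mult_mono) auto
      also have "\<dots> \<le> 4 * growth_const * (1 / sqrt (1 - t))" using mult_left_mono[OF one, of "4 * growth_const"] growth_const_pos by simp
      finally show ?thesis using t by (simp add: norm_mult norm_divide)
    qed
    moreover have "cmod ((z - W) * (deriv (deriv g) (of_real t * W) * W)) \<le> 2 * growth_const * (1 / sqrt (1 - t))"
    proof -
      have "cmod (z - W) * cmod W \<le> 1 - (cmod W)\<^sup>2" using circle_fold_displacement[of z] by (simp add: W_def)
      also have "\<dots> = (1 + cmod W) * (1 - cmod W)" by (simp add: power2_eq_square algebra_simps)
      also have "\<dots> \<le> 2 * s" using W s by (intro mult_mono) auto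
      finally have "cmod (z - W) * cmod W * cmod (deriv (deriv g) (of_real t * W)) \<le> 2 * s * (growth_const / (s * sqrt s))"
        by (rule mult_mono) (use deriv2_le[OF tW(1)] s in \<open>auto simp: nW s_def[symmetric]\<close>)
      also have "\<dots> = 2 * growth_const * (1 / sqrt s)" using s by simp
      also have "\<dots> \<le> 2 * growth_const * (1 / sqrt (1 - t))" using sq growth_const_pos by (intro mult_left_mono) auto
      finally show ?thesis by (simp add: norm_mult mult_ac)
    qed
    moreover have "e' t = deriv g (of_real t * W) * W / of_real t - g (of_real t * W) / (of_real t * of_real t)
         + (z - W) * (deriv (deriv g) (of_real t * W) * W)"
      using t by (simp add: e'_def diff_divide_distrib)
    ultimately show "cmod (e' t) \<le> 8 * growth_const / sqrt (1 - t)"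
      using norm_triangle_ineq[of "deriv g (of_real t * W) * W / of_real t - g (of_real t * W) / (of_real t * of_real t)" "(z - W) * (deriv (deriv g) (of_real t * W) * W)"]
        norm_triangle_ineq4[of "deriv g (of_real t * W) * W / of_real t" "g (of_real t * W) / (of_real t * of_real t)"]
      by simp
  qed
  moreover have "growth_const * sqrt (1 - \<rho>) \<ge> 0" using growth_const_pos assms by simp
  ultimately show ?thesis by simp
qed (use growth_const_pos assms in simp)

text \<open>
  Far out \<open>circle_fold z\<close> is near \<open>0\<close>, where \<open>g'\<close> is near \<open>1\<close>, so the second term of the extension
  grows linearly while the first is bounded. The uniformity in \<open>\<rho>\<close> makes properness survive the
  limit.
\<close>
lemma ext_lower_bound:
  obtains c where "\<And>\<rho> z. 1/2 \<le> \<rho> \<Longrightarrow> \<rho> < 1 \<Longrightarrow> cmod z / 2 - c \<le> cmod (ext \<rho> z)"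
proof -
  have "continuous_on unit_disk (deriv g)" using deriv_hol(1) by (rule holomorphic_on_imp_continuous_on)
  then have "continuous (at 0) (deriv g)" by (simp add: continuous_on_eq_continuous_at)
  then obtain d where d: "d > 0" "\<And>w. dist w 0 < d \<Longrightarrow> dist (deriv g w) (deriv g 0) < 1/2"
    unfolding continuous_at_eps_delta by (metis half_gt_zero zero_less_one)
  define m where "m = max 1 (2 / d)"
  have m: "m \<ge> 1" "1 / m < d" using d by (auto simp: m_def max_def divide_simps mult.commute split: if_splits)
  define c where "c = max (m / 2) (1/2 + 2 * growth_const)"
  have "cmod z / 2 - c \<le> cmod (ext \<rho> z)" if \<rho>: "1/2 \<le> \<rho>" "\<rho> < 1" for \<rho> z
  proof (cases "cmod z \<le> m")
    case True
    then have "cmod z / 2 - c \<le> 0" by (simp add: c_def max_def)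
    then show ?thesis using norm_ge_zero[of "ext \<rho> z"] by linarith
  next
    case False
    define W where "W = circle_fold z"
    have z: "cmod z > 1" "cmod W = 1 / cmod z" using False m by (auto simp: W_def circle_fold_def norm_divide)
    have in_disk: "of_real \<rho> * W \<in> unit_disk" "\<rho> * cmod W \<le> \<rho>" using dilated_in_disk[of \<rho> z] \<rho> by (auto simp: W_def)
    have "\<rho> * cmod W \<le> 1 * (1 / cmod z)" using \<rho> z by (intro mult_mono) auto
    also have "\<dots> \<le> 1 / m" using False m z by (simp add: frac_le)
    also have "\<dots> < d" by (rule m)
    finally have "dist (of_real \<rho> * W) 0 < d" using \<rho> by (simp add: norm_mult)
    from d(2)[OF this] have "cmod (1 - deriv g (of_real \<rho> * W)) \<le> 1/2"
      by (simp add: deriv_0 dist_norm norm_minus_commute)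
    then have "1/2 \<le> cmod (deriv g (of_real \<rho> * W))"
      using norm_triangle_ineq2[of 1 "1 - deriv g (of_real \<rho> * W)"] by simp
    moreover have "cmod z - 1 \<le> cmod (z - W)"
    proof -
      have "cmod W \<le> 1" unfolding W_def by (rule cmod_circle_fold_le)
      with norm_triangle_ineq2[of z W] show ?thesis by linarith
    qed
    ultimately have "(cmod z - 1) * (1/2) \<le> cmod (z - W) * cmod (deriv g (of_real \<rho> * W))"
      using z by (intro mult_mono) auto
    moreover have "cmod (g (of_real \<rho> * W) / of_real \<rho>) \<le> 2 * growth_const"
    proof -
      have "cmod (g (of_real \<rho> * W)) * (1 / \<rho>) \<le> growth_const * 2"
        using g_le[OF in_disk(1)] \<rho> growth_const_pos by (intro mult_mono) (auto simp: divide_simps)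
      then show ?thesis using \<rho> by (simp add: norm_divide)
    qed
    moreover have "cmod (z - W) * cmod (deriv g (of_real \<rho> * W)) - cmod (g (of_real \<rho> * W) / of_real \<rho>) \<le> cmod (ext \<rho> z)"
      using norm_triangle_ineq2[of "(z - W) * deriv g (of_real \<rho> * W)" "- (g (of_real \<rho> * W) / of_real \<rho>)"]
      by (simp add: ext_def W_def norm_mult add.commute)
    ultimately have "(cmod z - 1) * (1/2) - 2 * growth_const \<le> cmod (ext \<rho> z)" by linarith
    moreover have "1/2 + 2 * growth_const \<le> c" by (simp add: c_def)
    ultimately show ?thesis by (simp add: diff_divide_distrib)
  qed
  then show ?thesis by (rule that)
qed

subsection \<open>The limit of the extensions\<close>


definition dil :: "nat \<Rightarrow> real" where "dil n = 1 - 1 / (real n + 2)"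

lemma dil: "1/2 \<le> dil n" "0 < dil n" "dil n < 1" "m \<le> n \<Longrightarrow> dil m \<le> dil n"
  by (auto simp: dil_def frac_le)

lemma dil_tendsto: "dil \<longlonglongrightarrow> 1"
proof -
  have "(\<lambda>n. 1 / (real n + 2)) \<longlonglongrightarrow> 0"
    using LIMSEQ_ignore_initial_segment[OF lim_1_over_n[where 'a = real], of 2] by (simp add: add.commute)
  from tendsto_diff[OF tendsto_const[of 1] this] show ?thesis by (simp add: dil_def[abs_def])
qed

text \<open>
  For \<open>\<rho> = 1\<close> the formula evaluates \<open>g'\<close> on the circle, where it need not have a limit. So the extension
  is defined as a limit of maps for which the formula makes sense everywhere.
\<close>
definition becker_map :: "complex \<Rightarrow> complex" where "becker_map z = lim (\<lambda>n. ext (dil n) z)"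

lemma uniform_limit_becker_map: "uniform_limit UNIV (\<lambda>n. ext (dil n)) becker_map sequentially"
proof -
  have s: "(\<lambda>n. 16 * growth_const * sqrt (1 - dil n)) \<longlonglongrightarrow> 16 * growth_const * sqrt (1 - 1)"
    by (intro tendsto_intros dil_tendsto)
  have "uniformly_Cauchy_on UNIV (\<lambda>n. ext (dil n))"
  proof (rule uniformly_Cauchy_onI')
    fix e :: real assume "e > 0"
    then have "eventually (\<lambda>n. 16 * growth_const * sqrt (1 - dil n) < e) sequentially"
      using s by (intro order_tendstoD(2)[of _ 0]) auto
    then obtain M where M: "\<And>n. n \<ge> M \<Longrightarrow> 16 * growth_const * sqrt (1 - dil n) < e"
      by (auto simp: eventually_sequentially)
    show "\<exists>M. \<forall>x\<in>UNIV. \<forall>m\<ge>M. \<forall>n>m. dist (ext (dil m) x) (ext (dil n) x) < e"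
    proof (intro exI[of _ M] ballI allI impI)
      fix x m n assume "M \<le> m" "m < n"
      then have "cmod (ext (dil n) x - ext (dil m) x) \<le> 16 * growth_const * sqrt (1 - dil m)"
        using dil by (intro ext_Cauchy_bound) auto
      also have "\<dots> < e" using M \<open>M \<le> m\<close> by blast
      finally show "dist (ext (dil m) x) (ext (dil n) x) < e" by (simp add: dist_norm norm_minus_commute)
    qed
  qed
  then show ?thesis
    unfolding becker_map_def[abs_def] uniformly_convergent_uniform_limit_iff[symmetric]
    by (rule Cauchy_uniformly_convergent)
qed

lemma ext_tendsto_becker_map: "(\<lambda>n. ext (dil n) z) \<longlonglongrightarrow> becker_map z"
  using tendsto_uniform_limitI[OF uniform_limit_becker_map] by auto

lemma ext_tendsto_off_circle:
  assumes "cmod z \<noteq> 1"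
  shows "(\<lambda>n. ext (dil n) z) \<longlonglongrightarrow> ext 1 z" "(\<lambda>n. ext_dz (dil n) z) \<longlonglongrightarrow> ext_dz 1 z"
    "(\<lambda>n. ext_dzbar (dil n) z) \<longlonglongrightarrow> ext_dzbar 1 z"
proof -
  define W where "W = circle_fold z"
  have W: "W \<in> unit_disk" using cmod_circle_fold_less[OF assms] by (simp add: W_def)
  have lim: "(\<lambda>n. q (of_real (dil n) * W)) \<longlonglongrightarrow> q (of_real 1 * W)" if "q holomorphic_on unit_disk" for q
  proof (rule isCont_tendsto_compose[of _ q])
    show "isCont q (of_real 1 * W)"
      using holomorphic_on_imp_continuous_on[OF that] W by (simp add: continuous_on_eq_continuous_at)
    show "(\<lambda>n. of_real (dil n) * W) \<longlonglongrightarrow> of_real 1 * W" by (intro tendsto_intros dil_tendsto)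
  qed
  show "(\<lambda>n. ext (dil n) z) \<longlonglongrightarrow> ext 1 z" "(\<lambda>n. ext_dz (dil n) z) \<longlonglongrightarrow> ext_dz 1 z"
    "(\<lambda>n. ext_dzbar (dil n) z) \<longlonglongrightarrow> ext_dzbar 1 z"
    unfolding ext_def ext_dz_def ext_dzbar_def W_def[symmetric]
    by (intro tendsto_intros lim hol deriv_hol dil_tendsto; simp)+
qed

lemma becker_map_off_circle: "cmod z \<noteq> 1 \<Longrightarrow> becker_map z = ext 1 z"
  using LIMSEQ_unique[OF ext_tendsto_becker_map ext_tendsto_off_circle(1)] .

lemma becker_map_inside: "z \<in> unit_disk \<Longrightarrow> becker_map z = g z"
  by (simp add: becker_map_off_circle ext_def circle_fold_eq)

lemma continuous_on_becker_map: "continuous_on UNIV becker_map"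
proof (rule uniform_limit_theorem[OF _ uniform_limit_becker_map])
  show "\<forall>\<^sub>F n in sequentially. continuous_on UNIV (ext (dil n))"
    using dil dilated_in_disk by (intro always_eventually allI continuous_on_ext_parts) (auto intro: less_imp_le)
qed simp

lemma proper_of_lower_bound:
  assumes "\<And>z. cmod z / 2 - c \<le> cmod (f z)" "bounded B"
  shows "bounded (f -` B)"
proof -
  obtain M where M: "\<And>x. x \<in> B \<Longrightarrow> cmod x \<le> M" using assms(2) bounded_iff by blast
  have "cmod z \<le> 2 * (M + c)" if "z \<in> f -` B" for z
    using M[of "f z"] assms(1)[of z] that by auto
  then show ?thesis unfolding bounded_iff by blast
qed

lemma becker_map_proper: "bounded B \<Longrightarrow> bounded (becker_map -` B)"
  and ext_homeomorphism: "\<exists>G. homeomorphism UNIV UNIV (ext (dil n)) G"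
proof -
  obtain c where c: "\<And>\<rho> z. 1/2 \<le> \<rho> \<Longrightarrow> \<rho> < 1 \<Longrightarrow> cmod z / 2 - c \<le> cmod (ext \<rho> z)"
    using ext_lower_bound by blast
  have "cmod z / 2 - c \<le> cmod (becker_map z)" for z
    by (rule LIMSEQ_le_const[OF tendsto_norm[OF ext_tendsto_becker_map]]) (use c[OF dil(1,3)] in blast)
  then show "bounded B \<Longrightarrow> bounded (becker_map -` B)" by (rule proper_of_lower_bound)
  have cont: "continuous_on UNIV (ext (dil n))"
    using dil dilated_in_disk by (intro continuous_on_ext_parts) (auto intro: less_imp_le)
  obtain G where "homeomorphism UNIV UNIV (ext (dil n)) G"
    using proper_local_injection_imp_homeomorphism[OF cont proper_of_lower_bound[OF c[OF dil(1,3)]]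
      ext_locally_injective[OF dil(2,3)]] by blast
  then show "\<exists>G. homeomorphism UNIV UNIV (ext (dil n)) G" by blast
qed

lemma becker_map_fibre: "connected (becker_map -` {w})" "becker_map -` {w} \<noteq> {}"
proof -
  obtain G where "\<And>n. homeomorphism UNIV UNIV (ext (dil n)) (G n)"
    using ext_homeomorphism by metis
  then show "connected (becker_map -` {w})" "becker_map -` {w} \<noteq> {}"
    using fibre_of_limit_of_homeomorphisms[OF _ uniform_limit_becker_map continuous_on_becker_map becker_map_proper] by blast+
qed

text \<open>
  Off the circle the map is differentiable and, by the dilatation bound, its derivative is bounded
  below, so the image of a point is not taken again close to that point.
\<close>
lemma becker_map_isolated_off_circle:
  assumes z: "cmod z \<noteq> 1"
  shows "\<not> z islimpt becker_map -` {becker_map z}"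
proof -
  have in_disk: "of_real 1 * circle_fold z \<in> unit_disk" using cmod_circle_fold_less[OF z] by simp
  define f' where "f' = (\<lambda>h. ext_dz 1 z * h + ext_dzbar 1 z * cnj h)"
  have "(ext 1 has_derivative f') (at z)"
    unfolding f'_def using in_disk by (intro ext_has_derivative) auto
  moreover have "open (- sphere (0::complex) 1)" by auto
  ultimately have "(becker_map has_derivative f') (at z)"
    using z by (intro has_derivative_transform_within_open[of "ext 1" f' z UNIV "- sphere 0 1" becker_map]) (auto simp: becker_map_off_circle)
  define c where "c = (1 - k) * cmod (ext_dz 1 z)"
  have c: "c > 0" using ext_dz_nz[OF in_disk] k by (simp add: c_def)
  have low: "c * cmod h \<le> cmod (f' h)" for h
    unfolding f'_def c_def using ext_dilatation[OF _ _ in_disk] by (intro real_linear_bound_below) auto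
  obtain d where d: "d > 0" "\<And>y. cmod (y - z) < d \<Longrightarrow> cmod (becker_map y - becker_map z - f' (y - z)) \<le> c / 2 * cmod (y - z)"
    using \<open>(becker_map has_derivative f') (at z)\<close> c unfolding has_derivative_at_alt by (meson half_gt_zero)
  have "y = z" if "becker_map y = becker_map z" "cmod (y - z) < d" for y
  proof -
    have "c * cmod (y - z) \<le> c / 2 * cmod (y - z)"
      using d(2)[OF that(2)] low[of "y - z"] that(1) by simp
    then show ?thesis using c by (simp add: mult_le_cancel_right)
  qed
  then have "becker_map -` {becker_map z} \<inter> ball z d \<subseteq> {z}" by (auto simp: dist_norm norm_minus_commute)
  then show ?thesis using d(1) by (metis finite.emptyI finite_insert finite_subset islimpt_eq_infinite_ball)
qed

text \<open>
  As a uniform limit of homeomorphisms the map has connected fibres. A fibre \<open>K\<close> with two points has no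
  isolated point, so it lies on the circle. Then the boundary values of \<open>g\<close> are constant on it, and
  so \<open>g\<close> takes the same value at \<open>0\<close>, which is absurd because \<open>0\<close> is not on the circle.
\<close>
lemma inj_becker_map: "inj becker_map"
proof (rule injI, rule ccontr)
  fix a b assume ab: "becker_map a = becker_map b" "a \<noteq> b"
  define K where "K = becker_map -` {becker_map a}"
  have K: "connected K" "a \<in> K" "b \<in> K" using becker_map_fibre ab by (auto simp: K_def)
  have "K \<subseteq> sphere 0 1"
  proof
    fix z assume "z \<in> K"
    then have "z islimpt K" using K ab by (intro connected_imp_perfect) auto
    then show "z \<in> sphere 0 1" using becker_map_isolated_off_circle[of z] \<open>z \<in> K\<close> by (auto simp: K_def)
  qed
  have "becker_map 0 = becker_map a"
  proof (rule constant_on_circular_continuum_imp_centre)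
    show "continuous_on (cball 0 1) becker_map" using continuous_on_becker_map by (rule continuous_on_subset) auto
    show "becker_map holomorphic_on ball 0 1" using hol by (rule holomorphic_transform) (simp add: becker_map_inside)
    show "becker_map z = becker_map a" if "z \<in> K" for z using that by (auto simp: K_def)
  qed (use K ab \<open>K \<subseteq> sphere 0 1\<close> in auto)
  then have "0 \<in> K" by (simp add: K_def)
  with \<open>K \<subseteq> sphere 0 1\<close> show False by auto
qed

lemma surj_becker_map: "range becker_map = UNIV"
proof -
  have "w \<in> range becker_map" for w using becker_map_fibre(2)[of w] by auto
  then show ?thesis by blast
qed

text \<open>
  The dominating function combines the growth bound for \<open>g'\<close> with the distance of \<open>circle_fold z\<close> to
  the circle, which on a bounded set is comparable to the distance of \<open>z\<close>.
\<close>
lemma distributional_derivatives_becker_map: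
  defines "Fz \<equiv> \<lambda>z. if z \<in> sphere 0 1 then 0 else ext_dz 1 z"
    and "Fzbar \<equiv> \<lambda>z. if z \<in> sphere 0 1 then 0 else ext_dzbar 1 z"
  shows "distributional_dz UNIV becker_map Fz" "distributional_dzbar UNIV becker_map Fzbar"
    "locally_integrable_on Fz UNIV" "locally_integrable_on Fzbar UNIV"
proof -
  have off: "AE z in lborel. z \<notin> sphere (0::complex) 1"
  proof (rule AE_not_in)
    show "sphere (0::complex) 1 \<in> null_sets lborel"
      using negligible_sphere[of "0::complex" 1] by (simp add: negligible_iff_null_sets null_sets_completion_iff)
  qed
  have in_disk: "of_real 1 * circle_fold z \<in> unit_disk" if "z \<in> - sphere 0 1" for z
    using cmod_circle_fold_less[of z] that by simp
  have cont1: "continuous_on (- sphere 0 1) (ext_dz 1)" "continuous_on (- sphere 0 1) (ext_dzbar 1)"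
    using in_disk by (auto intro!: continuous_on_ext_parts)
  have "\<exists>M. \<forall>n. \<forall>z\<in>cball 0 R. cmod (ext (dil n) z) \<le> M" for R
  proof -
    have "continuous_on UNIV (ext (dil 0))"
      using dil dilated_in_disk by (intro continuous_on_ext_parts) (auto intro: less_imp_le)
    then have "compact (ext (dil 0) ` cball 0 R)"
      by (intro compact_continuous_image) (auto intro: continuous_on_subset)
    then obtain M where M: "\<And>z. z \<in> cball 0 R \<Longrightarrow> cmod (ext (dil 0) z) \<le> M"
      by (meson bounded_iff compact_imp_bounded imageI)
    have "cmod (ext (dil n) z) \<le> M + 16 * growth_const * sqrt (1 - dil 0)" if "z \<in> cball 0 R" for n z
      using M[OF that] ext_Cauchy_bound[OF dil(1) dil(4)[of 0 n] dil(3), of z]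
        norm_triangle_ineq2[of "ext (dil n) z" "ext (dil 0) z"] by linarith
    then show ?thesis by blast
  qed
  then obtain M where M: "\<And>R n z. z \<in> cball 0 R \<Longrightarrow> cmod (ext (dil n) z) \<le> M R" by metis
  define \<omega> where "\<omega> = (\<lambda>R z. \<bar>M R\<bar> + growth_const * sqrt (1 + \<bar>R\<bar>) * (1 / sqrt \<bar>cmod z - 1\<bar>))"
  have dz_le: "cmod (ext_dz (dil n) z) \<le> \<omega> R z" if z: "z \<in> cball 0 R" "z \<notin> sphere 0 1" for R n z
  proof -
    define W where "W = circle_fold z"
    define s where "s = \<bar>cmod z - 1\<bar>"
    have s: "s > 0" using z by (simp add: s_def)
    have R: "cmod z \<le> R" using z by simp
    have "s / (1 + \<bar>R\<bar>) \<le> 1 - cmod W"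
    proof (cases "cmod z \<le> 1")
      case True
      then show ?thesis using s by (simp add: W_def circle_fold_eq s_def divide_simps mult_left_le) 
    next
      case False
      then have "z \<noteq> 0" by auto
      then have "1 - cmod W = s / cmod z" using False by (simp add: W_def circle_fold_def norm_divide s_def divide_simps)
      moreover have "s / (1 + \<bar>R\<bar>) \<le> s / cmod z"
      proof (intro divide_left_mono mult_pos_pos)
        show "cmod z > 0" "1 + \<bar>R\<bar> > 0" "cmod z \<le> 1 + \<bar>R\<bar>" "s \<ge> 0" using R s False by linarith+
      qed
      ultimately show ?thesis by simp
    qed
    also have "\<dots> \<le> 1 - dil n * cmod W"
      using dil[of n] by (simp add: mult_left_le_one_le)
    finally have le: "s / (1 + \<bar>R\<bar>) \<le> 1 - dil n * cmod W" .
    have "cmod (ext_dz (dil n) z) \<le> growth_const / sqrt (1 - dil n * cmod W)"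
      using deriv_le[OF dilated_in_disk(1)[OF dil(2,3)], of n z] dil(2)[of n]
      by (simp add: ext_dz_def W_def norm_mult)
    also have "\<dots> \<le> growth_const / sqrt (s / (1 + \<bar>R\<bar>))"
    proof -
      have "s / (1 + \<bar>R\<bar>) > 0" using s by (simp add: add_pos_nonneg)
      moreover from this le have "1 - dil n * cmod W > 0" by linarith
      ultimately show ?thesis using le growth_const_pos by (intro divide_left_mono real_sqrt_le_mono mult_pos_pos) simp_all
    qed
    also have "\<dots> = growth_const * sqrt (1 + \<bar>R\<bar>) * (1 / sqrt s)" by (simp add: real_sqrt_divide)
    also have "\<dots> \<le> \<omega> R z" by (simp add: \<omega>_def s_def)
    finally show ?thesis .
  qed
  have dzbar_le: "cmod (ext_dzbar (dil n) z) \<le> \<omega> R z" if "z \<in> cball 0 R" "z \<notin> sphere 0 1" for R n z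
  proof -
    have "cmod (ext_dzbar (dil n) z) \<le> k * cmod (ext_dz (dil n) z)"
      using dil dilated_in_disk[OF dil(2,3)] by (intro ext_dilatation) (auto intro: less_imp_le)
    also have "\<dots> \<le> cmod (ext_dz (dil n) z)" using k by (simp add: mult_left_le_one_le)
    finally show ?thesis using dz_le[OF that] by (rule order.trans)
  qed
  have F_le: "cmod (ext (dil n) z) \<le> \<omega> R z" if "z \<in> cball 0 R" for R n z
  proof -
    have "growth_const * sqrt (1 + \<bar>R\<bar>) * (1 / sqrt \<bar>cmod z - 1\<bar>) \<ge> 0" using growth_const_pos by simp
    then show ?thesis using M[OF that, of n] by (simp add: \<omega>_def)
  qed
  have \<omega>_int: "set_integrable lborel (cball 0 R) (\<omega> R)" for R
    unfolding \<omega>_def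
  proof (rule set_integral_add)
    show "set_integrable lborel (cball 0 R) (\<lambda>z::complex. \<bar>M R\<bar>)"
      unfolding set_integrable_def by (rule borel_integrable_compact) auto
    show "set_integrable lborel (cball 0 R) (\<lambda>z::complex. growth_const * sqrt (1 + \<bar>R\<bar>) * (1 / sqrt \<bar>cmod z - 1\<bar>))"
      by (rule set_integrable_mult_right) (rule inverse_sqrt_circle_distance_integrable)
  qed
  have der: "(ext (dil n) has_derivative (\<lambda>h. ext_dz (dil n) z * h + ext_dzbar (dil n) z * cnj h)) (at z)" for n z
    using dil dilated_in_disk[OF dil(2,3)] by (intro ext_has_derivative) (auto intro: less_imp_le)
  have cont: "continuous_on UNIV (ext_dz (dil n))" "continuous_on UNIV (ext_dzbar (dil n))" for n
    using dil dilated_in_disk[OF dil(2,3)] by (auto intro!: continuous_on_ext_parts intro: less_imp_le)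
  have meas: "becker_map \<in> borel_measurable borel" "Fz \<in> borel_measurable borel" "Fzbar \<in> borel_measurable borel"
  proof -
    show "becker_map \<in> borel_measurable borel" by (rule borel_measurable_continuous_onI[OF continuous_on_becker_map])
    have "sphere (0::complex) 1 \<in> sets borel" by simp
    then show "Fz \<in> borel_measurable borel" "Fzbar \<in> borel_measurable borel"
      unfolding Fz_def Fzbar_def
      by (rule borel_measurable_continuous_on_if[OF _ continuous_on_const cont1(1)],
          rule borel_measurable_continuous_on_if[OF _ continuous_on_const cont1(2)])
  qed
  have lim: "AE z in lborel. (\<lambda>n. ext (dil n) z) \<longlonglongrightarrow> becker_map z"
    "AE z in lborel. (\<lambda>n. ext_dz (dil n) z) \<longlonglongrightarrow> Fz z"
    "AE z in lborel. (\<lambda>n. ext_dzbar (dil n) z) \<longlonglongrightarrow> Fzbar z"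
  proof -
    show "AE z in lborel. (\<lambda>n. ext (dil n) z) \<longlonglongrightarrow> becker_map z" by (simp add: ext_tendsto_becker_map)
    show "AE z in lborel. (\<lambda>n. ext_dz (dil n) z) \<longlonglongrightarrow> Fz z"
      by (rule eventually_mono[OF off]) (simp add: Fz_def ext_tendsto_off_circle)
    show "AE z in lborel. (\<lambda>n. ext_dzbar (dil n) z) \<longlonglongrightarrow> Fzbar z"
      by (rule eventually_mono[OF off]) (simp add: Fzbar_def ext_tendsto_off_circle)
  qed
  have bound: "AE z in lborel. z \<in> cball 0 R \<longrightarrow> cmod (ext (dil n) z) \<le> \<omega> R z"
    "AE z in lborel. z \<in> cball 0 R \<longrightarrow> cmod (ext_dz (dil n) z) \<le> \<omega> R z"
    "AE z in lborel. z \<in> cball 0 R \<longrightarrow> cmod (ext_dzbar (dil n) z) \<le> \<omega> R z" for R n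
  proof -
    show "AE z in lborel. z \<in> cball 0 R \<longrightarrow> cmod (ext (dil n) z) \<le> \<omega> R z"
      by (intro always_eventually allI impI F_le)
    show "AE z in lborel. z \<in> cball 0 R \<longrightarrow> cmod (ext_dz (dil n) z) \<le> \<omega> R z"
      by (rule eventually_mono[OF off]) (intro impI dz_le)
    show "AE z in lborel. z \<in> cball 0 R \<longrightarrow> cmod (ext_dzbar (dil n) z) \<le> \<omega> R z"
      by (rule eventually_mono[OF off]) (intro impI dzbar_le)
  qed
  show "distributional_dz UNIV becker_map Fz" "distributional_dzbar UNIV becker_map Fzbar"
    "locally_integrable_on Fz UNIV" "locally_integrable_on Fzbar UNIV"
    by (rule distributional_derivatives_of_limit[OF der cont meas lim \<omega>_int bound])+
qed

theorem quasiconformal_extension: "has_quasiconformal_extension k g"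
  unfolding has_quasiconformal_extension_def
proof (intro exI[of _ becker_map] conjI ballI)
  show "becker_map z = g z" if "z \<in> unit_disk" for z by (rule becker_map_inside[OF that])
  define Fz where "Fz = (\<lambda>z. if z \<in> sphere 0 1 then 0 else ext_dz 1 z)"
  define Fzbar where "Fzbar = (\<lambda>z. if z \<in> sphere 0 1 then 0 else ext_dzbar 1 z)"
  have "\<exists>F'. homeomorphism UNIV (range becker_map) becker_map F'"
    using invariance_of_domain_homeomorphism[of UNIV becker_map] continuous_on_becker_map inj_becker_map by auto
  moreover have dilatation: "cmod (Fzbar z) \<le> k * cmod (Fz z)" for z
    using ext_dilatation[of 1 z] cmod_circle_fold_less[of z] by (simp add: Fz_def Fzbar_def)
  moreover have "\<exists>Fz Fzbar. locally_integrable_on Fz UNIV \<and> locally_integrable_on Fzbar UNIV \<and>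
      distributional_dz UNIV becker_map Fz \<and> distributional_dzbar UNIV becker_map Fzbar \<and>
      (AE z in lebesgue. z \<in> UNIV \<longrightarrow> cmod (Fzbar z) \<le> k * cmod (Fz z))"
    by (rule exI[of _ Fz], rule exI[of _ Fzbar])
       (simp add: dilatation distributional_derivatives_becker_map[folded Fz_def Fzbar_def])
  ultimately show "quasiconformal_plane k becker_map"
    unfolding quasiconformal_plane_def quasiconformal_on_def using k surj_becker_map by (simp add: convex_connected)
qed

end

section \<open>The integral operator on functions with derivative of positive real part\<close>

lemma has_quasiconformal_extension_imp_inj_on:
  assumes "has_quasiconformal_extension k g"
  shows "inj_on g unit_disk"
proof -
  obtain F where F: "quasiconformal_plane k F" "\<And>z. z \<in> unit_disk \<Longrightarrow> F z = g z"
    using assms by (auto simp: has_quasiconformal_extension_def)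
  then obtain F' where "homeomorphism UNIV (F ` UNIV) F F'"
    unfolding quasiconformal_plane_def quasiconformal_on_def by blast
  then have "inj F" by (intro inj_on_inverseI[of _ F']) (simp add: homeomorphism_def)
  then have "inj_on F unit_disk" by (rule inj_on_subset) simp
  then show ?thesis using inj_on_cong[of unit_disk F g] F(2) by blast
qed

context
  fixes f :: "complex \<Rightarrow> complex"
  assumes f: "f \<in> class_R"
begin

lemma class_R_props:
  "f holomorphic_on unit_disk" "f 0 = 0" "deriv f 0 = 1"
  "z \<in> unit_disk \<Longrightarrow> Re (deriv f z) > 0"
  using f by (auto simp: class_R_def class_A_def)

lemma quot_nz:
  assumes "z \<in> unit_disk"
  shows "quot f z \<noteq> 0"
proof
  assume "quot f z = 0"
  then have z: "z \<noteq> 0" "f z / z = 0" by (auto simp: quot_def split: if_splits)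
  have "cmod (deriv f z) * (1 - (cmod z)\<^sup>2) \<le> 0"
    using class_R_quotient_bound[OF f assms z(1)] z(2) by simp
  moreover have "1 - (cmod z)\<^sup>2 > 0" using assms by (simp add: abs_square_less_1)
  ultimately have "deriv f z = 0" by (simp add: mult_le_0_iff)
  with class_R_props(4)[OF assms] show False by simp
qed

lemma quot_holomorphic: "quot f holomorphic_on unit_disk"
  by (rule pole_theorem_open_0[OF class_R_props(1) open_ball, of 0]) (auto simp: quot_def class_R_props)

lemma log_quot_props:
  "log_quot f holomorphic_on unit_disk" "log_quot f 0 = 0"
  "z \<in> unit_disk \<Longrightarrow> exp (log_quot f z) = quot f z"
proof -
  obtain L where L: "L holomorphic_on unit_disk" "\<And>z. z \<in> unit_disk \<Longrightarrow> quot f z = exp (L z)"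
    using contractible_imp_holomorphic_log[OF quot_holomorphic _ quot_nz] by (auto simp: convex_imp_contractible)
  have "exp (L 0) = 1" using L(2)[of 0] by (simp add: quot_def)
  then have "(\<lambda>z. L z - L 0) holomorphic_on unit_disk \<and> L 0 - L 0 = 0 \<and>
      (\<forall>z\<in>unit_disk. exp (L z - L 0) = quot f z)"
    using L by (auto intro!: holomorphic_intros simp: exp_diff)
  then have "\<exists>L. L holomorphic_on unit_disk \<and> L 0 = 0 \<and> (\<forall>z\<in>unit_disk. exp (L z) = quot f z)" by blast
  from someI_ex[OF this, folded log_quot_def]
  show "log_quot f holomorphic_on unit_disk" "log_quot f 0 = 0"
    "z \<in> unit_disk \<Longrightarrow> exp (log_quot f z) = quot f z" by auto
qed

text \<open>
  The logarithmic derivative of \<open>f z / z\<close> is the difference bounded in \<open>class_R_quotient_bound\<close>, divided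
  by \<open>z * (f z / z)\<close>.
\<close>
lemma deriv_log_quot_bound:
  assumes z: "z \<in> unit_disk"
  shows "cmod z * (1 - (cmod z)\<^sup>2) * cmod (deriv (log_quot f) z) \<le> 1"
proof (cases "z = 0")
  case False
  define L where "L = log_quot f"
  have "(L has_field_derivative deriv L z) (at z)"
    using holomorphic_derivI[OF log_quot_props(1) _ z] by (simp add: L_def)
  then have "((\<lambda>z. z * exp (L z)) has_field_derivative 1 * exp (L z) + exp (L z) * deriv L z * z) (at z)"
    by (auto intro!: derivative_eq_intros)
  moreover have "((\<lambda>z. z * exp (L z)) has_field_derivative deriv f z) (at z)"
    by (rule has_field_derivative_transform_within_open[of f _ _ unit_disk])
       (use holomorphic_derivI[OF class_R_props(1) _ z] z log_quot_props(3) class_R_props(2) in \<open>auto simp: L_def quot_def\<close>)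
  ultimately have "deriv f z = exp (L z) + exp (L z) * deriv L z * z"
    using DERIV_unique by fastforce
  moreover have q: "exp (L z) = f z / z" using log_quot_props(3)[OF z] False by (simp add: L_def quot_def)
  ultimately have "deriv f z - f z / z = (f z / z) * (z * deriv L z)" by (simp add: mult_ac)
  then have "cmod (f z / z) * (cmod z * cmod (deriv L z)) * (1 - (cmod z)\<^sup>2) \<le> Re (f z / z)"
    using class_R_quotient_bound[OF f z False] by (simp only: norm_mult)
  also have "\<dots> \<le> cmod (f z / z)" by (rule complex_Re_le_cmod)
  finally have "cmod (f z / z) * (cmod z * (1 - (cmod z)\<^sup>2) * cmod (deriv L z)) \<le> cmod (f z / z) * 1"
    by (simp add: mult_ac)
  moreover have "cmod (f z / z) > 0" using q by (metis exp_not_eq_zero zero_less_norm_iff)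
  ultimately show ?thesis unfolding L_def by (simp only: mult_le_cancel_left_pos)
qed simp

lemma quot_power_holomorphic: "quot_power \<alpha> f holomorphic_on unit_disk"
  unfolding quot_power_def[abs_def] by (intro holomorphic_intros log_quot_props)

lemma J_derivative:
  assumes "z \<in> unit_disk"
  shows "(J \<alpha> f has_field_derivative quot_power \<alpha> f z) (at z)"
proof -
  obtain G where G: "\<And>x. x \<in> unit_disk \<Longrightarrow> (G has_field_derivative quot_power \<alpha> f x) (at x within unit_disk)"
    using holomorphic_convex_primitive'[OF convex_ball open_ball quot_power_holomorphic] by blast
  have eq: "J \<alpha> f x = G x - G 0" if x: "x \<in> unit_disk" for x
  proof -
    have "path_image (linepath 0 x) \<subseteq> unit_disk"
      using x by (simp add: closed_segment_subset)
    from contour_integral_primitive[OF G valid_path_linepath this]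
    show ?thesis by (simp add: J_def contour_integral_unique)
  qed
  have "((\<lambda>x. G x - G 0) has_field_derivative quot_power \<alpha> f z) (at z)"
    using G[OF assms] assms by (auto intro!: derivative_eq_intros simp: at_within_open[of _ unit_disk])
  then show ?thesis
    by (rule has_field_derivative_transform_within_open[OF _ open_ball assms]) (simp add: eq)
qed

lemma deriv_J: "z \<in> unit_disk \<Longrightarrow> deriv (J \<alpha> f) z = quot_power \<alpha> f z"
  using J_derivative by (rule DERIV_imp_deriv)

lemma J_class_A: "J \<alpha> f \<in> class_A"
proof -
  have "J \<alpha> f holomorphic_on unit_disk"
    using J_derivative by (meson field_differentiable_at_within field_differentiable_def holomorphic_onI)
  moreover have "J \<alpha> f 0 = 0" by (simp add: J_def)
  moreover have "deriv (J \<alpha> f) 0 = 1" by (simp add: deriv_J quot_power_def log_quot_props)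
  ultimately show ?thesis by (simp add: class_A_def)
qed

lemma becker_J:
  assumes "cmod \<alpha> \<le> k" "k < 1"
  shows "becker (J \<alpha> f) k"
proof
  show "J \<alpha> f holomorphic_on unit_disk" "J \<alpha> f 0 = 0" "deriv (J \<alpha> f) 0 = 1"
    using J_class_A by (auto simp: class_A_def)
  show "0 \<le> k" "k < 1" using assms norm_ge_zero[of \<alpha>] by linarith+
  fix z :: complex assume z: "z \<in> unit_disk"
  show nz: "deriv (J \<alpha> f) z \<noteq> 0" by (simp add: deriv_J[OF z] quot_power_def)
  have "((\<lambda>z. exp (\<alpha> * log_quot f z)) has_field_derivative quot_power \<alpha> f z * (\<alpha> * deriv (log_quot f) z)) (at z)"
    unfolding quot_power_def
    using holomorphic_derivI[OF log_quot_props(1) open_ball z, of UNIV] by (auto intro!: derivative_eq_intros)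
  then have "(deriv (J \<alpha> f) has_field_derivative quot_power \<alpha> f z * (\<alpha> * deriv (log_quot f) z)) (at z)"
    by (rule has_field_derivative_transform_within_open[of _ _ _ unit_disk]) (use z in \<open>auto simp: deriv_J quot_power_def\<close>)
  then have "deriv (deriv (J \<alpha> f)) z = deriv (J \<alpha> f) z * (\<alpha> * deriv (log_quot f) z)"
    by (simp add: DERIV_imp_deriv deriv_J[OF z])
  then have "cmod z * (1 - (cmod z)\<^sup>2) * cmod (deriv (deriv (J \<alpha> f)) z)
      = cmod \<alpha> * cmod (deriv (J \<alpha> f) z) * (cmod z * (1 - (cmod z)\<^sup>2) * cmod (deriv (log_quot f) z))"
    by (simp add: norm_mult mult_ac)
  also have "\<dots> \<le> cmod \<alpha> * cmod (deriv (J \<alpha> f) z) * 1"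
    by (intro mult_left_mono deriv_log_quot_bound z) auto
  also have "\<dots> \<le> k * cmod (deriv (J \<alpha> f) z)" using assms by (simp add: mult_right_mono)
  finally show "cmod z * (1 - (cmod z)\<^sup>2) * cmod (deriv (deriv (J \<alpha> f)) z) \<le> k * cmod (deriv (J \<alpha> f) z)" .
qed

lemma J_uniform_limit:
  assumes a: "a \<longlonglongrightarrow> \<alpha>" and K: "compact K" "K \<subseteq> unit_disk"
  shows "uniform_limit K (\<lambda>n. J (a n) f) (J \<alpha> f) sequentially"
proof -
  obtain r where r: "r < 1" "K \<subseteq> cball 0 r" "0 \<le> r"
  proof (cases "K = {}")
    case False
    then obtain x where x: "x \<in> K" "\<And>y. y \<in> K \<Longrightarrow> cmod y \<le> cmod x"
      using continuous_attains_sup[OF K(1) _ continuous_on_norm[OF continuous_on_id]] by auto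
    then show ?thesis using K(2) by (intro that[of "cmod x"]) auto
  qed (use that[of 0] in auto)
  have "compact (log_quot f ` cball 0 r)"
    using r(1) by (intro compact_continuous_image holomorphic_on_imp_continuous_on
                    holomorphic_on_subset[OF log_quot_props(1)]) auto
  then have "bounded (log_quot f ` cball 0 r)" by (rule compact_imp_bounded)
  then obtain B where "B > 0" "\<forall>x\<in>log_quot f ` cball 0 r. cmod x \<le> B"
    unfolding bounded_pos by blast
  then have B: "B > 0" "\<And>z. z \<in> cball 0 r \<Longrightarrow> cmod (log_quot f z) \<le> B" by auto
  obtain A where "\<forall>x\<in>range a. cmod x \<le> A"
    using convergent_imp_bounded[OF a] unfolding bounded_iff by blast
  then have A: "cmod (a n) \<le> A" for n by simp
  have \<alpha>: "cmod \<alpha> \<le> A" by (rule LIMSEQ_le_const2[OF tendsto_norm[OF a]]) (use A in blast)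
  have A0: "A \<ge> 0" using A[of 0] norm_ge_zero[of "a 0"] by linarith
  have bound: "cmod (J (a n) f z - J \<alpha> f z) \<le> exp (A * B) * B * cmod (a n - \<alpha>)" if z: "z \<in> cball 0 r" for n z
  proof -
    have z1: "cmod z \<le> 1" "z \<in> unit_disk" using z r by auto
    have seg: "closed_segment 0 z \<subseteq> cball 0 r" using z r(3) by (intro closed_segment_subset) auto
    then have seg': "closed_segment 0 z \<subseteq> unit_disk" using r by auto
    have int: "quot_power b f contour_integrable_on linepath 0 z" for b
      by (intro contour_integrable_continuous_linepath holomorphic_on_imp_continuous_on
            holomorphic_on_subset[OF quot_power_holomorphic seg'])
    have "cmod (contour_integral (linepath 0 z) (\<lambda>x. quot_power (a n) f x - quot_power \<alpha> f x))
        \<le> exp (A * B) * (B * cmod (a n - \<alpha>)) * cmod (z - 0)"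
    proof (rule contour_integral_bound_linepath)
      show "(\<lambda>x. quot_power (a n) f x - quot_power \<alpha> f x) contour_integrable_on linepath 0 z"
        by (intro contour_integrable_diff int)
      fix x assume "x \<in> closed_segment 0 z"
      then have Bx: "cmod (log_quot f x) \<le> B" using seg B by blast
      have in_ball: "b * log_quot f x \<in> cball 0 (A * B)" if "cmod b \<le> A" for b
        using that Bx A0 by (auto simp: norm_mult intro!: mult_mono)
      have "cmod (exp (a n * log_quot f x) - exp (\<alpha> * log_quot f x))
          \<le> exp (A * B) * cmod (a n * log_quot f x - \<alpha> * log_quot f x)"
      proof (rule field_differentiable_bound[of "cball 0 (A * B)" exp exp])
        show "cmod (exp w) \<le> exp (A * B)" if "w \<in> cball 0 (A * B)" for w :: complex
          using that complex_Re_le_cmod[of w] by simp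
        show "(exp has_field_derivative exp w) (at w within cball 0 (A * B))" for w :: complex
          by (rule DERIV_subset[OF DERIV_exp]) auto
      qed (use in_ball A \<alpha> in auto)
      also have "cmod (a n * log_quot f x - \<alpha> * log_quot f x) = cmod (log_quot f x) * cmod (a n - \<alpha>)"
        by (simp add: norm_mult[symmetric] algebra_simps)
      also have "\<dots> \<le> B * cmod (a n - \<alpha>)" using Bx by (intro mult_right_mono) auto
      finally show "cmod (quot_power (a n) f x - quot_power \<alpha> f x) \<le> exp (A * B) * (B * cmod (a n - \<alpha>))"
        by (simp add: quot_power_def mult_left_mono)
    qed (use B in auto)
    also have "\<dots> \<le> exp (A * B) * (B * cmod (a n - \<alpha>)) * 1"
      using z1 B by (intro mult_left_mono) auto
    finally show ?thesis unfolding J_def contour_integral_diff[OF int int] by (simp add: mult_ac)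
  qed
  have "(\<lambda>n. exp (A * B) * B * cmod (a n - \<alpha>)) \<longlonglongrightarrow> exp (A * B) * B * cmod (\<alpha> - \<alpha>)"
    by (intro tendsto_intros a)
  then have lim: "(\<lambda>n. exp (A * B) * B * cmod (a n - \<alpha>)) \<longlonglongrightarrow> 0" by simp
  show ?thesis
  proof (rule uniform_limitI)
    fix e :: real assume "e > 0"
    then have "\<forall>\<^sub>F n in sequentially. exp (A * B) * B * cmod (a n - \<alpha>) < e"
      using lim by (rule order_tendstoD(2)[rotated])
    then show "\<forall>\<^sub>F n in sequentially. \<forall>x\<in>K. dist (J (a n) f x) (J \<alpha> f x) < e"
    proof eventually_elim
      case (elim n)
      show ?case
      proof
        fix x assume "x \<in> K"
        then show "dist (J (a n) f x) (J \<alpha> f x) < e"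
          using bound[of x n] r(2) elim by (auto simp: dist_norm)
      qed
    qed
  qed
qed

text \<open>
  On the circle \<open>cmod \<alpha> = 1\<close> Becker's theorem no longer applies. Shrinking \<open>\<alpha>\<close> by factors that tend to
  \<open>1\<close> gives univalent functions converging locally uniformly to \<open>J \<alpha> f\<close>, and Hurwitz's theorem passes
  univalence to the limit.
\<close>
lemma J_class_S:
  assumes "cmod \<alpha> \<le> 1"
  shows "J \<alpha> f \<in> class_S"
proof -
  define a where "a = (\<lambda>n. of_real (1 - 1 / real (Suc n)) * \<alpha>)"
  have "(\<lambda>n. 1 / real (Suc n)) \<longlonglongrightarrow> 0"
    using LIMSEQ_Suc[OF lim_1_over_n[where 'a = real]] by simp
  then have "(\<lambda>n. of_real (1 - 1 / real (Suc n)) * \<alpha>) \<longlonglongrightarrow> of_real (1 - 0) * \<alpha>"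
    by (intro tendsto_intros)
  then have a: "a \<longlonglongrightarrow> \<alpha>" by (simp add: a_def)
  have "cmod (a n) < 1" for n
  proof -
    have "cmod (a n) = (1 - 1 / real (Suc n)) * cmod \<alpha>" by (simp add: a_def norm_mult del: of_real_diff of_nat_Suc)
    also have "\<dots> \<le> (1 - 1 / real (Suc n)) * 1" using assms by (intro mult_left_mono) auto
    also have "\<dots> < 1" by simp
    finally show ?thesis .
  qed
  then have inj: "inj_on (J (a n) f) unit_disk" for n
    by (intro has_quasiconformal_extension_imp_inj_on[of "cmod (a n)"]
          becker.quasiconformal_extension becker_J order.refl)
  have "inj_on (J \<alpha> f) unit_disk"
  proof (rule Hurwitz_injective[of unit_disk "\<lambda>n. J (a n) f"])
    show "J (a n) f holomorphic_on unit_disk" "J \<alpha> f holomorphic_on unit_disk" for n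
      using J_class_A by (auto simp: class_A_def)
    show "uniform_limit K (\<lambda>n. J (a n) f) (J \<alpha> f) sequentially" if "compact K" "K \<subseteq> unit_disk" for K
      using that by (rule J_uniform_limit[OF a])
    show "\<not> J \<alpha> f constant_on unit_disk"
    proof
      assume "J \<alpha> f constant_on unit_disk"
      then obtain c where c: "\<forall>z\<in>unit_disk. J \<alpha> f z = c" unfolding constant_on_def by blast
      have "(J \<alpha> f has_field_derivative 0) (at 0)"
        by (rule has_field_derivative_transform_within_open[of "\<lambda>_. c" _ _ unit_disk]) (auto simp: c)
      then show False using J_class_A[of \<alpha>] by (simp add: class_A_def DERIV_imp_deriv)
    qed
  qed (use inj in auto)
  with J_class_A show ?thesis by (simp add: class_S_def)
qed

end

theorem corollary3p2:
  fixes f :: "complex \<Rightarrow> complex" and k :: real and \<alpha> :: complex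
  assumes "f \<in> class_R" and "0 \<le> k" and "k < 1"
  shows "(cmod \<alpha> \<le> 1 / h r0 \<longrightarrow> J \<alpha> f \<in> class_S) \<and>
         (cmod \<alpha> < k / h r0 \<longrightarrow> has_quasiconformal_extension k (J \<alpha> f))"
proof -
  have h: "h r0 \<ge> 1" using r0_properties by (intro h_ge_1) auto
  have "J \<alpha> f \<in> class_S" if "cmod \<alpha> \<le> 1 / h r0"
  proof (rule J_class_S[OF assms(1)])
    have "1 / h r0 \<le> 1" using h by simp
    with that show "cmod \<alpha> \<le> 1" by linarith
  qed
  moreover have "has_quasiconformal_extension k (J \<alpha> f)" if "cmod \<alpha> < k / h r0"
  proof (intro becker.quasiconformal_extension becker_J[OF assms(1)] assms(3))
    have "k / h r0 \<le> k / 1" using h assms(2) by (intro divide_left_mono) auto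
    with that show "cmod \<alpha> \<le> k" by simp
  qed
  ultimately show ?thesis by blast
qed

end
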